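(* Let $N\ge1$ be an integer, $Q=2N+2$, $s\in(0,1)$ and $p\in\big(1,\frac{Q}{Q-2s}\big)$. Let $u_0,f\in L^\infty(\mathbb{H}^N)\cap L^1_{\mathrm{loc}}(\mathbb{H}^N)$ with $u_0\ge0$ and $\int_{\mathbb{H}^N}f>0$. Then the problem $$\partial_t u+(-\Delta_{\mathbb{H}^N})^s u=|u|^p+f \ \text{ in } \mathbb{H}^N\times(0,T),\qquad u(0,\cdot)=u_0 \ \text{ in } \mathbb{H}^N,$$ does not possess a global-in-time weak solution (that is, a weak solution with $T=+\infty$).
   Context: The Heisenberg group $\mathbb{H}^N$ is $\mathbb{R}^{2N+1}$, with points $\xi=(x,y,w)$, $x,y\in\mathbb{R}^N$, $w\in\mathbb{R}$, and group law $\xi\circ\xi'=(x+x',\,y+y',\,w+w'+2\langle y,x'\rangle-2\langle x,y'\rangle)$; the inverse is $\xi^{-1}=-\xi$. Integrals and $L^q$ spaces are with respect to Lebesgue measure (the Haar measure). The homogeneous dimension is $Q=2N+2$. The homogeneous norm is $\|\xi\|_{\mathbb{H}^N}=\big[\sum_{i=1}^N(x_i^2+y_i^2)^2+w^2\big]^{1/4}$. Fractional sub-Laplacian of order $s\in(0,1)$: $$(-\Delta_{\mathbb{H}^N})^s u(\xi)=-\tfrac12 c(N,s)\int_{\mathbb{H}^N}\frac{u(\xi\circ\eta)+u(\xi\circ\eta^{-1})-2u(\xi)}{\|\eta\|_{\mathbb{H}^N}^{Q+2s}}\,d\eta,$$ for $u$ in the Schwartz class (and, by the same formula, for $u\in C_c^2(\mathbb{H}^N)$),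 where $c(N,s)>0$ is a constant depending only on $N$ and $s$. Weak solution: for $0<T\le\infty$ and $u_0,f\in L^1_{\mathrm{loc}}(\mathbb{H}^N)$, a function $u\in L^p_{\mathrm{loc}}((0,T),L^p_{\mathrm{loc}}(\mathbb{H}^N))$ is a weak solution of the problem if $$-\int_0^T\!\!\int_{\mathbb{H}^N}u\big(\partial_t\phi-(-\Delta_{\mathbb{H}^N})^s\phi\big)=\int_0^T\!\!\int_{\mathbb{H}^N}|u|^p\phi+\int_{\mathbb{H}^N}u_0\,\phi(0,\cdot)+\int_0^T\!\!\int_{\mathbb{H}^N}f\phi$$ (all integrals being well defined) holds for every non-negative test function $\phi\in C_c^1([0,T),C_c^2(\mathbb{H}^N))$ (so $\phi$ vanishes at $t=T$). Here $\phi(0,\cdot)$ is the value of $\phi$ at time $t=0$, and $(-\Delta_{\mathbb{H}^N})^s$ acts in the space variable. It is called global-in-time if $T=+\infty$. *)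

theory Defs
  imports "HOL-Analysis.Analysis"
begin

section \<open>The Heisenberg group\<close>

text \<open>The dimension \<open>N\<close> is \<open>CARD('n)\<close>; a point is a triple \<open>(x, y, w)\<close>. Lebesgue measure is the
  library measure \<open>lebesgue\<close> on this Euclidean space.\<close>

type_synonym 'n heis = "(real ^ 'n) \<times> (real ^ 'n) \<times> real"

definition heis_mult :: "'n::finite heis \<Rightarrow> 'n heis \<Rightarrow> 'n heis"  (infixl "\<circ>\<^sub>H" 70) where
  "\<xi> \<circ>\<^sub>H \<eta> = (case \<xi> of (x, y, w) \<Rightarrow> case \<eta> of (x', y', w') \<Rightarrow>
      (x + x', y + y', w + w' + 2 * (y \<bullet> x') - 2 * (x \<bullet> y')))"

text \<open>The group inverse is the vector space negation, and is written so below.\<close>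

lemma heis_mult_uminus: "\<xi> \<circ>\<^sub>H (- \<xi>) = 0" "(- \<xi>) \<circ>\<^sub>H \<xi> = 0"
  by (auto simp: heis_mult_def zero_prod_def inner_commute split: prod.splits)

definition heis_norm :: "'n::finite heis \<Rightarrow> real" where
  "heis_norm \<xi> = (case \<xi> of (x, y, w) \<Rightarrow>
      (((\<Sum>i\<in>UNIV. ((x $ i)\<^sup>2 + (y $ i)\<^sup>2)\<^sup>2) + w\<^sup>2) powr (1/4)))"

definition heis_hdim :: "'n::finite itself \<Rightarrow> real" where
  "heis_hdim _ = 2 * real CARD('n) + 2"

text \<open>The argument \<open>c\<close> is the normalising constant as a function of \<open>N\<close> and \<open>s\<close>.\<close>

definition frac_sublaplacian ::
    "(nat \<Rightarrow> real \<Rightarrow> real) \<Rightarrow> real \<Rightarrow> ('n::finite heis \<Rightarrow> real) \<Rightarrow> 'n heis \<Rightarrow> real" where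
  "frac_sublaplacian c s u \<xi> =
     - (1/2) * c CARD('n) s *
       (LINT \<eta>|lebesgue. (u (\<xi> \<circ>\<^sub>H \<eta>) + u (\<xi> \<circ>\<^sub>H (- \<eta>)) - 2 * u \<xi>)
                          / heis_norm \<eta> powr (heis_hdim TYPE('n) + 2 * s))"


section \<open>Function spaces\<close>

definition L1_loc :: "('a::euclidean_space \<Rightarrow> real) \<Rightarrow> bool" where
  "L1_loc f \<longleftrightarrow> (\<forall>K. compact K \<longrightarrow> f absolutely_integrable_on K)"

definition L_infty :: "('a::euclidean_space \<Rightarrow> real) \<Rightarrow> bool" where
  "L_infty f \<longleftrightarrow> f \<in> borel_measurable lebesgue \<and> (\<exists>C. AE x in lebesgue. \<bar>f x\<bar> \<le> C)"

text \<open>Integrals with values in the extended reals: \<open>quasi_integrable f\<close> says that the integral of \<open>f\<close>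
  is well defined, i.e. that it is not of the form \<open>\<infinity> - \<infinity>\<close>; then \<open>ext_integral f\<close> is its value.
  (\<open>ennreal\<close> maps negative reals to 0, so the two integrands are the positive and negative part.)\<close>

definition quasi_integrable :: "('a::euclidean_space \<Rightarrow> real) \<Rightarrow> bool" where
  "quasi_integrable f \<longleftrightarrow> f \<in> borel_measurable lebesgue \<and>
     ((\<integral>\<^sup>+ x. ennreal (f x) \<partial>lebesgue) < \<infinity> \<or> (\<integral>\<^sup>+ x. ennreal (- f x) \<partial>lebesgue) < \<infinity>)"

definition ext_integral :: "('a::euclidean_space \<Rightarrow> real) \<Rightarrow> ereal" where
  "ext_integral f = enn2ereal (\<integral>\<^sup>+ x. ennreal (f x) \<partial>lebesgue)
                    - enn2ereal (\<integral>\<^sup>+ x. ennreal (- f x) \<partial>lebesgue)"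

text \<open>The Frechet derivative as a map into the normed space of bounded linear maps; it is meaningful
  where the function is differentiable.\<close>

definition fderiv :: "('a::real_normed_vector \<Rightarrow> 'b::real_normed_vector) \<Rightarrow> 'a \<Rightarrow> 'a \<Rightarrow>\<^sub>L 'b" where
  "fderiv f x = Blinfun (frechet_derivative f (at x))"

definition C2 :: "('a::real_normed_vector \<Rightarrow> real) \<Rightarrow> bool" where
  "C2 f \<longleftrightarrow> (\<forall>x. f differentiable (at x)) \<and> (\<forall>x. fderiv f differentiable (at x)) \<and>
            continuous_on UNIV (fderiv (fderiv f))"

definition Cc2 :: "('a::real_normed_vector \<Rightarrow> real) \<Rightarrow> bool" where
  "Cc2 f \<longleftrightarrow> C2 f \<and> compact (closure {x. f x \<noteq> 0})"

text \<open>Convergence in the \<open>C\<^sup>2\<close> norm: uniform convergence of the functions and of their first and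
  second derivatives.\<close>

definition C2_limit ::
    "('i \<Rightarrow> 'a::real_normed_vector \<Rightarrow> real) \<Rightarrow> ('a \<Rightarrow> real) \<Rightarrow> 'i filter \<Rightarrow> bool" where
  "C2_limit g l F \<longleftrightarrow> uniform_limit UNIV g l F \<and>
     uniform_limit UNIV (\<lambda>i. fderiv (g i)) (fderiv l) F \<and>
     uniform_limit UNIV (\<lambda>i. fderiv (fderiv (g i))) (fderiv (fderiv l)) F"


section \<open>Weak solutions\<close>

definition Lp_loc_Lp_loc :: "real \<Rightarrow> ereal \<Rightarrow> (real \<Rightarrow> 'n::finite heis \<Rightarrow> real) \<Rightarrow> bool" where
  "Lp_loc_Lp_loc p T u \<longleftrightarrow>
     (\<forall>J K. compact J \<and> J \<subseteq> {t. 0 < t \<and> ereal t < T} \<and> compact K \<longrightarrow>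
        set_borel_measurable lebesgue (J \<times> K) (\<lambda>(t, \<xi>). u t \<xi>) \<and>
        set_integrable lebesgue (J \<times> K) (\<lambda>(t, \<xi>). \<bar>u t \<xi>\<bar> powr p))"

text \<open>The space \<open>C\<^sub>c\<^sup>1([0,T), C\<^sub>c\<^sup>2)\<close>: the map \<open>t \<mapsto> \<phi> t\<close> vanishes outside a compact subset
  of \<open>[0,T)\<close>, its values are supported in one fixed compact set, and it is continuously differentiable
  (one-sidedly at 0) with respect to the \<open>C\<^sup>2\<close> norm. For a compactly supported map this is
  \<open>C\<^sup>1\<close> regularity for the inductive limit topology of \<open>C\<^sub>c\<^sup>2\<close>. Values of \<open>\<phi>\<close> at
  times outside \<open>[0,T)\<close> play no role.\<close>

definition test_function :: "ereal \<Rightarrow> (real \<Rightarrow> 'n::finite heis \<Rightarrow> real) \<Rightarrow> bool" where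
  "test_function T \<phi> \<longleftrightarrow>
     (let I = {t. 0 \<le> t \<and> ereal t < T} in
       (\<exists>J K. compact J \<and> J \<subseteq> I \<and> compact K \<and> (\<forall>t\<in>I. \<forall>\<xi>. \<phi> t \<xi> \<noteq> 0 \<longrightarrow> t \<in> J \<and> \<xi> \<in> K)) \<and>
       (\<forall>t\<in>I. Cc2 (\<phi> t)) \<and>
       (\<exists>\<psi>. \<forall>t\<in>I. Cc2 (\<psi> t) \<and>
          C2_limit (\<lambda>r \<xi>. (\<phi> r \<xi> - \<phi> t \<xi>) / (r - t)) (\<psi> t) (at t within I) \<and>
          C2_limit \<psi> (\<psi> t) (at t within I)))"

definition weak_solution ::
    "(nat \<Rightarrow> real \<Rightarrow> real) \<Rightarrow> real \<Rightarrow> real \<Rightarrow> ereal \<Rightarrow> ('n::finite heis \<Rightarrow> real) \<Rightarrow> ('n heis \<Rightarrow> real)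
      \<Rightarrow> (real \<Rightarrow> 'n heis \<Rightarrow> real) \<Rightarrow> bool" where
  "weak_solution c s p T u0 f u \<longleftrightarrow>
     Lp_loc_Lp_loc p T u \<and>
     (\<forall>\<phi>. test_function T \<phi> \<and> (\<forall>t \<xi>. 0 \<le> t \<and> ereal t < T \<longrightarrow> 0 \<le> \<phi> t \<xi>) \<longrightarrow>
       (let D = {t. 0 < t \<and> ereal t < T} \<times> (UNIV :: 'n heis set);
            A = (\<lambda>(t, \<xi>). u t \<xi> * (deriv (\<lambda>r. \<phi> r \<xi>) t - frac_sublaplacian c s (\<phi> t) \<xi>));
            B = (\<lambda>(t, \<xi>). \<bar>u t \<xi>\<bar> powr p * \<phi> t \<xi>);
            U = (\<lambda>\<xi>. u0 \<xi> * \<phi> 0 \<xi>);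
            G = (\<lambda>(t, \<xi>). f \<xi> * \<phi> t \<xi>)
        in set_integrable lebesgue D A \<and> set_integrable lebesgue D B \<and>
           integrable lebesgue U \<and> set_integrable lebesgue D G \<and>
           - (LINT z:D|lebesgue. A z)
             = (LINT z:D|lebesgue. B z) + (LINT \<xi>|lebesgue. U \<xi>) + (LINT z:D|lebesgue. G z)))"

definition global_weak_solution ::
    "(nat \<Rightarrow> real \<Rightarrow> real) \<Rightarrow> real \<Rightarrow> real \<Rightarrow> ('n::finite heis \<Rightarrow> real) \<Rightarrow> ('n heis \<Rightarrow> real)
      \<Rightarrow> (real \<Rightarrow> 'n heis \<Rightarrow> real) \<Rightarrow> bool" where
  "global_weak_solution c s p u0 f u \<longleftrightarrow> weak_solution c s p \<infinity> u0 f u"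

end

theory Submission
  imports Defs
begin

text \<open>The proof is the test function method: for a test function \<open>\<theta>(t) g(\<xi>)\<close> at time scale
  \<open>T = R\<^sup>2\<^sup>s\<close> and space scale \<open>R\<close>, both the time derivative and the fractional sub-Laplacian cost a
  factor \<open>R\<^sup>-\<^sup>2\<^sup>s\<close>, and the linear term they produce is absorbed into \<open>\<bar>u\<bar>\<^sup>p\<close>. With
  \<open>q = p / (p - 1)\<close> what is left is \<open>T \<integral> f g \<le> C T R\<^sup>Q\<^sup>-\<^sup>2\<^sup>s\<^sup>q\<close>. The hypothesis on \<open>p\<close> says exactly that
  \<open>Q < 2sq\<close>, so letting \<open>R\<close> tend to infinity contradicts \<open>\<integral> f > 0\<close>.

  The difficulty is that the operator is nonlocal and that \<open>u\<close> may change sign. Outside the support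
  of a compactly supported \<open>g\<close> the function \<open>(-\<Delta>)\<^sup>s g\<close> does not vanish, while \<open>\<bar>u\<bar>\<^sup>p g\<close> does, so nothing
  is there to absorb the linear term. Absorption needs a weight with \<open>\<bar>(-\<Delta>)\<^sup>s \<Phi>\<bar> \<le> C \<Phi>\<close>
  everywhere. Since \<open>(-\<Delta>)\<^sup>s\<close> of a bump decays like \<open>\<parallel>\<xi>\<parallel>\<close> to the power \<open>- (Q + 2s)\<close>, the right choice
  is \<open>\<Phi> = P\<^sup>-\<^sup>b\<close> with \<open>P(\<xi>) = 1 + (\<bar>x\<bar>\<^sup>2 + \<bar>y\<bar>\<^sup>2)\<^sup>2 + w\<^sup>2\<close> and \<open>4b = Q + 2s\<close>, which is positive,
  integrable, and not compactly supported.

  The weight is reached through the admissible functions \<open>\<Phi> \<cdot> (1 - P/k)\<^sup>3\<close>, cut off at zero. They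
  satisfy \<open>\<bar>(-\<Delta>)\<^sup>s g\<bar> \<le> C \<Phi>\<close> with \<open>C\<close> independent of \<open>k\<close> (\<open>frac_sublaplacian_profile_upper\<close>): for
  small increments the curve \<open>\<tau> \<mapsto> \<xi> \<circ> \<tau>\<eta>\<close> is affine and \<open>P\<close> is a quartic polynomial along it, whose
  derivatives are controlled by \<open>P\<close>; for large increments \<open>\<Phi>\<close> convolved with itself is at most a
  multiple of \<open>\<Phi>\<close>. Passing to the limit in \<open>k\<close> needs \<open>u \<Phi>\<close> to be integrable, and this is hidden in
  the definition of a weak solution: its integrals must exist for every single bump \<open>g\<close>, and away from
  the support of \<open>g\<close> the function \<open>\<bar>(-\<Delta>)\<^sup>s g\<bar>\<close> is at least a multiple of \<open>\<Phi>\<close>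
  (\<open>frac_sublaplacian_profile_lower\<close>, \<open>solution_weighted_integrable\<close>). The resulting estimate for
  the weight itself is \<open>tested_inequality_limit\<close>.\<close>


section \<open>The homogeneous gauge\<close>

text \<open>A polynomial comparable with \<open>1 + \<parallel>\<xi>\<parallel>\<^sup>4\<close>. Unlike \<open>heis_norm\<close> it is smooth and bounded below by 1, so that
  all its real powers are smooth.\<close>

definition bracket :: "'n::finite heis \<Rightarrow> real" where
  "bracket \<xi> = 1 + ((norm (fst \<xi>))\<^sup>2 + (norm (fst (snd \<xi>)))\<^sup>2)\<^sup>2 + (snd (snd \<xi>))\<^sup>2"

text \<open>The automorphic dilations, for which \<open>heis_norm\<close> is homogeneous of degree one.\<close>

definition dil :: "real \<Rightarrow> 'n::finite heis \<Rightarrow> 'n heis" where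
  "dil r \<xi> = (r *\<^sub>R fst \<xi>, r *\<^sub>R fst (snd \<xi>), r\<^sup>2 * snd (snd \<xi>))"

lemma heis_mult_eq:
  "\<xi> \<circ>\<^sub>H \<eta> = (fst \<xi> + fst \<eta>, fst (snd \<xi>) + fst (snd \<eta>),
     snd (snd \<xi>) + snd (snd \<eta>) + 2 * (fst (snd \<xi>) \<bullet> fst \<eta>) - 2 * (fst \<xi> \<bullet> fst (snd \<eta>)))"
  by (auto simp: heis_mult_def split: prod.splits)

lemma heis_mult_assoc: "(\<alpha> \<circ>\<^sub>H \<beta>) \<circ>\<^sub>H \<gamma> = \<alpha> \<circ>\<^sub>H (\<beta> \<circ>\<^sub>H \<gamma>)"
  by (simp add: heis_mult_eq inner_add_left inner_add_right algebra_simps)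

lemma heis_mult_zero [simp]: "\<xi> \<circ>\<^sub>H 0 = \<xi>" "0 \<circ>\<^sub>H \<xi> = \<xi>"
  by (auto simp: heis_mult_eq)

lemma heis_mult_minus_cancel: "(- \<xi>) \<circ>\<^sub>H (\<xi> \<circ>\<^sub>H \<eta>) = \<eta>" "(\<eta> \<circ>\<^sub>H \<xi>) \<circ>\<^sub>H (- \<xi>) = \<eta>"
  by (metis heis_mult_assoc heis_mult_uminus heis_mult_zero)+

lemma dil_mult: "dil r (\<xi> \<circ>\<^sub>H \<eta>) = dil r \<xi> \<circ>\<^sub>H dil r \<eta>"
  by (simp add: dil_def heis_mult_eq algebra_simps power2_eq_square)

lemma dil_minus: "dil r (- \<xi>) = - dil r \<xi>"
  by (simp add: dil_def)

lemma bracket_ge_1 [simp]: "1 \<le> bracket \<xi>"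
  by (simp add: bracket_def)

lemma bracket_pos [simp]: "0 < bracket \<xi>"
  by (rule less_le_trans[OF zero_less_one bracket_ge_1])

lemma bracket_minus [simp]: "bracket (- \<xi>) = bracket \<xi>"
  by (simp add: bracket_def)

text \<open>The quasi-triangle inequality of the gauge. The symplectic term \<open>\<langle>y, x'\<rangle> - \<langle>x, y'\<rangle>\<close> in the group law is
  quadratic in the horizontal variables, and this is compensated by their entering with the fourth power.\<close>

lemma bracket_mult_le: "bracket (\<alpha> \<circ>\<^sub>H \<beta>) \<le> 14 * (bracket \<alpha> + bracket \<beta>)"
proof -
  obtain x y w where a: "\<alpha> = (x, y, w)" by (cases \<alpha>) auto
  obtain x' y' w' where b: "\<beta> = (x', y', w')" by (cases \<beta>) auto
  define A where "A = (norm x)\<^sup>2 + (norm y)\<^sup>2"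
  define A' where "A' = (norm x')\<^sup>2 + (norm y')\<^sup>2"
  define k where "k = y \<bullet> x' - x \<bullet> y'"
  have par: "(norm (u + v))\<^sup>2 \<le> 2 * (norm u)\<^sup>2 + 2 * (norm v)\<^sup>2" for u v :: "real^'n"
    using zero_le_power2[of "norm (u - v)"]
    by (simp add: power2_norm_eq_inner inner_add_left inner_add_right inner_diff_left inner_diff_right inner_commute)
  have A0: "0 \<le> A" "0 \<le> A'" by (auto simp: A_def A'_def)
  have "(norm (x + x'))\<^sup>2 + (norm (y + y'))\<^sup>2 \<le> 2 * A + 2 * A'"
    using par[of x x'] par[of y y'] by (simp add: A_def A'_def)
  then have "((norm (x + x'))\<^sup>2 + (norm (y + y'))\<^sup>2)\<^sup>2 \<le> (2 * A + 2 * A')\<^sup>2"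
    by (intro power_mono) auto
  also have "\<dots> \<le> 8 * A\<^sup>2 + 8 * A'\<^sup>2"
    using zero_le_power2[of "A - A'"] by (simp add: power2_eq_square algebra_simps)
  finally have h: "((norm (x + x'))\<^sup>2 + (norm (y + y'))\<^sup>2)\<^sup>2 \<le> 8 * A\<^sup>2 + 8 * A'\<^sup>2" .
  have "\<bar>k\<bar> \<le> norm y * norm x' + norm x * norm y'"
    unfolding k_def using Cauchy_Schwarz_ineq2[of y x'] Cauchy_Schwarz_ineq2[of x y'] by linarith
  then have "k\<^sup>2 \<le> (norm y * norm x' + norm x * norm y')\<^sup>2"
    by (metis abs_ge_zero power2_abs power_mono)
  also have "\<dots> \<le> A * A'"
    using zero_le_power2[of "norm y * norm y' - norm x * norm x'"]
    by (simp add: A_def A'_def power2_eq_square algebra_simps)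
  also have "\<dots> \<le> (A\<^sup>2 + A'\<^sup>2) / 2"
    using zero_le_power2[of "A - A'"] by (simp add: power2_eq_square algebra_simps)
  finally have k2: "k\<^sup>2 \<le> (A\<^sup>2 + A'\<^sup>2) / 2" .
  have "(w + w' + 2 * k)\<^sup>2 \<le> 3 * w\<^sup>2 + 3 * w'\<^sup>2 + 12 * k\<^sup>2"
    using zero_le_power2[of "w - w'"] zero_le_power2[of "w - 2 * k"] zero_le_power2[of "w' - 2 * k"]
    by (simp add: power2_eq_square algebra_simps)
  also have "\<dots> \<le> 3 * w\<^sup>2 + 3 * w'\<^sup>2 + 6 * A\<^sup>2 + 6 * A'\<^sup>2" using k2 by simp
  finally have v: "(w + w' + 2 * k)\<^sup>2 \<le> 3 * w\<^sup>2 + 3 * w'\<^sup>2 + 6 * A\<^sup>2 + 6 * A'\<^sup>2" .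
  have "bracket (\<alpha> \<circ>\<^sub>H \<beta>) = 1 + ((norm (x + x'))\<^sup>2 + (norm (y + y'))\<^sup>2)\<^sup>2 + (w + w' + 2 * k)\<^sup>2"
    by (simp add: a b bracket_def heis_mult_eq k_def algebra_simps)
  also have "\<dots> \<le> 14 * (bracket \<alpha> + bracket \<beta>)"
  proof -
    have "1 + H + V \<le> 14 * (1 + a + b + (1 + a' + b'))"
      if "H \<le> 8 * a + 8 * a'" "V \<le> 3 * b + 3 * b' + 6 * a + 6 * a'" "0 \<le> b" "0 \<le> b'"
      for H V a a' b b' :: real using that by simp
    from this[OF h v] show ?thesis by (simp add: a b bracket_def A_def A'_def)
  qed
  finally show ?thesis .
qed

lemma bracket_dil: "bracket (dil r \<xi>) = 1 + r ^ 4 * (bracket \<xi> - 1)"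
  by (simp add: bracket_def dil_def power_mult_distrib algebra_simps flip: power_mult)
     (simp add: power2_eq_square power4_eq_xxxx algebra_simps)

text \<open>Weights at different scales are thus comparable, which transfers integrability from scale one to all others.\<close>

lemma bracket_dil_ge:
  assumes "0 < r" "r \<le> 1"
  shows "r ^ 4 * bracket \<xi> \<le> bracket (dil r \<xi>)"
proof -
  have "r ^ 4 \<le> 1" using assms by (intro power_le_one) auto
  then show ?thesis by (simp add: bracket_dil algebra_simps)
qed

lemma heis_norm_nonneg [simp]: "0 \<le> heis_norm \<eta>"
  by (simp add: heis_norm_def split: prod.splits)

lemma heis_norm_pow4:
  "heis_norm \<eta> ^ 4 = (\<Sum>i\<in>UNIV. ((fst \<eta> $ i)\<^sup>2 + (fst (snd \<eta>) $ i)\<^sup>2)\<^sup>2) + (snd (snd \<eta>))\<^sup>2"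
proof -
  have nn: "0 \<le> (\<Sum>i\<in>UNIV. ((fst \<eta> $ i)\<^sup>2 + (fst (snd \<eta>) $ i)\<^sup>2)\<^sup>2) + (snd (snd \<eta>))\<^sup>2"
    by (intro add_nonneg_nonneg sum_nonneg) auto
  have "a \<ge> 0 \<Longrightarrow> (a powr (1/4)) ^ 4 = a" for a :: real
    by (cases "a = 0") (simp_all add: powr_power)
  from this[OF nn] show ?thesis by (cases \<eta>) (simp add: heis_norm_def)
qed

lemma norm_sq_sum: "(norm x)\<^sup>2 + (norm y)\<^sup>2 = (\<Sum>i\<in>UNIV. (x $ i)\<^sup>2 + (y $ i)\<^sup>2)" for x y :: "real^'n::finite"
  by (simp add: power2_norm_eq_inner inner_vec_def sum.distrib flip: power2_eq_square)

lemma heis_norm_le_bracket: "heis_norm \<eta> ^ 4 \<le> bracket \<eta>"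
proof -
  have "(\<Sum>i\<in>UNIV. ((fst \<eta> $ i)\<^sup>2 + (fst (snd \<eta>) $ i)\<^sup>2)\<^sup>2) \<le> (\<Sum>i\<in>UNIV. (fst \<eta> $ i)\<^sup>2 + (fst (snd \<eta>) $ i)\<^sup>2)\<^sup>2"
    by (subst (2) power2_eq_square, subst sum_product, intro sum_mono)
       (simp add: power2_eq_square, rule member_le_sum, auto)
  then show ?thesis unfolding heis_norm_pow4 bracket_def norm_sq_sum by simp
qed

lemma horizontal_le_heis_norm:
  "((norm (fst \<eta>))\<^sup>2 + (norm (fst (snd \<eta>)))\<^sup>2)\<^sup>2 \<le> real CARD('n) * heis_norm (\<eta> :: 'n::finite heis) ^ 4"
proof -
  have "((norm (fst \<eta>))\<^sup>2 + (norm (fst (snd \<eta>)))\<^sup>2)\<^sup>2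
      \<le> real CARD('n) * (\<Sum>i\<in>UNIV. ((fst \<eta> $ i)\<^sup>2 + (fst (snd \<eta>) $ i)\<^sup>2)\<^sup>2)"
    unfolding norm_sq_sum using sum_squared_le_sum_of_squares[of "\<lambda>i. (fst \<eta> $ i)\<^sup>2 + (fst (snd \<eta>) $ i)\<^sup>2" UNIV]
    by (simp add: mult.commute)
  also have "\<dots> \<le> real CARD('n) * heis_norm \<eta> ^ 4"
    unfolding heis_norm_pow4 by (intro mult_left_mono) auto
  finally show ?thesis .
qed

lemma vertical_le_heis_norm: "\<bar>snd (snd \<eta>)\<bar> \<le> heis_norm \<eta> ^ 2"
proof (rule power2_le_imp_le)
  have "0 \<le> (\<Sum>i\<in>UNIV. ((fst \<eta> $ i)\<^sup>2 + (fst (snd \<eta>) $ i)\<^sup>2)\<^sup>2)" by (intro sum_nonneg) auto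
  then show "\<bar>snd (snd \<eta>)\<bar>\<^sup>2 \<le> (heis_norm \<eta> ^ 2)\<^sup>2"
    using heis_norm_pow4[of \<eta>] by (simp flip: power_mult)
qed simp

lemma bracket_le_heis_norm:
  "bracket \<eta> \<le> 1 + (1 + real CARD('n)) * heis_norm (\<eta> :: 'n::finite heis) ^ 4"
proof -
  have "(snd (snd \<eta>))\<^sup>2 \<le> heis_norm \<eta> ^ 4"
    using power_mono[OF vertical_le_heis_norm[of \<eta>], of 2] by (simp flip: power_mult)
  with horizontal_le_heis_norm[of \<eta>] show ?thesis by (simp add: bracket_def algebra_simps)
qed

lemma heis_norm_minus [simp]: "heis_norm (- \<eta>) = heis_norm \<eta>"
  by (simp add: heis_norm_def split: prod.splits)

lemma heis_norm_eq_0 [simp]: "heis_norm \<eta> = 0 \<longleftrightarrow> \<eta> = 0"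
proof
  assume "heis_norm \<eta> = 0"
  then show "\<eta> = 0" using horizontal_le_heis_norm[of \<eta>] vertical_le_heis_norm[of \<eta>]
    by (auto simp: prod_eq_iff add_nonneg_eq_0_iff)
next
  assume "\<eta> = 0" then show "heis_norm \<eta> = 0" by (simp add: heis_norm_def zero_prod_def)
qed

lemma heis_norm_dil: assumes "0 \<le> r" shows "heis_norm (dil r \<eta>) = r * heis_norm \<eta>"
proof (rule power_eq_imp_eq_base[where n = 4])
  have e: "((r * a)\<^sup>2 + (r * b)\<^sup>2)\<^sup>2 = r^4 * (a\<^sup>2 + b\<^sup>2)\<^sup>2" for a b :: real
    by (simp add: power2_eq_square power4_eq_xxxx algebra_simps)
  have e2: "(r\<^sup>2 * a)\<^sup>2 = r^4 * a\<^sup>2" for a :: real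
    by (simp add: power2_eq_square power4_eq_xxxx)
  show "heis_norm (dil r \<eta>) ^ 4 = (r * heis_norm \<eta>) ^ 4"
    unfolding power_mult_distrib heis_norm_pow4
    by (simp add: dil_def e e2 distrib_left sum_distrib_left)
qed (use assms in auto)

lemma continuous_bracket: "continuous_on UNIV bracket"
  unfolding bracket_def by (intro continuous_intros)

lemma continuous_heis_norm: "continuous_on UNIV heis_norm"
proof -
  have e: "heis_norm = (\<lambda>\<eta>. root 4 (heis_norm \<eta> ^ 4))"
    by (simp add: real_root_power_cancel fun_eq_iff)
  show ?thesis
    by (subst e, unfold heis_norm_pow4) (intro continuous_intros)
qed

lemma continuous_dil: "continuous_on UNIV (dil r)"
  unfolding dil_def by (intro continuous_intros)

lemma continuous_heis_mult: "continuous_on UNIV (\<lambda>\<eta>. \<xi> \<circ>\<^sub>H \<eta>)"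
  unfolding heis_mult_eq by (intro continuous_intros)

lemma borel_measurable_heis [measurable]:
  "bracket \<in> borel_measurable borel" "heis_norm \<in> borel_measurable borel"
  "dil r \<in> borel_measurable borel" "(\<lambda>\<eta>. \<xi> \<circ>\<^sub>H \<eta>) \<in> borel_measurable borel"
  by (rule borel_measurable_continuous_onI continuous_bracket continuous_heis_norm
      continuous_dil continuous_heis_mult)+

lemma bounded_bracket_sublevel: "bounded {\<xi> :: 'n::finite heis. bracket \<xi> \<le> M}"
proof (rule boundedI)
  fix \<xi> :: "'n heis" assume "\<xi> \<in> {\<xi>. bracket \<xi> \<le> M}"
  then have M: "bracket \<xi> \<le> M" by simp
  have sq: "t \<le> 1 + t\<^sup>2" for t :: real using zero_le_power2[of "t - 1"] by (simp add: power2_eq_square algebra_simps)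
      (smt (verit) zero_le_square)
  define h where "h = (norm (fst \<xi>))\<^sup>2 + (norm (fst (snd \<xi>)))\<^sup>2"
  have "norm \<xi> \<le> norm (fst \<xi>) + norm (snd \<xi>)" by (metis norm_Pair_le prod.collapse)
  also have "norm (snd \<xi>) \<le> norm (fst (snd \<xi>)) + norm (snd (snd \<xi>))" by (metis norm_Pair_le prod.collapse)
  finally have "norm \<xi> \<le> norm (fst \<xi>) + norm (fst (snd \<xi>)) + \<bar>snd (snd \<xi>)\<bar>" by simp
  also have "\<dots> \<le> 3 + h + (snd (snd \<xi>))\<^sup>2"
    using sq[of "norm (fst \<xi>)"] sq[of "norm (fst (snd \<xi>))"] sq[of "\<bar>snd (snd \<xi>)\<bar>"] by (simp add: h_def)
  also have "\<dots> \<le> 3 + bracket \<xi>"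
    using sq[of h] by (simp add: bracket_def flip: h_def)
  finally show "norm \<xi> \<le> 3 + M" using M by simp
qed

lemma compact_bracket_sublevel: "compact {\<xi> :: 'n::finite heis. bracket \<xi> \<le> M}"
  using bounded_bracket_sublevel continuous_bracket
  by (auto simp: compact_eq_bounded_closed intro!: closed_Collect_le continuous_intros)


section \<open>Lebesgue measure under translations and dilations\<close>

lemma nn_integral_lborel_translate:
  fixes f :: "'a::euclidean_space \<Rightarrow> ennreal"
  assumes [measurable]: "f \<in> borel_measurable borel"
  shows "(\<integral>\<^sup>+x. f (t + x) \<partial>lborel) = (\<integral>\<^sup>+x. f x \<partial>lborel)"
  by (subst (2) lborel_distr_plus[of t, symmetric]) (simp add: nn_integral_distr)

lemma nn_integral_lborel_scale:
  fixes f :: "'a::euclidean_space \<Rightarrow> ennreal"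
  assumes [measurable]: "f \<in> borel_measurable borel" and "c \<noteq> 0"
  shows "ennreal (\<bar>c\<bar> ^ DIM('a)) * (\<integral>\<^sup>+x. f (c *\<^sub>R x) \<partial>lborel) = (\<integral>\<^sup>+x. f x \<partial>lborel)"
  by (subst (2) lborel_affine[OF assms(2), of 0]) (simp add: nn_integral_density nn_integral_distr nn_integral_cmult)

lemma nn_integral_heis:
  fixes f :: "'n::finite heis \<Rightarrow> ennreal"
  assumes [measurable]: "f \<in> borel_measurable borel"
  shows "(\<integral>\<^sup>+\<eta>. f \<eta> \<partial>lborel) = (\<integral>\<^sup>+x. \<integral>\<^sup>+y. \<integral>\<^sup>+w. f (x, y, w) \<partial>lborel \<partial>lborel \<partial>lborel)"
proof -
  have "(\<integral>\<^sup>+\<eta>. f \<eta> \<partial>lborel) = (\<integral>\<^sup>+\<eta>. f \<eta> \<partial>(lborel \<Otimes>\<^sub>M lborel))" by (simp add: lborel_prod)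
  also have "\<dots> = (\<integral>\<^sup>+x. \<integral>\<^sup>+z. f (x, z) \<partial>lborel \<partial>lborel)"
    by (subst lborel.nn_integral_fst) (simp_all add: lborel_prod)
  also have "\<dots> = (\<integral>\<^sup>+x. \<integral>\<^sup>+z. f (x, z) \<partial>(lborel \<Otimes>\<^sub>M lborel) \<partial>lborel)" by (simp add: lborel_prod)
  also have "\<dots> = (\<integral>\<^sup>+x. \<integral>\<^sup>+y. \<integral>\<^sup>+w. f (x, y, w) \<partial>lborel \<partial>lborel \<partial>lborel)"
    by (subst lborel.nn_integral_fst) (simp_all add: lborel_prod)
  finally show ?thesis .
qed

text \<open>Left translations are shears: for fixed horizontal variables the last variable is translated by a constant,
  so Fubini reduces the invariance to that of one-dimensional and Euclidean Lebesgue measure.\<close>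

lemma nn_integral_heis_mult:
  fixes f :: "'n::finite heis \<Rightarrow> ennreal"
  assumes [measurable]: "f \<in> borel_measurable borel"
  shows "(\<integral>\<^sup>+\<eta>. f (\<xi> \<circ>\<^sub>H \<eta>) \<partial>lborel) = (\<integral>\<^sup>+\<eta>. f \<eta> \<partial>lborel)"
proof -
  obtain x y w where xi: "\<xi> = (x, y, w)" by (cases \<xi>) auto
  have w: "(\<integral>\<^sup>+w'. f (x', y', w + w' + 2 * c - 2 * d) \<partial>lborel) = (\<integral>\<^sup>+w'. f (x', y', w') \<partial>lborel)" for x' y' c d
    using nn_integral_lborel_translate[of "\<lambda>w'. f (x', y', w')" "w + 2 * c - 2 * d"] by (simp add: algebra_simps)
  have "(\<integral>\<^sup>+\<eta>. f (\<xi> \<circ>\<^sub>H \<eta>) \<partial>lborel) = (\<integral>\<^sup>+x'. \<integral>\<^sup>+y'. \<integral>\<^sup>+w'. f (x + x', y + y', w') \<partial>lborel \<partial>lborel \<partial>lborel)"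
    by (subst nn_integral_heis) (measurable, simp add: xi heis_mult_eq w)
  also have "\<dots> = (\<integral>\<^sup>+x'. \<integral>\<^sup>+y'. \<integral>\<^sup>+w'. f (x', y', w') \<partial>lborel \<partial>lborel \<partial>lborel)"
    by (subst nn_integral_lborel_translate, simp, subst nn_integral_lborel_translate) simp_all
  finally show ?thesis by (simp add: nn_integral_heis)
qed

lemma nn_integral_heis_minus:
  fixes f :: "'n::finite heis \<Rightarrow> ennreal"
  assumes "f \<in> borel_measurable borel"
  shows "(\<integral>\<^sup>+\<eta>. f (- \<eta>) \<partial>lborel) = (\<integral>\<^sup>+\<eta>. f \<eta> \<partial>lborel)"
  using nn_integral_lborel_scale[OF assms, of "-1"] by simp

lemma nn_integral_dil:
  fixes f :: "'n::finite heis \<Rightarrow> ennreal"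
  assumes [measurable]: "f \<in> borel_measurable borel" and r: "0 < r"
  shows "ennreal (r powr heis_hdim TYPE('n)) * (\<integral>\<^sup>+\<eta>. f (dil r \<eta>) \<partial>lborel) = (\<integral>\<^sup>+\<eta>. f \<eta> \<partial>lborel)"
proof -
  have Q: "r powr heis_hdim TYPE('n) = r ^ CARD('n) * (r ^ CARD('n) * r\<^sup>2)"
  proof -
    have "heis_hdim TYPE('n) = real (CARD('n) + (CARD('n) + 2))" by (simp add: heis_hdim_def)
    then show ?thesis using r by (simp only: powr_realpow power_add)
  qed
  have "(\<integral>\<^sup>+\<eta>. f \<eta> \<partial>lborel) = (\<integral>\<^sup>+x. \<integral>\<^sup>+y. \<integral>\<^sup>+w. f (x, y, w) \<partial>lborel \<partial>lborel \<partial>lborel)"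
    by (rule nn_integral_heis) simp
  also have "\<dots> = (\<integral>\<^sup>+x. \<integral>\<^sup>+y. ennreal (r\<^sup>2) * (\<integral>\<^sup>+w. f (x, y, r\<^sup>2 * w) \<partial>lborel) \<partial>lborel \<partial>lborel)"
    using r by (subst nn_integral_lborel_scale[of _ "r\<^sup>2", symmetric]) simp_all
  also have "\<dots> = (\<integral>\<^sup>+x. ennreal (r ^ CARD('n)) * (\<integral>\<^sup>+y. ennreal (r\<^sup>2) * (\<integral>\<^sup>+w. f (x, r *\<^sub>R y, r\<^sup>2 * w) \<partial>lborel) \<partial>lborel) \<partial>lborel)"
    using r by (subst nn_integral_lborel_scale[of _ "r", symmetric]) simp_all
  also have "\<dots> = ennreal (r ^ CARD('n)) * (\<integral>\<^sup>+x. ennreal (r ^ CARD('n)) * (\<integral>\<^sup>+y. ennreal (r\<^sup>2) * (\<integral>\<^sup>+w. f (r *\<^sub>R x, r *\<^sub>R y, r\<^sup>2 * w) \<partial>lborel) \<partial>lborel) \<partial>lborel)"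
    using r by (subst nn_integral_lborel_scale[of _ "r", symmetric]) simp_all
  also have "\<dots> = ennreal (r powr heis_hdim TYPE('n)) * (\<integral>\<^sup>+x. \<integral>\<^sup>+y. \<integral>\<^sup>+w. f (r *\<^sub>R x, r *\<^sub>R y, r\<^sup>2 * w) \<partial>lborel \<partial>lborel \<partial>lborel)"
    using r by (simp add: nn_integral_cmult Q ennreal_mult mult.assoc)
  also have "(\<integral>\<^sup>+x. \<integral>\<^sup>+y. \<integral>\<^sup>+w. f (r *\<^sub>R x, r *\<^sub>R y, r\<^sup>2 * w) \<partial>lborel \<partial>lborel \<partial>lborel) = (\<integral>\<^sup>+\<eta>. f (dil r \<eta>) \<partial>lborel)"
    by (subst nn_integral_heis) (measurable, simp add: dil_def)
  finally show ?thesis ..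
qed

lemma heis_norm_sublevel_bracket:
  "{\<eta> :: 'n::finite heis. heis_norm \<eta> \<le> M} \<subseteq> {\<eta>. bracket \<eta> \<le> 1 + (1 + real CARD('n)) * M ^ 4}"
proof safe
  fix \<eta> :: "'n heis" assume "heis_norm \<eta> \<le> M"
  then have "(1 + real CARD('n)) * heis_norm \<eta> ^ 4 \<le> (1 + real CARD('n)) * M ^ 4"
    by (intro mult_left_mono power_mono) auto
  then show "bracket \<eta> \<le> 1 + (1 + real CARD('n)) * M ^ 4" using bracket_le_heis_norm[of \<eta>] by linarith
qed

lemma emeasure_heis_norm_sublevel: "emeasure lborel {\<eta> :: 'n::finite heis. heis_norm \<eta> \<le> M} < \<infinity>"
proof (rule emeasure_bounded_finite)
  show "bounded {\<eta> :: 'n heis. heis_norm \<eta> \<le> M}"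
    by (rule bounded_subset[OF bounded_bracket_sublevel heis_norm_sublevel_bracket])
qed

text \<open>Decomposition into dilated copies of one shell. The \<open>j\<close>-th shell contributes at most
  \<open>\<sigma>\<close> to the power \<open>j (Q - a)\<close> times the measure of the unit shell, a geometric series. The choice \<open>\<sigma> = 1/2\<close> covers the
  unit ball and \<open>\<sigma> = 2\<close> its complement.\<close>

lemma nn_integral_heis_norm_powr_dyadic:
  fixes A :: "'n::finite heis set"
  assumes [measurable]: "A \<in> sets borel"
    and \<sigma>: "0 < \<sigma>" "\<sigma> powr (heis_hdim TYPE('n) - a) < 1" and "0 \<le> a"
    and cover: "\<And>\<eta>. \<eta> \<in> A \<Longrightarrow> \<exists>j::nat. \<sigma> ^ j \<le> heis_norm \<eta> \<and> heis_norm \<eta> \<le> 2 * \<sigma> ^ j"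
  shows "(\<integral>\<^sup>+\<eta>. indicator A \<eta> * ennreal (heis_norm \<eta> powr - a) \<partial>lborel) < \<infinity>"
proof -
  define S where "S = {\<eta> :: 'n heis. 1 \<le> heis_norm \<eta> \<and> heis_norm \<eta> \<le> 2}"
  define Q where "Q = heis_hdim TYPE('n)"
  have [measurable]: "S \<in> sets borel" unfolding S_def by measurable
  define V where "V = enn2real (emeasure lborel S)"
  have "emeasure lborel S \<le> emeasure lborel {\<eta> :: 'n heis. heis_norm \<eta> \<le> 2}"
    by (intro emeasure_mono) (auto simp: S_def)
  then have V: "emeasure lborel S = ennreal V"
    unfolding V_def using le_less_trans[OF _ emeasure_heis_norm_sublevel[of 2]]
    by (intro ennreal_enn2real[symmetric]) auto
  have pt: "indicator A \<eta> * ennreal (heis_norm \<eta> powr - a)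
      \<le> (\<Sum>j. ennreal ((\<sigma> ^ j) powr - a) * indicator S (dil (1 / \<sigma> ^ j) \<eta>))" for \<eta> :: "'n heis"
  proof (cases "\<eta> \<in> A")
    case True
    then obtain j :: nat where j: "\<sigma> ^ j \<le> heis_norm \<eta>" "heis_norm \<eta> \<le> 2 * \<sigma> ^ j" using cover by blast
    have "\<sigma> ^ j > 0" using \<sigma> by simp
    then have "dil (1 / \<sigma> ^ j) \<eta> \<in> S" using j by (simp add: S_def heis_norm_dil field_simps)
    moreover have "heis_norm \<eta> powr - a \<le> (\<sigma> ^ j) powr - a"
      using j \<open>\<sigma> ^ j > 0\<close> \<open>0 \<le> a\<close> by (intro powr_mono2') auto
    ultimately have "indicator A \<eta> * ennreal (heis_norm \<eta> powr - a)
        \<le> ennreal ((\<sigma> ^ j) powr - a) * indicator S (dil (1 / \<sigma> ^ j) \<eta>)"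
      using True by (simp add: ennreal_leI)
    also have "\<dots> \<le> (\<Sum>j. ennreal ((\<sigma> ^ j) powr - a) * indicator S (dil (1 / \<sigma> ^ j) \<eta>))"
    proof -
      have "g j \<le> suminf g" for g :: "nat \<Rightarrow> ennreal" using sum_le_suminf[of g "{j}"] by simp
      from this[of "\<lambda>j. ennreal ((\<sigma> ^ j) powr - a) * indicator S (dil (1 / \<sigma> ^ j) \<eta>)"] show ?thesis .
    qed
    finally show ?thesis .
  qed simp
  have shell: "(\<integral>\<^sup>+\<eta>. indicator S (dil (1 / \<sigma> ^ j) \<eta>) \<partial>lborel) = ennreal ((\<sigma> ^ j) powr Q * V)" for j
  proof -
    have "(\<integral>\<^sup>+\<eta>. indicator S (dil (1 / \<sigma> ^ j) \<eta>) \<partial>lborel)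
       = ennreal ((\<sigma> ^ j) powr Q) * (ennreal ((1 / \<sigma> ^ j) powr Q) * (\<integral>\<^sup>+\<eta>. indicator S (dil (1 / \<sigma> ^ j) \<eta>) \<partial>lborel))"
      using \<sigma> by (simp add: mult.assoc[symmetric] ennreal_mult[symmetric] powr_divide)
    also have "\<dots> = ennreal ((\<sigma> ^ j) powr Q) * (\<integral>\<^sup>+\<eta>. indicator S \<eta> \<partial>lborel)"
      unfolding Q_def using \<sigma> by (subst nn_integral_dil) simp_all
    finally show ?thesis by (simp add: V ennreal_mult')
  qed
  have pw: "(\<sigma> ^ j) powr x = (\<sigma> powr x) ^ j" for j x
    using \<sigma> by (induction j) (simp_all add: powr_mult)
  have "\<sigma> powr (Q - a) = \<sigma> powr - a * \<sigma> powr Q" by (simp flip: powr_add)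
  then have eq: "(\<sigma> ^ j) powr - a * ((\<sigma> ^ j) powr Q * V) = V * (\<sigma> powr (Q - a)) ^ j" for j
    by (simp add: pw power_mult_distrib)
  have "(\<integral>\<^sup>+\<eta>. indicator A \<eta> * ennreal (heis_norm \<eta> powr - a) \<partial>lborel)
      \<le> (\<integral>\<^sup>+\<eta>. (\<Sum>j. ennreal ((\<sigma> ^ j) powr - a) * indicator S (dil (1 / \<sigma> ^ j) \<eta>)) \<partial>lborel)"
    by (rule nn_integral_mono) (rule pt)
  also have "\<dots> = (\<Sum>j. ennreal ((\<sigma> ^ j) powr - a) * (\<integral>\<^sup>+\<eta>. indicator S (dil (1 / \<sigma> ^ j) \<eta>) \<partial>lborel))"
    by (subst nn_integral_suminf) (simp_all add: nn_integral_cmult)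
  also have "\<dots> = (\<Sum>j. ennreal (V * (\<sigma> powr (Q - a)) ^ j))"
    by (simp add: shell eq ennreal_mult'[symmetric])
  also have "\<dots> < \<infinity>"
  proof -
    have "summable (\<lambda>j. V * (\<sigma> powr (Q - a)) ^ j)"
      using \<sigma> by (intro summable_mult summable_geometric) (simp add: Q_def)
    then show ?thesis by (subst suminf_ennreal2) (auto simp: V_def)
  qed
  finally show ?thesis .
qed

lemma ex_dyadic_ge_1:
  fixes t :: real assumes "1 \<le> t" shows "\<exists>j::nat. 2 ^ j \<le> t \<and> t \<le> 2 * 2 ^ j"
proof -
  define j where "j = (LEAST j::nat. t < 2 ^ Suc j)"
  obtain k :: nat where "t < 2 ^ k" using real_arch_pow[of 2 t] by auto
  moreover have "(2::real) ^ k \<le> 2 ^ Suc k" by (intro power_increasing) auto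
  ultimately have "t < 2 ^ Suc k" by linarith
  then have *: "t < 2 ^ Suc j" unfolding j_def by (rule LeastI)
  have "2 ^ j \<le> t"
  proof (cases j)
    case (Suc i)
    then have "\<not> t < 2 ^ Suc i" unfolding j_def by (intro not_less_Least) (simp add: j_def)
    then show ?thesis using Suc by simp
  qed (use assms in auto)
  with * show ?thesis by (auto intro!: exI[of _ j])
qed

lemma nn_integral_heis_norm_powr_near:
  assumes "0 \<le> a" "a < heis_hdim TYPE('n::finite)"
  shows "(\<integral>\<^sup>+\<eta>. indicator {\<eta>. 0 < heis_norm \<eta> \<and> heis_norm \<eta> \<le> 1} \<eta> * ennreal (heis_norm \<eta> powr - a) \<partial>(lborel :: 'n heis measure)) < \<infinity>"
proof (rule nn_integral_heis_norm_powr_dyadic[where \<sigma> = "1/2"])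
  fix \<eta> :: "'n heis" assume "\<eta> \<in> {\<eta>. 0 < heis_norm \<eta> \<and> heis_norm \<eta> \<le> 1}"
  then have n: "0 < heis_norm \<eta>" "heis_norm \<eta> \<le> 1" by auto
  then obtain j :: nat where j: "2 ^ j \<le> 1 / heis_norm \<eta>" "1 / heis_norm \<eta> \<le> 2 * 2 ^ j"
    using ex_dyadic_ge_1[of "1 / heis_norm \<eta>"] by auto
  show "\<exists>j::nat. (1/2) ^ j \<le> heis_norm \<eta> \<and> heis_norm \<eta> \<le> 2 * (1/2) ^ j"
    by (rule exI[of _ "Suc j"]) (use j n in \<open>simp add: field_simps\<close>)
next
  show "(1/2) powr (heis_hdim TYPE('n) - a) < 1" using assms powr_less_mono'[of "1/2" 0 "heis_hdim TYPE('n) - a"] by simp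
qed (use assms in auto)

lemma nn_integral_heis_norm_powr_far:
  assumes "heis_hdim TYPE('n::finite) < a"
  shows "(\<integral>\<^sup>+\<eta>. indicator {\<eta>. 1 \<le> heis_norm \<eta>} \<eta> * ennreal (heis_norm \<eta> powr - a) \<partial>(lborel :: 'n heis measure)) < \<infinity>"
proof (rule nn_integral_heis_norm_powr_dyadic[where \<sigma> = 2])
  show "2 powr (heis_hdim TYPE('n) - a) < 1" using assms powr_less_mono[of "heis_hdim TYPE('n) - a" 0 2] by simp
  show "0 \<le> a" using assms by (simp add: heis_hdim_def)
qed (auto intro: ex_dyadic_ge_1)


section \<open>Twice continuously differentiable functions\<close>

lemma fderiv_eq:
  assumes "\<And>x. (f has_derivative blinfun_apply (f' x)) (at x)"
  shows "fderiv f = f'"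
proof
  fix x
  have "frechet_derivative f (at x) = blinfun_apply (f' x)"
    using frechet_derivative_at[OF assms[of x]] by simp
  then show "fderiv f x = f' x" by (simp add: fderiv_def blinfun_apply_inverse)
qed

lemma C2I:
  assumes "\<And>x. (f has_derivative blinfun_apply (f' x)) (at x)"
    and "\<And>x. (f' has_derivative blinfun_apply (f'' x)) (at x)"
    and "continuous_on UNIV f''"
  shows "C2 f"
  unfolding C2_def fderiv_eq[OF assms(1)] fderiv_eq[OF assms(2)]
  using assms by (auto simp: differentiable_def)

lemma differentiable_fderiv:
  assumes "f differentiable (at x)"
  shows "(f has_derivative blinfun_apply (fderiv f x)) (at x)"
proof -
  have d: "(f has_derivative frechet_derivative f (at x)) (at x)"
    using assms by (simp add: frechet_derivative_works)
  then show ?thesis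
    unfolding fderiv_def by (simp add: bounded_linear_Blinfun_apply has_derivative_bounded_linear)
qed

lemma C2D:
  assumes "C2 f"
  shows "(f has_derivative blinfun_apply (fderiv f x)) (at x)"
    and "(fderiv f has_derivative blinfun_apply (fderiv (fderiv f) x)) (at x)"
    and "continuous_on UNIV (fderiv (fderiv f))"
  using assms by (auto simp: C2_def intro!: differentiable_fderiv)

lemma C2_continuous:
  assumes "C2 f"
  shows "continuous_on S f" "continuous_on S (fderiv f)" "continuous_on S (fderiv (fderiv f))"
  by (rule continuous_at_imp_continuous_on, rule ballI, rule has_derivative_continuous, rule C2D(1)[OF assms],
      rule continuous_at_imp_continuous_on, rule ballI, rule has_derivative_continuous, rule C2D(2)[OF assms],
      rule continuous_on_subset[OF C2D(3)[OF assms]], simp)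

lemma C2_const: "C2 (\<lambda>x. c)"
  by (rule C2I[where f' = "\<lambda>_. 0" and f'' = "\<lambda>_. 0"]) (auto intro!: derivative_eq_intros simp: zero_blinfun.rep_eq)

lemma C2_bounded_linear:
  assumes "bounded_linear f"
  shows "C2 f"
proof (rule C2I[where f' = "\<lambda>_. Blinfun f" and f'' = "\<lambda>_. 0"])
  show "(f has_derivative blinfun_apply (Blinfun f)) (at x)" for x
    using assms by (simp add: bounded_linear_Blinfun_apply bounded_linear_imp_has_derivative)
qed (auto intro!: derivative_eq_intros simp: zero_blinfun.rep_eq)

lemma C2_add:
  assumes "C2 f" "C2 g"
  shows "C2 (\<lambda>x. f x + g x)"
proof (rule C2I)
  show "((\<lambda>x. f x + g x) has_derivative blinfun_apply (fderiv f x + fderiv g x)) (at x)" for x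
    by (auto intro!: derivative_eq_intros C2D assms simp: plus_blinfun.rep_eq)
  show "((\<lambda>x. fderiv f x + fderiv g x) has_derivative blinfun_apply (fderiv (fderiv f) x + fderiv (fderiv g) x)) (at x)" for x
    by (auto intro!: derivative_eq_intros C2D assms simp: plus_blinfun.rep_eq)
qed (intro continuous_intros C2D assms)

lemma C2_sum:
  assumes "\<And>i. i \<in> I \<Longrightarrow> C2 (f i)"
  shows "C2 (\<lambda>x. \<Sum>i\<in>I. f i x)"
  using assms by (induction I rule: infinite_finite_induct) (auto intro: C2_add C2_const)

text \<open>The chain rule for an outer function that is only known to be twice differentiable on a set containing the
  values of \<open>f\<close>; powers with real exponent are smooth on positive reals only.\<close>

lemma C2_compose:
  fixes f :: "'a::real_normed_vector \<Rightarrow> real"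
  assumes f: "C2 f" and S: "\<And>x. f x \<in> S"
    and g: "\<And>v. v \<in> S \<Longrightarrow> (g has_field_derivative g' v) (at v)"
    and g': "\<And>v. v \<in> S \<Longrightarrow> (g' has_field_derivative g'' v) (at v)"
    and g'': "continuous_on S g''"
  shows "C2 (\<lambda>x. g (f x))"
proof (rule C2I)
  show "((\<lambda>x. g (f x)) has_derivative blinfun_apply (g' (f x) *\<^sub>R fderiv f x)) (at x)" for x
  proof -
    have "((\<lambda>x. g (f x)) has_derivative (\<lambda>h. g' (f x) * fderiv f x h)) (at x)"
      using has_derivative_compose[OF C2D(1)[OF f, of x] g[OF S, unfolded has_field_derivative_def]] by simp
    then show ?thesis by (simp add: scaleR_blinfun.rep_eq)
  qed
  show "((\<lambda>x. g' (f x) *\<^sub>R fderiv f x) has_derivative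
      blinfun_apply (g' (f x) *\<^sub>R fderiv (fderiv f) x + (blinfun_scaleR_left (fderiv f x) o\<^sub>L (g'' (f x) *\<^sub>R fderiv f x)))) (at x)" for x
  proof -
    have "((\<lambda>x. g' (f x)) has_derivative (\<lambda>h. g'' (f x) * fderiv f x h)) (at x)"
      using has_derivative_compose[OF C2D(1)[OF f, of x] g'[OF S, unfolded has_field_derivative_def]] by simp
    from has_derivative_scaleR[OF this C2D(2)[OF f]] show ?thesis
      by (simp add: scaleR_blinfun.rep_eq plus_blinfun.rep_eq)
  qed
  have "continuous_on S g'" using g' by (auto intro!: continuous_at_imp_continuous_on DERIV_isCont)
  then have "continuous_on UNIV (\<lambda>x. g' (f x))" "continuous_on UNIV (\<lambda>x. g'' (f x))"
    using g'' S by (auto intro!: continuous_on_compose2[OF _ C2_continuous(1)[OF f]])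
  then show "continuous_on UNIV (\<lambda>x. g' (f x) *\<^sub>R fderiv (fderiv f) x
      + (blinfun_scaleR_left (fderiv f x) o\<^sub>L (g'' (f x) *\<^sub>R fderiv f x)))"
    by (intro continuous_intros C2_continuous[OF f]
        bounded_bilinear.continuous_on[OF bounded_bilinear_blinfun_compose]
        bounded_linear.continuous_on[OF bounded_linear_blinfun_scaleR_left]) auto
qed

lemma C2_square: "C2 f \<Longrightarrow> C2 (\<lambda>x. (f x)\<^sup>2)"
  by (rule C2_compose[where S = UNIV and g' = "\<lambda>v. 2 * v" and g'' = "\<lambda>_. 2"])
     (auto intro!: derivative_eq_intros continuous_intros)

lemma C2_norm_square:
  fixes A :: "'a::real_normed_vector \<Rightarrow> 'b::euclidean_space"
  assumes "bounded_linear A"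
  shows "C2 (\<lambda>x. (norm (A x))\<^sup>2)"
proof -
  have "(norm (A x))\<^sup>2 = (\<Sum>i\<in>Basis. (A x \<bullet> i)\<^sup>2)" for x
    by (subst power2_norm_eq_inner, subst euclidean_inner) (simp add: power2_eq_square)
  then show ?thesis
    using assms by (simp add: C2_sum C2_square C2_bounded_linear bounded_linear_inner_left_comp)
qed

lemma C2_bracket_dil: "C2 (\<lambda>\<xi>. bracket (dil r \<xi>))"
  unfolding bracket_def dil_def fst_conv snd_conv
  by (intro C2_add C2_const C2_square C2_norm_square C2_bounded_linear
      bounded_linear_scaleR_right bounded_linear_const_mult bounded_linear_const_scaleR
      bounded_linear_fst bounded_linear_snd bounded_linear_fst_comp bounded_linear_snd_comp)

lemma Cc2I:
  assumes "C2 f" "compact K" "\<And>x. x \<notin> K \<Longrightarrow> f x = 0"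
  shows "Cc2 f"
proof -
  have "{x. f x \<noteq> 0} \<subseteq> K" using assms(3) by auto
  then have "closure {x. f x \<noteq> 0} \<subseteq> K" by (rule closure_minimal) (use assms(2) in \<open>rule compact_imp_closed\<close>)
  then have "compact (closure {x. f x \<noteq> 0})"
    using compact_Int_closed[OF assms(2) closed_closure, of "{x. f x \<noteq> 0}"] by (simp add: Int_absorb1)
  then show ?thesis using assms(1) by (simp add: Cc2_def)
qed

text \<open>This passes the support from a function to its derivatives, and so yields the boundedness needed for the
  uniform limits in the definition of a test function.\<close>

lemma fderiv_eq_0_outside:
  assumes "\<And>x. f differentiable (at x)" and "closed K" and "\<And>x. x \<notin> K \<Longrightarrow> f x = 0" and "x \<notin> K"
  shows "fderiv f x = 0"
proof -
  have "((\<lambda>_. 0) has_derivative blinfun_apply (fderiv f x)) (at x)"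
    by (rule has_derivative_transform_within_open[OF differentiable_fderiv[OF assms(1)], of "- K"])
       (use assms in auto)
  moreover have "((\<lambda>_. 0) has_derivative (\<lambda>_. 0)) (at x)" by simp
  ultimately have "blinfun_apply (fderiv f x) = (\<lambda>_. 0)" by (rule has_derivative_unique)
  then show ?thesis by (intro blinfun_eqI) (simp add: zero_blinfun.rep_eq)
qed

lemma bounded_if_compact_support:
  assumes "continuous_on UNIV f" "compact K" "\<And>x. x \<notin> K \<Longrightarrow> f x = 0"
  shows "bounded (range f)"
proof -
  have "range f \<subseteq> insert 0 (f ` K)" using assms(3) by auto
  moreover have "bounded (insert 0 (f ` K))"
    using compact_imp_bounded[OF compact_continuous_image[OF continuous_on_subset[OF assms(1)] assms(2)]] by simp
  ultimately show ?thesis by (rule bounded_subset[rotated])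
qed

lemma Cc2_bounded:
  assumes "Cc2 f"
  shows "bounded (range f)" "bounded (range (fderiv f))" "bounded (range (fderiv (fderiv f)))"
proof -
  let ?K = "closure {x. f x \<noteq> 0}"
  have C2: "C2 f" and K: "compact ?K" using assms by (auto simp: Cc2_def)
  have 0: "f x = 0" if "x \<notin> ?K" for x using that closure_subset[of "{x. f x \<noteq> 0}"] by auto
  have d: "f differentiable (at x)" "fderiv f differentiable (at x)" for x
    using C2 by (simp_all add: C2_def)
  have 1: "fderiv f x = 0" if "x \<notin> ?K" for x
    by (rule fderiv_eq_0_outside[OF d(1) closed_closure 0 that])
  have 2: "fderiv (fderiv f) x = 0" if "x \<notin> ?K" for x
    by (rule fderiv_eq_0_outside[OF d(2) closed_closure 1 that])
  show "bounded (range f)" "bounded (range (fderiv f))" "bounded (range (fderiv (fderiv f)))"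
    by (rule bounded_if_compact_support[OF C2_continuous(1)[OF C2] K 0]
        bounded_if_compact_support[OF C2_continuous(2)[OF C2] K 1]
        bounded_if_compact_support[OF C2_continuous(3)[OF C2] K 2]; assumption)+
qed

lemma fderiv_scale:
  assumes "\<And>x. f differentiable (at x)"
  shows "fderiv (\<lambda>x. a *\<^sub>R f x) = (\<lambda>x. a *\<^sub>R fderiv f x)"
  by (rule fderiv_eq) (auto intro!: derivative_eq_intros differentiable_fderiv assms simp: scaleR_blinfun.rep_eq)

lemma fderiv_scale_C2:
  assumes "C2 f"
  shows "fderiv (\<lambda>x. a * f x) = (\<lambda>x. a *\<^sub>R fderiv f x)"
    and "fderiv (\<lambda>x. a *\<^sub>R fderiv f x) = (\<lambda>x. a *\<^sub>R fderiv (fderiv f) x)"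
  using assms by (auto simp: C2_def fderiv_scale[of f, unfolded real_scaleR_def] fderiv_scale)

lemma C2_scale:
  assumes "C2 f" shows "C2 (\<lambda>x. a * f x)"
  using assms unfolding C2_def fderiv_scale_C2[OF assms] by (auto intro!: continuous_intros)

lemma Cc2_scale:
  assumes "Cc2 f" shows "Cc2 (\<lambda>x. a * f x)"
proof (rule Cc2I[where K = "closure {x. f x \<noteq> 0}"])
  show "a * f x = 0" if "x \<notin> closure {x. f x \<noteq> 0}" for x
    using that closure_subset[of "{x. f x \<noteq> 0}"] by auto
qed (use assms in \<open>auto simp: Cc2_def intro: C2_scale\<close>)

lemma uniform_limit_scale_bounded:
  fixes h :: "'a \<Rightarrow> 'b::real_normed_vector"
  assumes "bounded (range h)" "(a \<longlongrightarrow> a0) F"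
  shows "uniform_limit UNIV (\<lambda>i x. a i *\<^sub>R h x) (\<lambda>x. a0 *\<^sub>R h x) F"
proof (rule uniform_limitI)
  fix e :: real assume "0 < e"
  obtain B where B: "0 < B" "\<And>x. norm (h x) \<le> B" using assms(1) by (auto simp: bounded_pos)
  have "\<forall>\<^sub>F i in F. dist (a i) a0 < e / B" using tendstoD[OF assms(2)] \<open>0 < e\<close> B by simp
  then show "\<forall>\<^sub>F i in F. \<forall>x\<in>UNIV. dist (a i *\<^sub>R h x) (a0 *\<^sub>R h x) < e"
  proof eventually_elim
    case (elim i)
    have "dist (a i *\<^sub>R h x) (a0 *\<^sub>R h x) < e" for x
    proof -
      have "dist (a i *\<^sub>R h x) (a0 *\<^sub>R h x) = dist (a i) a0 * norm (h x)"
        by (simp add: dist_norm flip: scaleR_diff_left)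
      also have "\<dots> \<le> dist (a i) a0 * B" using B by (intro mult_left_mono) auto
      also have "\<dots> < e" using elim B by (simp add: field_simps)
      finally show ?thesis .
    qed
    then show ?case by simp
  qed
qed

lemma C2_limit_scale:
  assumes "Cc2 g" "(a \<longlongrightarrow> a0) F"
  shows "C2_limit (\<lambda>i x. a i * g x) (\<lambda>x. a0 * g x) F"
proof -
  have C2: "C2 g" using assms by (simp add: Cc2_def)
  show ?thesis
    unfolding C2_limit_def fderiv_scale_C2[OF C2]
    using uniform_limit_scale_bounded[OF Cc2_bounded(1)[OF assms(1)] assms(2)]
      uniform_limit_scale_bounded[OF Cc2_bounded(2)[OF assms(1)] assms(2)]
      uniform_limit_scale_bounded[OF Cc2_bounded(3)[OF assms(1)] assms(2)] by simp
qed

text \<open>For a product the difference quotients in time are scalar multiples of the fixed function \<open>g\<close>, so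
  convergence in the \<open>C\<^sup>2\<close> norm reduces to convergence of the scalars.\<close>

lemma test_function_product:
  fixes g :: "'n::finite heis \<Rightarrow> real"
  assumes g: "Cc2 g"
    and \<theta>: "\<And>t. (\<theta> has_field_derivative \<theta>' t) (at t)" "continuous_on UNIV \<theta>'"
    and supp: "\<And>t. T \<le> t \<Longrightarrow> \<theta> t = 0"
  shows "test_function \<infinity> (\<lambda>t \<xi>. \<theta> t * g \<xi>)"
  unfolding test_function_def Let_def
proof (intro conjI exI ballI allI impI)
  let ?K = "closure {x. g x \<noteq> 0}"
  let ?I = "{t. 0 \<le> t \<and> ereal t < \<infinity>}"
  show "compact {0..T}" "{0..T} \<subseteq> ?I" by auto
  show "compact ?K" using g by (simp add: Cc2_def)
  fix t assume t: "t \<in> ?I"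
  show "Cc2 (\<lambda>\<xi>. \<theta> t * g \<xi>)" "Cc2 (\<lambda>\<xi>. \<theta>' t * g \<xi>)" by (rule Cc2_scale[OF g])+
  show "t \<in> {0..T}" if "\<theta> t * g \<xi> \<noteq> 0" for \<xi>
    using that t supp[of t] by (cases "T \<le> t") auto
  show "\<xi> \<in> ?K" if "\<theta> t * g \<xi> \<noteq> 0" for \<xi>
    using that closure_subset[of "{x. g x \<noteq> 0}"] by auto
  have "((\<lambda>r. (\<theta> r - \<theta> t) / (r - t)) \<longlongrightarrow> \<theta>' t) (at t within ?I)"
    using DERIV_subset[OF \<theta>(1)[of t], of ?I] by (simp add: has_field_derivative_iff)
  from C2_limit_scale[OF g this]
  show "C2_limit (\<lambda>r \<xi>. (\<theta> r * g \<xi> - \<theta> t * g \<xi>) / (r - t)) (\<lambda>\<xi>. \<theta>' t * g \<xi>) (at t within ?I)"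
    by (simp add: left_diff_distrib)
  have "(\<theta>' \<longlongrightarrow> \<theta>' t) (at t within ?I)"
    using \<theta>(2) by (meson UNIV_I continuous_on_def tendsto_within_subset subset_UNIV)
  from C2_limit_scale[OF g this]
  show "C2_limit (\<lambda>t \<xi>. \<theta>' t * g \<xi>) (\<lambda>\<xi>. \<theta>' t * g \<xi>) (at t within ?I)" .
qed

lemma pos_part_power_deriv:
  "((\<lambda>x::real. max 0 x ^ Suc (Suc n)) has_field_derivative (real (Suc (Suc n)) * max 0 x ^ Suc n)) (at x)"
proof -
  consider "x < 0" | "x = 0" | "0 < x" by linarith
  then show ?thesis
  proof cases
    case 1
    show ?thesis
      by (rule has_field_derivative_transform_within_open[of "\<lambda>_. 0" _ _ "{..<0}"]) (use 1 in auto)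
  next
    case 3
    have "((\<lambda>x. x ^ Suc (Suc n)) has_field_derivative (real (Suc (Suc n)) * max 0 x ^ Suc n)) (at x)"
      using 3 DERIV_pow[of "Suc (Suc n)" x] by simp
    then show ?thesis
      by (rule has_field_derivative_transform_within_open[of _ _ _ "{0<..}"]) (use 3 in auto)
  next
    case 2
    have "((\<lambda>y::real. max 0 y ^ Suc n) \<longlongrightarrow> 0) (at 0)"
      by (rule tendsto_eq_intros | simp)+
    then have "((\<lambda>y::real. max 0 y ^ Suc (Suc n) / y) \<longlongrightarrow> 0) (at 0)"
      by (rule Lim_transform_eventually) (auto simp: eventually_at_filter max_def split: if_splits)
    then show ?thesis using 2 by (simp add: has_field_derivative_iff)
  qed
qed


section \<open>Truncated weights and their second differences\<close>

text \<open>The outer function that turns \<open>bracket\<close> into a truncated weight. The third power is the smallest integer power of a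
  positive part that is twice continuously differentiable. The cut-off approaches 1 as \<open>k\<close> grows but need not equal it
  anywhere.\<close>

definition profile :: "real \<Rightarrow> real \<Rightarrow> real \<Rightarrow> real" where
  "profile b k v = v powr - b * max 0 (1 - v / k) ^ 3"

definition profile' :: "real \<Rightarrow> real \<Rightarrow> real \<Rightarrow> real" where
  "profile' b k v = - b * v powr (- b - 1) * max 0 (1 - v / k) ^ 3 - 3 / k * v powr - b * (max 0 (1 - v / k))\<^sup>2"

definition profile'' :: "real \<Rightarrow> real \<Rightarrow> real \<Rightarrow> real" where
  "profile'' b k v = b * (b + 1) * v powr (- b - 2) * max 0 (1 - v / k) ^ 3
     + 6 * b / k * v powr (- b - 1) * (max 0 (1 - v / k))\<^sup>2 + 6 / k\<^sup>2 * v powr - b * max 0 (1 - v / k)"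

lemma cutoff_deriv:
  fixes k v :: real
  assumes "k \<noteq> 0"
  shows "((\<lambda>v. max 0 (1 - v / k) ^ 3) has_field_derivative (- 3 / k * (max 0 (1 - v / k))\<^sup>2)) (at v)"
    and "((\<lambda>v. (max 0 (1 - v / k))\<^sup>2) has_field_derivative (- 2 / k * max 0 (1 - v / k))) (at v)"
proof -
  have i: "((\<lambda>v. 1 - v / k) has_field_derivative (- 1 / k)) (at v)"
    using assms by (auto intro!: derivative_eq_intros)
  show "((\<lambda>v. max 0 (1 - v / k) ^ 3) has_field_derivative (- 3 / k * (max 0 (1 - v / k))\<^sup>2)) (at v)"
    using DERIV_chain2[OF pos_part_power_deriv[of 1] i] by (simp add: numeral_3_eq_3 numeral_2_eq_2 field_simps)
  show "((\<lambda>v. (max 0 (1 - v / k))\<^sup>2) has_field_derivative (- 2 / k * max 0 (1 - v / k))) (at v)"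
    using DERIV_chain2[OF pos_part_power_deriv[of 0] i] by (simp add: numeral_2_eq_2 field_simps)
qed

lemma profile_deriv:
  assumes "k \<noteq> 0" "0 < v"
  shows "(profile b k has_field_derivative profile' b k v) (at v)"
    and "(profile' b k has_field_derivative profile'' b k v) (at v)"
proof -
  have p: "((\<lambda>v. v powr a) has_field_derivative (a * v powr (a - 1))) (at v)" for a
    using has_real_derivative_powr[OF assms(2)] by simp
  show "(profile b k has_field_derivative profile' b k v) (at v)"
    unfolding profile_def[abs_def] profile'_def
    by (rule DERIV_cong[OF DERIV_mult[OF p cutoff_deriv(1)[OF assms(1)]]]) simp
  have "(\<lambda>v. profile' b k v) = (\<lambda>v. - b * (v powr (- b - 1) * max 0 (1 - v / k) ^ 3) + - 3 / k * (v powr - b * (max 0 (1 - v / k))\<^sup>2))"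
    by (simp add: profile'_def fun_eq_iff)
  moreover have "((\<lambda>v. - b * (v powr (- b - 1) * max 0 (1 - v / k) ^ 3) + - 3 / k * (v powr - b * (max 0 (1 - v / k))\<^sup>2))
      has_field_derivative profile'' b k v) (at v)"
    by (rule DERIV_cong[OF DERIV_add[OF DERIV_cmult[OF DERIV_mult[OF p cutoff_deriv(1)[OF assms(1)]]]
            DERIV_cmult[OF DERIV_mult[OF p cutoff_deriv(2)[OF assms(1)]]]]])
       (simp add: profile''_def algebra_simps add_divide_distrib diff_divide_distrib power2_eq_square)
  ultimately show "(profile' b k has_field_derivative profile'' b k v) (at v)" by simp
qed

text \<open>Derivatives of the cut-off bring factors \<open>1/k\<close>, and \<open>1/k \<le> 1/v\<close> wherever the cut-off does not vanish. Hence the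
  truncated power obeys, up to constants, the derivative bounds of the power itself, uniformly in \<open>k\<close>.\<close>

lemma profile_bounds:
  assumes "0 < k" "0 < v" "0 \<le> b"
  shows "0 \<le> profile b k v" "profile b k v \<le> v powr - b"
    and "\<bar>profile' b k v\<bar> \<le> (b + 3) * v powr (- b - 1)"
    and "\<bar>profile'' b k v\<bar> \<le> (b * (b + 1) + 6 * b + 6) * v powr (- b - 2)"
proof -
  define z where "z = max 0 (1 - v / k)"
  have z: "0 \<le> z" "z \<le> 1" using assms by (auto simp: z_def)
  have zp: "0 \<le> z ^ n" "z ^ n \<le> 1" for n using z by (auto intro: power_le_one)
  have kz: "1 / k * z ^ n \<le> 1 / v" if "n > 0" for n
  proof (cases "v \<le> k")
    case True
    have "1 / k * z ^ n \<le> 1 / k * 1" using assms zp[of n] by (intro mult_left_mono) auto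
    also have "\<dots> \<le> 1 / v" using True assms by (simp add: field_simps)
    finally show ?thesis .
  next
    case False
    then have "z = 0" using assms by (simp add: z_def max_def field_simps)
    then show ?thesis using that assms by (simp add: power_0_left)
  qed
  have kz2: "1 / k\<^sup>2 * z \<le> 1 / v\<^sup>2"
  proof (cases "v \<le> k")
    case True
    have "1 / k\<^sup>2 * z \<le> 1 / k\<^sup>2 * 1" using assms z by (intro mult_left_mono) auto
    also have "\<dots> \<le> 1 / v\<^sup>2" using True assms by (auto simp: field_simps intro!: power_mono)
    finally show ?thesis .
  next
    case False
    then have "z = 0" using assms by (simp add: z_def max_def field_simps)
    then show ?thesis using assms by simp
  qed
  have p1: "v powr - b * (1 / v) = v powr (- b - 1)" using assms by (simp add: powr_diff)
  have p2: "v powr (- b - 1) * (1 / v) = v powr (- b - 2)" using assms by (simp add: powr_diff power2_eq_square)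
  have p3: "v powr - b * (1 / v\<^sup>2) = v powr (- b - 2)" using assms by (simp add: powr_diff)
  show "0 \<le> profile b k v" using zp(1)[of 3] by (simp add: profile_def flip: z_def)
  show "profile b k v \<le> v powr - b"
    using mult_left_mono[OF zp(2)[of 3], of "v powr - b"] by (simp add: profile_def flip: z_def)
  have a: "v powr (- b - 1) * z ^ 3 \<le> v powr (- b - 1)"
    using mult_left_mono[OF zp(2)[of 3], of "v powr (- b - 1)"] by simp
  have a': "v powr (- b - 2) * z ^ 3 \<le> v powr (- b - 2)"
    using mult_left_mono[OF zp(2)[of 3], of "v powr (- b - 2)"] by simp
  have c: "v powr - b * (1 / k * z\<^sup>2) \<le> v powr (- b - 1)"
    unfolding p1[symmetric] by (intro mult_left_mono kz) auto
  have d: "v powr (- b - 1) * (1 / k * z\<^sup>2) \<le> v powr (- b - 2)"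
    unfolding p2[symmetric] by (intro mult_left_mono kz) auto
  have e: "v powr - b * (1 / k\<^sup>2 * z) \<le> v powr (- b - 2)"
    unfolding p3[symmetric] by (intro mult_left_mono kz2) auto
  have "profile' b k v = - (b * (v powr (- b - 1) * z ^ 3) + 3 * (v powr - b * (1 / k * z\<^sup>2)))"
    by (simp add: profile'_def flip: z_def)
  moreover have "0 \<le> b * (v powr (- b - 1) * z ^ 3) + 3 * (v powr - b * (1 / k * z\<^sup>2))"
    using assms z by simp
  moreover have "b * (v powr (- b - 1) * z ^ 3) + 3 * (v powr - b * (1 / k * z\<^sup>2)) \<le> b * v powr (- b - 1) + 3 * v powr (- b - 1)"
    using assms by (intro add_mono mult_left_mono a c) auto
  ultimately show "\<bar>profile' b k v\<bar> \<le> (b + 3) * v powr (- b - 1)" by (simp add: algebra_simps)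
  have "profile'' b k v = b * (b + 1) * (v powr (- b - 2) * z ^ 3) + 6 * b * (v powr (- b - 1) * (1 / k * z\<^sup>2)) + 6 * (v powr - b * (1 / k\<^sup>2 * z))"
    by (simp add: profile''_def flip: z_def)
  moreover have "0 \<le> b * (b + 1) * (v powr (- b - 2) * z ^ 3) + 6 * b * (v powr (- b - 1) * (1 / k * z\<^sup>2)) + 6 * (v powr - b * (1 / k\<^sup>2 * z))"
    using assms z by simp
  moreover have "b * (b + 1) * (v powr (- b - 2) * z ^ 3) + 6 * b * (v powr (- b - 1) * (1 / k * z\<^sup>2)) + 6 * (v powr - b * (1 / k\<^sup>2 * z))
     \<le> b * (b + 1) * v powr (- b - 2) + 6 * b * v powr (- b - 2) + 6 * v powr (- b - 2)"
    using assms by (intro add_mono mult_left_mono a' d e) auto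
  ultimately show "\<bar>profile'' b k v\<bar> \<le> (b * (b + 1) + 6 * b + 6) * v powr (- b - 2)" by (simp add: algebra_simps)
qed

lemma second_difference_le:
  fixes g :: "real \<Rightarrow> real"
  assumes g: "\<And>t. \<bar>t\<bar> \<le> 1 \<Longrightarrow> (g has_field_derivative g' t) (at t)"
    and g': "\<And>t. \<bar>t\<bar> \<le> 1 \<Longrightarrow> (g' has_field_derivative g'' t) (at t)"
    and M: "\<And>t. \<bar>t\<bar> \<le> 1 \<Longrightarrow> \<bar>g'' t\<bar> \<le> M"
  shows "\<bar>g 1 + g (- 1) - 2 * g 0\<bar> \<le> 2 * M"
proof -
  have M0: "0 \<le> M" using M[of 0] by simp
  have d: "((\<lambda>t. g t + g (- t)) has_field_derivative (g' t - g' (- t))) (at t)" if "\<bar>t\<bar> \<le> 1" for t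
    using DERIV_add[OF g[OF that] DERIV_chain2[OF g[of "- t"] DERIV_minus[OF DERIV_ident]]] that by simp
  obtain t where t: "0 < t" "t < 1" "(g 1 + g (- 1)) - (g 0 + g (- 0)) = (1 - 0) * (g' t - g' (- t))"
    using MVT2[of 0 1 "\<lambda>t. g t + g (- t)" "\<lambda>t. g' t - g' (- t)"] d by force
  obtain r where r: "- t < r" "r < t" "g' t - g' (- t) = (t - (- t)) * g'' r"
    using MVT2[of "- t" t g' g''] g' t by force
  have "\<bar>g 1 + g (- 1) - 2 * g 0\<bar> = 2 * t * \<bar>g'' r\<bar>"
    using t r by (simp add: abs_mult)
  also have "\<dots> \<le> 2 * 1 * M" using t r M0 by (intro mult_mono M) auto
  finally show ?thesis by simp
qed

lemma bracket_line:
  "bracket (\<xi> \<circ>\<^sub>H (t *\<^sub>R \<eta>)) = 1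
     + ((norm (fst \<xi> + t *\<^sub>R fst \<eta>))\<^sup>2 + (norm (fst (snd \<xi>) + t *\<^sub>R fst (snd \<eta>)))\<^sup>2)\<^sup>2
     + (snd (snd \<xi>) + t * (snd (snd \<eta>) + 2 * (fst (snd \<xi>) \<bullet> fst \<eta> - fst \<xi> \<bullet> fst (snd \<eta>))))\<^sup>2"
  by (simp add: bracket_def heis_mult_eq algebra_simps)

text \<open>Along \<open>t \<mapsto> \<xi> \<circ> t\<eta>\<close> all three coordinates are affine in \<open>t\<close>. With \<open>a\<close> the squared horizontal length and \<open>D\<close>
  that of \<open>\<eta>\<close>, the Cauchy-Schwarz inequality bounds \<open>a'\<^sup>2\<close> and the symplectic part of the vertical speed \<open>\<kappa>\<close> by
  multiples of \<open>a D\<close>. As \<open>D\<close> and the vertical component of \<open>\<eta>\<close> are of order \<open>\<parallel>\<eta>\<parallel>\<^sup>2\<close>, each derivative of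
  \<open>bracket\<close> costs one factor \<open>\<parallel>\<eta>\<parallel>\<close> and no more than the function itself.\<close>

lemma bracket_line_derivs:
  fixes \<xi> \<eta> :: "'n::finite heis"
  assumes n1: "heis_norm \<eta> \<le> 1"
  defines "q \<equiv> \<lambda>t. bracket (\<xi> \<circ>\<^sub>H (t *\<^sub>R \<eta>))"
  obtains q' q'' where
    "\<And>t. (q has_field_derivative q' t) (at t)" "\<And>t. (q' has_field_derivative q'' t) (at t)"
    "\<And>t. (q' t)\<^sup>2 \<le> (96 * real CARD('n) + 16) * (q t)\<^sup>2 * (heis_norm \<eta>)\<^sup>2"
    "\<And>t. \<bar>q'' t\<bar> \<le> (28 * real CARD('n) + 4) * q t * (heis_norm \<eta>)\<^sup>2"
proof -
  obtain x y w where xi: "\<xi> = (x, y, w)" by (cases \<xi>) auto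
  obtain x' y' w' where eta: "\<eta> = (x', y', w')" by (cases \<eta>) auto
  define n where "n = heis_norm \<eta>"
  define N where "N = real CARD('n)"
  define D where "D = (norm x')\<^sup>2 + (norm y')\<^sup>2"
  define B where "B = 2 * (x \<bullet> x' + y \<bullet> y')"
  define \<kappa> where "\<kappa> = w' + 2 * (y \<bullet> x' - x \<bullet> y')"
  define a where "a t = (norm (x + t *\<^sub>R x'))\<^sup>2 + (norm (y + t *\<^sub>R y'))\<^sup>2" for t
  define a' where "a' t = B + 2 * D * t" for t
  define w0 where "w0 t = w + t * \<kappa>" for t
  have q: "q t = 1 + (a t)\<^sup>2 + (w0 t)\<^sup>2" for t
    unfolding q_def bracket_line a_def w0_def \<kappa>_def by (simp add: xi eta)
  have a_eq: "a t = (norm x)\<^sup>2 + (norm y)\<^sup>2 + B * t + D * t\<^sup>2" for t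
    unfolding a_def B_def D_def power2_norm_eq_inner
    by (simp add: inner_add_left inner_add_right inner_commute power2_eq_square algebra_simps)
  have da: "(a has_field_derivative a' t) (at t)" for t
    unfolding a_eq[abs_def] a'_def by (auto intro!: derivative_eq_intros)
  have da': "(a' has_field_derivative 2 * D) (at t)" for t
    unfolding a'_def[abs_def] by (auto intro!: derivative_eq_intros)
  have dw: "(w0 has_field_derivative \<kappa>) (at t)" for t
    unfolding w0_def[abs_def] by (auto intro!: derivative_eq_intros)
  define q' where "q' t = 2 * a t * a' t + 2 * w0 t * \<kappa>" for t
  define q'' where "q'' t = 2 * (a' t)\<^sup>2 + 4 * a t * D + 2 * \<kappa>\<^sup>2" for t
  have 1: "(q has_field_derivative q' t) (at t)" for t
    unfolding q[abs_def] q'_def by (auto intro!: derivative_eq_intros da dw)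
  have 2: "(q' has_field_derivative q'' t) (at t)" for t
    unfolding q'_def[abs_def] q''_def
    by (auto intro!: derivative_eq_intros da da' dw simp: power2_eq_square algebra_simps)
  have a0: "0 \<le> a t" and D0: "0 \<le> D" for t by (auto simp: a_def D_def)
  have cs: "(u \<bullet> u' + v \<bullet> v')\<^sup>2 \<le> ((norm u)\<^sup>2 + (norm v)\<^sup>2) * ((norm u')\<^sup>2 + (norm v')\<^sup>2)" for u u' v v' :: "real^'n"
    using Cauchy_Schwarz_ineq[of "(u, v)" "(u', v')"] by (simp add: power2_norm_eq_inner)
  have A: "(a' t)\<^sup>2 \<le> 4 * a t * D" for t
  proof -
    have "a' t = 2 * ((x + t *\<^sub>R x') \<bullet> x' + (y + t *\<^sub>R y') \<bullet> y')"
      by (simp add: a'_def B_def D_def power2_norm_eq_inner inner_add_left algebra_simps)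
    then have "(a' t)\<^sup>2 = 4 * ((x + t *\<^sub>R x') \<bullet> x' + (y + t *\<^sub>R y') \<bullet> y')\<^sup>2"
      by (simp only: power_mult_distrib) simp
    also have "\<dots> \<le> 4 * (a t * D)" unfolding a_def D_def by (intro mult_left_mono cs) auto
    finally show ?thesis by simp
  qed
  \<comment> \<open>The base point may be moved along the line: the symplectic form does not see the added multiple of \<open>(x', y')\<close>.\<close>
  have K: "\<kappa>\<^sup>2 \<le> 2 * w'\<^sup>2 + 8 * a t * D" for t
  proof -
    have "y \<bullet> x' - x \<bullet> y' = (x + t *\<^sub>R x') \<bullet> (- y') + (y + t *\<^sub>R y') \<bullet> x'"
      by (simp add: inner_add_left inner_add_right inner_commute)
    then have "(y \<bullet> x' - x \<bullet> y')\<^sup>2 \<le> a t * D"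
      using cs[of "x + t *\<^sub>R x'" "- y'" "y + t *\<^sub>R y'" x'] by (simp add: a_def D_def add.commute)
    moreover have "\<kappa>\<^sup>2 \<le> 2 * w'\<^sup>2 + 8 * (y \<bullet> x' - x \<bullet> y')\<^sup>2"
      using zero_le_power2[of "w' - 2 * (y \<bullet> x' - x \<bullet> y')"] unfolding \<kappa>_def
      by (simp add: power2_eq_square algebra_simps)
    ultimately show ?thesis by linarith
  qed
  have n: "0 \<le> n" "n \<le> 1" using n1 by (auto simp: n_def)
  have N: "1 \<le> N" by (simp add: N_def Suc_leI)
  have Dn: "D \<le> N * n\<^sup>2"
  proof (rule power2_le_imp_le)
    have "D\<^sup>2 \<le> N * n ^ 4" using horizontal_le_heis_norm[of \<eta>] by (simp add: D_def N_def n_def eta)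
    also have "\<dots> \<le> N\<^sup>2 * n ^ 4" using N by (intro mult_right_mono) (auto simp: power2_eq_square)
    finally show "D\<^sup>2 \<le> (N * n\<^sup>2)\<^sup>2" by (simp add: power_mult_distrib flip: power_mult)
  qed (use N in auto)
  have wn: "w'\<^sup>2 \<le> n\<^sup>2"
  proof -
    have "\<bar>w'\<bar> \<le> n\<^sup>2" using vertical_le_heis_norm[of \<eta>] by (simp add: eta n_def)
    also have "\<dots> \<le> n" using n by (simp add: power2_eq_square mult_left_le)
    finally show ?thesis using power_mono[of "\<bar>w'\<bar>" n 2] by simp
  qed
  have aq: "a t \<le> q t" for t
  proof -
    have "2 * a t \<le> 1 + (a t)\<^sup>2"
      using zero_le_power2[of "a t - 1"] by (simp add: power2_eq_square algebra_simps)
    then show ?thesis unfolding q using zero_le_power2[of "w0 t"] a0[of t] by linarith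
  qed
  have q1: "1 \<le> q t" for t by (simp add: q)
  have a2q: "(a t)\<^sup>2 \<le> q t" and w2q: "(w0 t)\<^sup>2 \<le> q t" for t by (simp_all add: q)
  have aD: "a t * D \<le> q t * (N * n\<^sup>2)" for t
    using q1[of t] by (intro mult_mono aq Dn D0) auto
  have K2: "\<kappa>\<^sup>2 \<le> (8 * N + 2) * q t * n\<^sup>2" for t
  proof -
    have "w'\<^sup>2 \<le> q t * n\<^sup>2" using mult_right_mono[OF q1[of t], of "n\<^sup>2"] wn by simp
    then show ?thesis using K[of t] aD[of t] by (simp add: algebra_simps)
  qed
  have 4: "\<bar>q'' t\<bar> \<le> (28 * N + 4) * q t * n\<^sup>2" for t
  proof -
    have "\<bar>q'' t\<bar> = q'' t" using a0[of t] D0 by (simp add: q''_def)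
    also have "\<dots> \<le> 12 * (a t * D) + 2 * \<kappa>\<^sup>2" using A[of t] by (simp add: q''_def algebra_simps)
    also have "\<dots> \<le> (28 * N + 4) * q t * n\<^sup>2" using aD[of t] K2[of t] by (simp add: algebra_simps)
    finally show ?thesis .
  qed
  have 3: "(q' t)\<^sup>2 \<le> (96 * N + 16) * (q t)\<^sup>2 * n\<^sup>2" for t
  proof -
    have "(q' t)\<^sup>2 \<le> 8 * ((a t)\<^sup>2 * (a' t)\<^sup>2) + 8 * ((w0 t)\<^sup>2 * \<kappa>\<^sup>2)"
      using zero_le_power2[of "2 * a t * a' t - 2 * w0 t * \<kappa>"] unfolding q'_def
      by (simp add: power2_eq_square algebra_simps)
    also have "(a t)\<^sup>2 * (a' t)\<^sup>2 \<le> q t * (4 * N * q t * n\<^sup>2)"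
      using A[of t] aD[of t] q1[of t] by (intro mult_mono a2q) (auto simp: algebra_simps)
    also have "(w0 t)\<^sup>2 * \<kappa>\<^sup>2 \<le> q t * ((8 * N + 2) * q t * n\<^sup>2)"
      using q1[of t] by (intro mult_mono w2q K2) auto
    finally show ?thesis by (simp add: algebra_simps power2_eq_square)
  qed
  show thesis using that[OF 1 2] 3 4 by (simp add: n_def N_def)
qed

lemma bracket_scale_le: "\<bar>t\<bar> \<le> 1 \<Longrightarrow> bracket (t *\<^sub>R \<eta>) \<le> bracket \<eta>"
proof -
  assume t: "\<bar>t\<bar> \<le> 1"
  then have t2: "t\<^sup>2 \<le> 1" by (simp add: abs_square_le_1)
  have n: "(norm (t *\<^sub>R v))\<^sup>2 \<le> (norm v)\<^sup>2" for v :: "'b::real_normed_vector"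
    using mult_right_mono[OF t2, of "(norm v)\<^sup>2"] by (simp add: power_mult_distrib)
  show ?thesis unfolding bracket_def fst_scaleR snd_scaleR
    using n[of "snd (snd \<eta>)"] by (intro add_mono power_mono[OF add_mono[OF n n]] order_refl) auto
qed

definition sdiff :: "('n::finite heis \<Rightarrow> real) \<Rightarrow> 'n heis \<Rightarrow> 'n heis \<Rightarrow> real" where
  "sdiff u \<xi> \<eta> = u (\<xi> \<circ>\<^sub>H \<eta>) + u (\<xi> \<circ>\<^sub>H (- \<eta>)) - 2 * u \<xi>"

text \<open>The second difference is a second derivative along the line through \<open>\<xi>\<close>, estimated by the chain rule; a
  point at distance at most one from \<open>\<xi>\<close> has a comparable gauge. The quadratic gain in \<open>\<parallel>\<eta>\<parallel>\<close> makes the singular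
  kernel integrable at the origin.\<close>

lemma sdiff_profile_near:
  assumes b: "0 \<le> b"
  obtains C where "0 \<le> C" "\<And>k \<xi> (\<eta> :: 'n::finite heis). \<lbrakk>0 < k; heis_norm \<eta> \<le> 1\<rbrakk> \<Longrightarrow>
    \<bar>sdiff (\<lambda>\<zeta>. profile b k (bracket \<zeta>)) \<xi> \<eta>\<bar> \<le> C * bracket \<xi> powr - b * (heis_norm \<eta>)\<^sup>2"
proof -
  define N where "N = real CARD('n)"
  define c1 where "c1 = b + 3"
  define c2 where "c2 = b * (b + 1) + 6 * b + 6"
  define E where "E = c2 * (96 * N + 16) + c1 * (28 * N + 4)"
  define F where "F = (14 * (3 + N)) powr b"
  have N: "1 \<le> N" by (simp add: N_def Suc_leI)
  have c: "0 \<le> c1" "0 \<le> c2" using b by (auto simp: c1_def c2_def)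
  have E: "0 \<le> E" using N c by (simp add: E_def)
  have "\<bar>sdiff (\<lambda>\<zeta>. profile b k (bracket \<zeta>)) \<xi> \<eta>\<bar> \<le> 2 * (E * (F * bracket \<xi> powr - b) * (heis_norm \<eta>)\<^sup>2)"
    if k: "0 < k" and n: "heis_norm \<eta> \<le> 1" for k \<xi> and \<eta> :: "'n heis"
  proof -
    define q where "q t = bracket (\<xi> \<circ>\<^sub>H (t *\<^sub>R \<eta>))" for t
    obtain q' q'' where q': "\<And>t. (q has_field_derivative q' t) (at t)" "\<And>t. (q' has_field_derivative q'' t) (at t)"
      and q1: "\<And>t. (q' t)\<^sup>2 \<le> (96 * N + 16) * (q t)\<^sup>2 * (heis_norm \<eta>)\<^sup>2"
      and q2: "\<And>t. \<bar>q'' t\<bar> \<le> (28 * N + 4) * q t * (heis_norm \<eta>)\<^sup>2"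
      using bracket_line_derivs[OF n, of \<xi>] unfolding q_def[symmetric] N_def[symmetric] by (metis q_def)
    have q0: "0 < q t" for t by (simp add: q_def)
    define g where "g t = profile b k (q t)" for t
    define g' where "g' t = profile' b k (q t) * q' t" for t
    define g'' where "g'' t = profile'' b k (q t) * (q' t)\<^sup>2 + profile' b k (q t) * q'' t" for t
    have dg: "(g has_field_derivative g' t) (at t)" for t
      unfolding g_def[abs_def] g'_def using k q0 by (intro DERIV_chain2[OF profile_deriv(1) q'(1)]) auto
    have dg': "(g' has_field_derivative g'' t) (at t)" for t
    proof -
      have "((\<lambda>t. profile' b k (q t)) has_field_derivative profile'' b k (q t) * q' t) (at t)"
        using k q0 by (intro DERIV_chain2[OF profile_deriv(2) q'(1)]) auto
      from DERIV_mult[OF this q'(2)] show ?thesis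
        unfolding g'_def[abs_def] g''_def by (simp add: power2_eq_square algebra_simps)
    qed
    have "\<bar>g'' t\<bar> \<le> E * (F * bracket \<xi> powr - b) * (heis_norm \<eta>)\<^sup>2" if t: "\<bar>t\<bar> \<le> 1" for t
    proof -
      have "\<bar>g'' t\<bar> \<le> \<bar>profile'' b k (q t)\<bar> * (q' t)\<^sup>2 + \<bar>profile' b k (q t)\<bar> * \<bar>q'' t\<bar>"
        unfolding g''_def by (rule order_trans[OF abs_triangle_ineq]) (simp add: abs_mult)
      also have "\<dots> \<le> (c2 * q t powr (- b - 2)) * ((96 * N + 16) * (q t)\<^sup>2 * (heis_norm \<eta>)\<^sup>2)
          + (c1 * q t powr (- b - 1)) * ((28 * N + 4) * q t * (heis_norm \<eta>)\<^sup>2)"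
        unfolding c1_def c2_def using c by (intro add_mono mult_mono profile_bounds k q0 b q1 q2)
          (auto simp: c1_def c2_def)
      also have "\<dots> = E * (q t powr - b) * (heis_norm \<eta>)\<^sup>2"
        using q0[of t] by (simp add: E_def powr_diff field_simps)
      also have "\<dots> \<le> E * (F * bracket \<xi> powr - b) * (heis_norm \<eta>)\<^sup>2"
      proof (intro mult_right_mono mult_left_mono E)
        have "bracket (t *\<^sub>R \<eta>) \<le> 2 + N"
        proof -
          have "(1 + N) * heis_norm \<eta> ^ 4 \<le> 1 + N"
            using n N by (intro mult_right_le_one_le power_le_one) auto
          then show ?thesis
            using bracket_scale_le[OF t, of \<eta>] bracket_le_heis_norm[of \<eta>] unfolding N_def by linarith
        qed
        also have "\<dots> \<le> (2 + N) * q t" using N by (simp add: q_def)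
        finally have "bracket (- (t *\<^sub>R \<eta>)) \<le> (2 + N) * q t" by simp
        then have "bracket \<xi> \<le> (14 * (3 + N)) * q t"
          using bracket_mult_le[of "\<xi> \<circ>\<^sub>H (t *\<^sub>R \<eta>)" "- (t *\<^sub>R \<eta>)"]
          by (simp add: heis_mult_minus_cancel algebra_simps flip: q_def)
        then have "((14 * (3 + N)) * q t) powr - b \<le> bracket \<xi> powr - b"
          using b by (intro powr_mono2') auto
        moreover have "F * ((14 * (3 + N)) * q t) powr - b = q t powr - b"
          using N q0[of t] by (simp add: F_def powr_mult powr_minus)
        ultimately show "q t powr - b \<le> F * bracket \<xi> powr - b"
          using mult_left_mono[of _ _ F] by (simp add: F_def) (metis powr_ge_zero)
      qed auto
      finally show ?thesis .
    qed
    from second_difference_le[OF dg dg' this]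
    have "\<bar>g 1 + g (- 1) - 2 * g 0\<bar> \<le> 2 * (E * (F * bracket \<xi> powr - b) * (heis_norm \<eta>)\<^sup>2)" by simp
    then show ?thesis by (simp add: g_def q_def sdiff_def)
  qed
  then show thesis by (intro that[of "2 * E * F"]) (use E in \<open>auto simp: F_def algebra_simps\<close>)
qed

text \<open>By the quasi-triangle inequality one of the two factors on the left is already controlled by the weight at \<open>\<xi>\<close>.
  Integrated over \<open>\<eta>\<close>, this says that the convolution of the weight with itself is at most a multiple of the weight.\<close>

lemma bracket_powr_convolve:
  assumes "0 \<le> b"
  shows "bracket (\<xi> \<circ>\<^sub>H \<eta>) powr - b * bracket \<eta> powr - b
    \<le> 28 powr b * bracket \<xi> powr - b * (bracket (\<xi> \<circ>\<^sub>H \<eta>) powr - b + bracket \<eta> powr - b)"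
proof -
  define B where "B = 28 powr b * bracket \<xi> powr - b"
  have B0: "0 \<le> B" by (simp add: B_def)
  have "bracket \<xi> \<le> 14 * (bracket (\<xi> \<circ>\<^sub>H \<eta>) + bracket \<eta>)"
    using bracket_mult_le[of "\<xi> \<circ>\<^sub>H \<eta>" "- \<eta>"] by (simp add: heis_mult_minus_cancel)
  then consider "bracket \<xi> / 28 \<le> bracket (\<xi> \<circ>\<^sub>H \<eta>)" | "bracket \<xi> / 28 \<le> bracket \<eta>" by argo
  then have "bracket (\<xi> \<circ>\<^sub>H \<eta>) powr - b \<le> B \<or> bracket \<eta> powr - b \<le> B"
  proof cases
    have e: "(bracket \<xi> / 28) powr - b = B" by (simp add: B_def powr_divide powr_minus field_simps)
    case 1
    then have "bracket (\<xi> \<circ>\<^sub>H \<eta>) powr - b \<le> (bracket \<xi> / 28) powr - b" using assms by (intro powr_mono2') auto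
    then show ?thesis by (simp add: e)
  next
    have e: "(bracket \<xi> / 28) powr - b = B" by (simp add: B_def powr_divide powr_minus field_simps)
    case 2
    then have "bracket \<eta> powr - b \<le> (bracket \<xi> / 28) powr - b" using assms by (intro powr_mono2') auto
    then show ?thesis by (simp add: e)
  qed
  moreover have "p * r \<le> B * (p + r)" if "p \<le> B \<or> r \<le> B" "0 \<le> p" "0 \<le> r" for p r
    using that(1)
  proof
    assume "p \<le> B" then show ?thesis using mult_right_mono[of p B r] mult_nonneg_nonneg[OF B0 that(2)] that(3) by (simp add: algebra_simps)
  next
    assume "r \<le> B" then show ?thesis using mult_left_mono[of r B p] mult_nonneg_nonneg[OF B0 that(3)] that(2) by (simp add: algebra_simps)
  qed
  ultimately show ?thesis unfolding B_def[symmetric] by simp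
qed

lemma pow4_powr: "0 < (h::real) \<Longrightarrow> (h ^ 4) powr c = h powr (4 * c)"
  using powr_powr[of h 4 c] by simp

lemma heis_norm_powr_le_bracket:
  assumes "0 \<le> b" "1 \<le> heis_norm (\<eta> :: 'n::finite heis)"
  shows "heis_norm \<eta> powr - (4 * b) \<le> (2 + real CARD('n)) powr b * bracket \<eta> powr - b"
proof -
  have "1 \<le> heis_norm \<eta> ^ 4" using assms by simp
  then have "bracket \<eta> \<le> (2 + real CARD('n)) * heis_norm \<eta> ^ 4"
    using bracket_le_heis_norm[of \<eta>] by (simp add: algebra_simps)
  then have "((2 + real CARD('n)) * heis_norm \<eta> ^ 4) powr - b \<le> bracket \<eta> powr - b"
    using assms by (intro powr_mono2') auto
  moreover have "(heis_norm \<eta> ^ 4) powr - b = heis_norm \<eta> powr - (4 * b)"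
    using assms pow4_powr[of "heis_norm \<eta>" "- b"] by simp
  ultimately have "(2 + real CARD('n)) powr - b * heis_norm \<eta> powr - (4 * b) \<le> bracket \<eta> powr - b"
    by (simp add: powr_mult)
  from mult_left_mono[OF this, of "(2 + real CARD('n)) powr b"] show ?thesis
    by (simp add: mult.assoc[symmetric] flip: powr_add)
qed

lemma bracket_powr_le_heis_norm:
  assumes "0 \<le> b" "\<eta> \<noteq> 0"
  shows "bracket \<eta> powr - b \<le> heis_norm \<eta> powr - (4 * b)"
proof -
  have p: "0 < heis_norm \<eta>" using assms(2) by (simp add: less_le)
  have "bracket \<eta> powr - b \<le> (heis_norm \<eta> ^ 4) powr - b"
    using assms p by (intro powr_mono2' heis_norm_le_bracket) auto
  also have "\<dots> = heis_norm \<eta> powr - (4 * b)"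
    using pow4_powr[OF p, of "- b"] by simp
  finally show ?thesis .
qed


section \<open>The fractional sub-Laplacian of the weights\<close>

lemma heis_hdim_ge_4: "4 \<le> heis_hdim TYPE('n::finite)"
proof -
  have "1 \<le> real CARD('n)" by (simp add: Suc_leI)
  then show ?thesis by (simp add: heis_hdim_def)
qed

lemma nn_integral_bracket_powr:
  assumes b: "heis_hdim TYPE('n::finite) < 4 * b"
  shows "(\<integral>\<^sup>+\<eta>. ennreal (bracket \<eta> powr - b) \<partial>(lborel :: 'n heis measure)) < \<infinity>"
proof -
  let ?A = "{\<eta> :: 'n heis. heis_norm \<eta> \<le> 1}" and ?B = "{\<eta> :: 'n heis. 1 \<le> heis_norm \<eta>}"
  have b0: "0 \<le> b" using b heis_hdim_ge_4[where 'n='n] by simp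
  have "(\<integral>\<^sup>+\<eta>. ennreal (bracket \<eta> powr - b) \<partial>(lborel :: 'n heis measure))
      \<le> (\<integral>\<^sup>+\<eta>. indicator ?A \<eta> + indicator ?B \<eta> * ennreal (heis_norm \<eta> powr - (4 * b)) \<partial>lborel)"
  proof (rule nn_integral_mono)
    fix \<eta> :: "'n heis"
    show "ennreal (bracket \<eta> powr - b) \<le> indicator ?A \<eta> + indicator ?B \<eta> * ennreal (heis_norm \<eta> powr - (4 * b))"
    proof (cases "\<eta> \<in> ?A")
      case True
      have "bracket \<eta> powr - b \<le> 1 powr - b" using b0 by (intro powr_mono2') auto
      then have "ennreal (bracket \<eta> powr - b) \<le> 1" by (simp add: ennreal_le_1)
      also have "1 \<le> indicator ?A \<eta> + indicator ?B \<eta> * ennreal (heis_norm \<eta> powr - (4 * b))"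
        using True by (simp add: add_increasing2)
      finally show ?thesis .
    next
      case False
      then have "\<eta> \<in> ?B" by auto
      moreover from this have "\<eta> \<noteq> 0" by (metis heis_norm_eq_0 mem_Collect_eq not_one_le_zero)
      ultimately
      show ?thesis using False bracket_powr_le_heis_norm[OF b0, of \<eta>] by (simp add: ennreal_leI)
    qed
  qed
  also have "\<dots> = emeasure lborel ?A + (\<integral>\<^sup>+\<eta>. indicator ?B \<eta> * ennreal (heis_norm \<eta> powr - (4 * b)) \<partial>lborel)"
    by (subst nn_integral_add) auto
  also have "\<dots> < \<infinity>"
    using emeasure_heis_norm_sublevel[where 'n='n, of 1] nn_integral_heis_norm_powr_far[OF b] by simp
  finally show ?thesis .
qed

lemma borel_measurable_profile [measurable]: "profile b k \<in> borel_measurable borel"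
  unfolding profile_def[abs_def] by measurable

lemma sdiff_profile_measurable [measurable]:
  "(\<lambda>\<eta>. sdiff (\<lambda>\<zeta>. profile b k (bracket (dil r \<zeta>))) \<xi> \<eta>) \<in> borel_measurable borel"
  "(\<lambda>\<eta>. sdiff (\<lambda>\<zeta>. profile b k (bracket \<zeta>)) \<xi> \<eta>) \<in> borel_measurable borel"
proof -
  have m: "(\<lambda>\<eta>. \<xi> \<circ>\<^sub>H (- \<eta>)) \<in> borel_measurable borel"
    by (rule measurable_compose[OF borel_measurable_uminus borel_measurable_heis(4)]) simp
  note [measurable] = m
  show "(\<lambda>\<eta>. sdiff (\<lambda>\<zeta>. profile b k (bracket (dil r \<zeta>))) \<xi> \<eta>) \<in> borel_measurable borel"
    "(\<lambda>\<eta>. sdiff (\<lambda>\<zeta>. profile b k (bracket \<zeta>)) \<xi> \<eta>) \<in> borel_measurable borel"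
    unfolding sdiff_def by measurable
qed

text \<open>The core estimate: near increments by \<open>sdiff_profile_near\<close>, far ones by \<open>bracket_powr_convolve\<close>. Everything is
  dominated by the weight at \<open>\<xi>\<close> times a function of \<open>\<eta>\<close> whose integral does not depend on \<open>\<xi>\<close>, by translation
  invariance, nor on \<open>k\<close>.\<close>

lemma nn_integral_sdiff_profile:
  assumes b: "heis_hdim TYPE('n::finite) < 4 * b" "4 * b < heis_hdim TYPE('n) + 2"
  obtains C where "0 \<le> C" "\<And>k (\<xi> :: 'n heis). 0 < k \<Longrightarrow>
    (\<integral>\<^sup>+\<eta>. ennreal (\<bar>sdiff (\<lambda>\<zeta>. profile b k (bracket \<zeta>)) \<xi> \<eta>\<bar> / heis_norm \<eta> powr (4 * b)) \<partial>lborel)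
      \<le> ennreal (C * bracket \<xi> powr - b)"
proof -
  have b0: "0 \<le> b" and b4: "4 * b - 2 \<ge> 0" using b heis_hdim_ge_4[where 'n='n] by auto
  let ?A = "{\<eta> :: 'n heis. 0 < heis_norm \<eta> \<and> heis_norm \<eta> \<le> 1}" and ?B = "{\<eta> :: 'n heis. 1 \<le> heis_norm \<eta>}"
  define \<Phi> where "\<Phi> \<eta> = bracket \<eta> powr - b" for \<eta> :: "'n heis"
  have [measurable]: "\<Phi> \<in> borel_measurable borel" unfolding \<Phi>_def[abs_def] by measurable
  obtain C1 where C1: "0 \<le> C1" "\<And>k \<xi> (\<eta> :: 'n heis). \<lbrakk>0 < k; heis_norm \<eta> \<le> 1\<rbrakk> \<Longrightarrow>
    \<bar>sdiff (\<lambda>\<zeta>. profile b k (bracket \<zeta>)) \<xi> \<eta>\<bar> \<le> C1 * \<Phi> \<xi> * (heis_norm \<eta>)\<^sup>2"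
    unfolding \<Phi>_def using sdiff_profile_near[OF b0, where 'n='n] by metis
  define F where "F = (2 + real CARD('n)) powr b * 28 powr b"
  have F: "0 \<le> F" by (simp add: F_def)
  define C2 where "C2 = C1 + F + 2"
  have C2: "C1 \<le> C2" "F \<le> C2" "2 \<le> C2" "0 \<le> C2" using C1 F by (auto simp: C2_def)
  \<comment> \<open>The dominating function: the two radial terms are for near and far increments, the others come from the convolution estimate.\<close>
  define W where "W \<xi> \<eta> = indicator ?A \<eta> * ennreal (heis_norm \<eta> powr - (4 * b - 2))
      + indicator ?B \<eta> * ennreal (heis_norm \<eta> powr - (4 * b))
      + ennreal (\<Phi> (\<xi> \<circ>\<^sub>H \<eta>)) + ennreal (\<Phi> (\<xi> \<circ>\<^sub>H (- \<eta>))) + 2 * ennreal (\<Phi> \<eta>)" for \<xi> \<eta>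
  define I1 where "I1 = (\<integral>\<^sup>+\<eta>. indicator ?A \<eta> * ennreal (heis_norm \<eta> powr - (4 * b - 2)) \<partial>lborel)"
  define I2 where "I2 = (\<integral>\<^sup>+\<eta>. indicator ?B \<eta> * ennreal (heis_norm \<eta> powr - (4 * b)) \<partial>lborel)"
  define I3 where "I3 = (\<integral>\<^sup>+\<eta>. ennreal (\<Phi> \<eta>) \<partial>lborel)"
  have pt: "ennreal (\<bar>sdiff (\<lambda>\<zeta>. profile b k (bracket \<zeta>)) \<xi> \<eta>\<bar> / heis_norm \<eta> powr (4 * b))
      \<le> ennreal (C2 * \<Phi> \<xi>) * W \<xi> \<eta>" if k: "0 < k" for k \<xi> \<eta>
  proof -
    let ?D = "\<bar>sdiff (\<lambda>\<zeta>. profile b k (bracket \<zeta>)) \<xi> \<eta>\<bar>"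
    consider "\<eta> = 0" | "\<eta> \<in> ?A" | "\<eta> \<in> ?B"
      using heis_norm_nonneg[of \<eta>] heis_norm_eq_0[of \<eta>] by (auto simp del: heis_norm_nonneg heis_norm_eq_0) linarith
    then show ?thesis
    proof cases
      case 1 then show ?thesis by (simp add: sdiff_def)
    next
      case 2
      then have n: "0 < heis_norm \<eta>" "heis_norm \<eta> \<le> 1" by auto
      have "?D / heis_norm \<eta> powr (4 * b) \<le> (C1 * \<Phi> \<xi> * (heis_norm \<eta>)\<^sup>2) / heis_norm \<eta> powr (4 * b)"
        by (intro divide_right_mono C1 k n) auto
      also have "\<dots> = C1 * \<Phi> \<xi> * heis_norm \<eta> powr - (4 * b - 2)"
        using n by (simp add: powr_diff powr_minus field_simps)
      also have "\<dots> \<le> C2 * \<Phi> \<xi> * heis_norm \<eta> powr - (4 * b - 2)"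
        using C2 by (intro mult_right_mono) (auto simp: \<Phi>_def)
      finally have "ennreal (?D / heis_norm \<eta> powr (4 * b)) \<le> ennreal (C2 * \<Phi> \<xi>) * ennreal (heis_norm \<eta> powr - (4 * b - 2))"
        by (subst ennreal_mult[symmetric]) (use C2 in \<open>auto simp: \<Phi>_def intro!: ennreal_leI\<close>)
      also have "\<dots> \<le> ennreal (C2 * \<Phi> \<xi>) * W \<xi> \<eta>"
        using 2 by (intro mult_left_mono) (auto simp: W_def add.assoc)
      finally show ?thesis .
    next
      case 3
      then have n: "1 \<le> heis_norm \<eta>" by simp
      have pr: "\<bar>profile b k (bracket \<zeta>)\<bar> \<le> \<Phi> \<zeta>" "0 \<le> \<Phi> \<zeta>" for \<zeta> :: "'n heis"
        using profile_bounds(1,2)[OF k _ b0, of "bracket \<zeta>"] by (auto simp: \<Phi>_def)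
      let ?h = "heis_norm \<eta> powr - (4 * b)"
      have "?D \<le> \<Phi> (\<xi> \<circ>\<^sub>H \<eta>) + \<Phi> (\<xi> \<circ>\<^sub>H (- \<eta>)) + 2 * \<Phi> \<xi>"
        using pr[of "\<xi> \<circ>\<^sub>H \<eta>"] pr[of "\<xi> \<circ>\<^sub>H (- \<eta>)"] pr[of \<xi>] unfolding sdiff_def by linarith
      then have "?D / heis_norm \<eta> powr (4 * b) \<le> (\<Phi> (\<xi> \<circ>\<^sub>H \<eta>) + \<Phi> (\<xi> \<circ>\<^sub>H (- \<eta>)) + 2 * \<Phi> \<xi>) / heis_norm \<eta> powr (4 * b)"
        by (intro divide_right_mono) auto
      also have "\<dots> = \<Phi> (\<xi> \<circ>\<^sub>H \<eta>) * ?h + \<Phi> (\<xi> \<circ>\<^sub>H (- \<eta>)) * ?h + 2 * \<Phi> \<xi> * ?h"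
        by (simp add: powr_minus divide_inverse algebra_simps)
      also have "\<dots> \<le> F * \<Phi> \<xi> * (\<Phi> (\<xi> \<circ>\<^sub>H \<eta>) + \<Phi> \<eta>) + F * \<Phi> \<xi> * (\<Phi> (\<xi> \<circ>\<^sub>H (- \<eta>)) + \<Phi> \<eta>) + 2 * \<Phi> \<xi> * ?h"
      proof -
        have *: "\<Phi> (\<xi> \<circ>\<^sub>H \<zeta>) * ?h \<le> F * \<Phi> \<xi> * (\<Phi> (\<xi> \<circ>\<^sub>H \<zeta>) + \<Phi> \<eta>)" if "\<zeta> = \<eta> \<or> \<zeta> = - \<eta>" for \<zeta>
        proof -
          have e: "\<Phi> \<zeta> = \<Phi> \<eta>" using that by (auto simp: \<Phi>_def)
          have "\<Phi> (\<xi> \<circ>\<^sub>H \<zeta>) * ?h \<le> \<Phi> (\<xi> \<circ>\<^sub>H \<zeta>) * ((2 + real CARD('n)) powr b * \<Phi> \<eta>)"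
            unfolding \<Phi>_def using heis_norm_powr_le_bracket[OF b0 n] by (intro mult_left_mono) auto
          also have "\<dots> = (2 + real CARD('n)) powr b * (\<Phi> (\<xi> \<circ>\<^sub>H \<zeta>) * \<Phi> \<zeta>)" by (simp add: e)
          also have "\<dots> \<le> (2 + real CARD('n)) powr b * (28 powr b * \<Phi> \<xi> * (\<Phi> (\<xi> \<circ>\<^sub>H \<zeta>) + \<Phi> \<zeta>))"
            unfolding \<Phi>_def by (intro mult_left_mono bracket_powr_convolve b0) auto
          finally show ?thesis by (simp add: F_def e mult.assoc)
        qed
        show ?thesis by (intro add_mono * order_refl) auto
      qed
      also have "\<dots> \<le> C2 * \<Phi> \<xi> * (\<Phi> (\<xi> \<circ>\<^sub>H \<eta>) + \<Phi> \<eta>) + C2 * \<Phi> \<xi> * (\<Phi> (\<xi> \<circ>\<^sub>H (- \<eta>)) + \<Phi> \<eta>) + C2 * \<Phi> \<xi> * ?h"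
        using C2 pr(2) by (intro add_mono mult_right_mono) (auto intro!: add_nonneg_nonneg)
      also have "\<dots> = C2 * \<Phi> \<xi> * (?h + \<Phi> (\<xi> \<circ>\<^sub>H \<eta>) + \<Phi> (\<xi> \<circ>\<^sub>H (- \<eta>)) + 2 * \<Phi> \<eta>)"
        by (simp add: algebra_simps)
      finally have "ennreal (?D / heis_norm \<eta> powr (4 * b))
          \<le> ennreal (C2 * \<Phi> \<xi> * (?h + \<Phi> (\<xi> \<circ>\<^sub>H \<eta>) + \<Phi> (\<xi> \<circ>\<^sub>H (- \<eta>)) + 2 * \<Phi> \<eta>))" by (rule ennreal_leI)
      also have "\<dots> = ennreal (C2 * \<Phi> \<xi>) * (ennreal ?h + ennreal (\<Phi> (\<xi> \<circ>\<^sub>H \<eta>)) + ennreal (\<Phi> (\<xi> \<circ>\<^sub>H (- \<eta>))) + 2 * ennreal (\<Phi> \<eta>))"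
        using C2 pr(2) by (simp add: ennreal_mult ennreal_plus)
      also have "\<dots> \<le> ennreal (C2 * \<Phi> \<xi>) * W \<xi> \<eta>"
        using 3 by (intro mult_left_mono) (auto simp: W_def add.assoc intro!: add_increasing)
      finally show ?thesis .
    qed
  qed
  have m: "(\<lambda>\<eta>. \<xi> \<circ>\<^sub>H (- \<eta>)) \<in> borel_measurable borel" for \<xi> :: "'n heis"
    by (rule measurable_compose[OF borel_measurable_uminus borel_measurable_heis(4)]) simp
  note [measurable] = m
  have W: "(\<integral>\<^sup>+\<eta>. W \<xi> \<eta> \<partial>lborel) = I1 + I2 + I3 + I3 + 2 * I3" for \<xi>
  proof -
    have i3: "(\<integral>\<^sup>+\<eta>. ennreal (\<Phi> (\<xi> \<circ>\<^sub>H \<eta>)) \<partial>lborel) = I3"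
      unfolding I3_def by (rule nn_integral_heis_mult[of "\<lambda>\<eta>. ennreal (\<Phi> \<eta>)"]) measurable
    have i4: "(\<integral>\<^sup>+\<eta>. ennreal (\<Phi> (\<xi> \<circ>\<^sub>H (- \<eta>))) \<partial>lborel) = I3"
      unfolding i3[symmetric] by (rule nn_integral_heis_minus[of "\<lambda>\<eta>. ennreal (\<Phi> (\<xi> \<circ>\<^sub>H \<eta>))"]) measurable
    show ?thesis
      unfolding W_def I1_def I2_def by (simp add: nn_integral_add nn_integral_cmult i3 i4 flip: I3_def)
  qed
  have "I1 < \<infinity>" unfolding I1_def using b b4 by (intro nn_integral_heis_norm_powr_near) auto
  moreover have "I2 < \<infinity>" unfolding I2_def using b by (intro nn_integral_heis_norm_powr_far) auto
  moreover have "I3 < \<infinity>" unfolding I3_def \<Phi>_def using b by (intro nn_integral_bracket_powr) auto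
  ultimately have fin: "I1 + I2 + I3 + I3 + 2 * I3 < \<infinity>" by (simp add: ennreal_mult_less_top)
  define I where "I = enn2real (I1 + I2 + I3 + I3 + 2 * I3)"
  have I: "I1 + I2 + I3 + I3 + 2 * I3 = ennreal I"
    unfolding I_def using fin by (intro ennreal_enn2real[symmetric]) simp
  show thesis
  proof (rule that[of "C2 * I"])
    show "0 \<le> C2 * I" using C2 by (simp add: I_def)
    fix k :: real and \<xi> :: "'n heis" assume k: "0 < k"
    have "(\<integral>\<^sup>+\<eta>. ennreal (\<bar>sdiff (\<lambda>\<zeta>. profile b k (bracket \<zeta>)) \<xi> \<eta>\<bar> / heis_norm \<eta> powr (4 * b)) \<partial>lborel)
      \<le> (\<integral>\<^sup>+\<eta>. ennreal (C2 * \<Phi> \<xi>) * W \<xi> \<eta> \<partial>lborel)"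
      by (intro nn_integral_mono pt k)
    also have "\<dots> = ennreal (C2 * \<Phi> \<xi>) * (\<integral>\<^sup>+\<eta>. W \<xi> \<eta> \<partial>lborel)"
      by (rule nn_integral_cmult) (unfold W_def, measurable)
    also have "\<dots> = ennreal (C2 * I * bracket \<xi> powr - b)"
      unfolding W I using C2 by (subst ennreal_mult[symmetric]) (auto simp: \<Phi>_def I_def algebra_simps)
    finally show "(\<integral>\<^sup>+\<eta>. ennreal (\<bar>sdiff (\<lambda>\<zeta>. profile b k (bracket \<zeta>)) \<xi> \<eta>\<bar> / heis_norm \<eta> powr (4 * b)) \<partial>lborel)
      \<le> ennreal (C2 * I * bracket \<xi> powr - b)" .
  qed
qed

lemma nn_integral_sdiff_dil:
  fixes u :: "'n::finite heis \<Rightarrow> real"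
  assumes [measurable]: "u \<in> borel_measurable borel" and r: "0 < r"
  shows "(\<integral>\<^sup>+\<eta>. ennreal (\<bar>sdiff (\<lambda>\<zeta>. u (dil r \<zeta>)) \<xi> \<eta>\<bar> / heis_norm \<eta> powr a) \<partial>lborel)
    = ennreal (r powr (a - heis_hdim TYPE('n)))
      * (\<integral>\<^sup>+\<eta>. ennreal (\<bar>sdiff u (dil r \<xi>) \<eta>\<bar> / heis_norm \<eta> powr a) \<partial>lborel)"
proof -
  define F where "F \<eta> = ennreal (\<bar>sdiff u (dil r \<xi>) \<eta>\<bar> / heis_norm \<eta> powr a)" for \<eta>
  have m: "(\<lambda>\<eta>. dil r \<xi> \<circ>\<^sub>H (- \<eta>)) \<in> borel_measurable borel"
    by (rule measurable_compose[OF borel_measurable_uminus borel_measurable_heis(4)]) simp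
  note [measurable] = m
  have [measurable]: "F \<in> borel_measurable borel" unfolding F_def[abs_def] sdiff_def by measurable
  have e: "ennreal (\<bar>sdiff (\<lambda>\<zeta>. u (dil r \<zeta>)) \<xi> \<eta>\<bar> / heis_norm \<eta> powr a) = ennreal (r powr a) * F (dil r \<eta>)" for \<eta>
    unfolding F_def using r
    by (subst ennreal_mult[symmetric])
       (auto simp: sdiff_def dil_mult dil_minus heis_norm_dil powr_mult)
  have "ennreal (r powr (a - heis_hdim TYPE('n))) * (\<integral>\<^sup>+\<eta>. F \<eta> \<partial>lborel)
     = ennreal (r powr (a - heis_hdim TYPE('n))) * (ennreal (r powr heis_hdim TYPE('n)) * (\<integral>\<^sup>+\<eta>. F (dil r \<eta>) \<partial>lborel))"
    using r by (subst nn_integral_dil) auto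
  also have "\<dots> = ennreal (r powr a) * (\<integral>\<^sup>+\<eta>. F (dil r \<eta>) \<partial>lborel)"
    by (simp add: mult.assoc[symmetric] ennreal_mult[symmetric] powr_add[symmetric])
  also have "\<dots> = (\<integral>\<^sup>+\<eta>. ennreal (r powr a) * F (dil r \<eta>) \<partial>lborel)"
    by (rule nn_integral_cmult[symmetric]) measurable
  finally show ?thesis by (simp add: e F_def)
qed

text \<open>The absolute bound on the integrand is kept as a Lebesgue integral with values in the extended reals, so that
  integrability of the kernel integral comes with the estimate.\<close>

lemma frac_sublaplacian_bound:
  fixes u :: "'n::finite heis \<Rightarrow> real"
  assumes m: "(\<lambda>\<eta>. sdiff u \<xi> \<eta>) \<in> borel_measurable borel"
    and B: "0 \<le> B" "(\<integral>\<^sup>+\<eta>. ennreal (\<bar>sdiff u \<xi> \<eta>\<bar> / heis_norm \<eta> powr (heis_hdim TYPE('n) + 2 * s)) \<partial>lborel) \<le> ennreal B"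
  shows "\<bar>frac_sublaplacian c s u \<xi>\<bar> \<le> \<bar>c CARD('n) s\<bar> / 2 * B"
    and "integrable lebesgue (\<lambda>\<eta>. sdiff u \<xi> \<eta> / heis_norm \<eta> powr (heis_hdim TYPE('n) + 2 * s))"
proof -
  let ?g = "\<lambda>\<eta>. sdiff u \<xi> \<eta> / heis_norm \<eta> powr (heis_hdim TYPE('n) + 2 * s)"
  note [measurable] = m
  have [measurable]: "?g \<in> borel_measurable lebesgue" by (rule measurable_completion) measurable
  have le: "(\<integral>\<^sup>+\<eta>. ennreal (norm (?g \<eta>)) \<partial>lebesgue) \<le> ennreal B"
    using B(2) by (simp add: nn_integral_completion)
  show i: "integrable lebesgue ?g"
    by (rule integrableI_bounded) (use le in \<open>auto intro: le_less_trans\<close>)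
  have "ennreal (norm (LINT \<eta>|lebesgue. ?g \<eta>)) \<le> ennreal B"
    using integral_norm_bound_ennreal[OF i] le by (rule order_trans)
  then have "norm (LINT \<eta>|lebesgue. ?g \<eta>) \<le> B" using B(1) by simp
  then have "\<bar>c CARD('n) s\<bar> / 2 * \<bar>LINT \<eta>|lebesgue. ?g \<eta>\<bar> \<le> \<bar>c CARD('n) s\<bar> / 2 * B"
    by (intro mult_left_mono) auto
  then show "\<bar>frac_sublaplacian c s u \<xi>\<bar> \<le> \<bar>c CARD('n) s\<bar> / 2 * B"
    by (simp add: frac_sublaplacian_def sdiff_def abs_mult)
qed

lemma frac_sublaplacian_profile_upper:
  fixes c :: "nat \<Rightarrow> real \<Rightarrow> real"
  assumes s: "0 < s" "s < 1" and b: "4 * b = heis_hdim TYPE('n::finite) + 2 * s"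
  obtains C where "0 \<le> C" "\<And>k r (\<xi> :: 'n heis). \<lbrakk>0 < k; 0 < r\<rbrakk> \<Longrightarrow>
    \<bar>frac_sublaplacian c s (\<lambda>\<zeta>. profile b k (bracket (dil r \<zeta>))) \<xi>\<bar>
      \<le> C * r powr (2 * s) * bracket (dil r \<xi>) powr - b"
proof -
  obtain C where C: "0 \<le> C" "\<And>k (\<xi> :: 'n heis). 0 < k \<Longrightarrow>
    (\<integral>\<^sup>+\<eta>. ennreal (\<bar>sdiff (\<lambda>\<zeta>. profile b k (bracket \<zeta>)) \<xi> \<eta>\<bar> / heis_norm \<eta> powr (4 * b)) \<partial>lborel)
      \<le> ennreal (C * bracket \<xi> powr - b)"
    using nn_integral_sdiff_profile[where 'n='n, of b] s b by auto
  show thesis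
  proof (rule that[of "\<bar>c CARD('n) s\<bar> / 2 * C"])
    show "0 \<le> \<bar>c CARD('n) s\<bar> / 2 * C" using C by simp
    fix k r :: real and \<xi> :: "'n heis" assume k: "0 < k" and r: "0 < r"
    let ?u = "\<lambda>\<zeta> :: 'n heis. profile b k (bracket (dil r \<zeta>))"
    have "(\<integral>\<^sup>+\<eta>. ennreal (\<bar>sdiff ?u \<xi> \<eta>\<bar> / heis_norm \<eta> powr (4 * b)) \<partial>lborel)
        = ennreal (r powr (2 * s)) * (\<integral>\<^sup>+\<eta>. ennreal (\<bar>sdiff (\<lambda>\<zeta>. profile b k (bracket \<zeta>)) (dil r \<xi>) \<eta>\<bar> / heis_norm \<eta> powr (4 * b)) \<partial>lborel)"
      using nn_integral_sdiff_dil[of "\<lambda>\<zeta> :: 'n heis. profile b k (bracket \<zeta>)" r \<xi> "4 * b"] r b by simp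
    also have "\<dots> \<le> ennreal (r powr (2 * s)) * ennreal (C * bracket (dil r \<xi>) powr - b)"
      by (intro mult_left_mono C k) auto
    also have "\<dots> = ennreal (C * r powr (2 * s) * bracket (dil r \<xi>) powr - b)"
      using C by (subst ennreal_mult[symmetric]) (auto simp: algebra_simps)
    finally have le: "(\<integral>\<^sup>+\<eta>. ennreal (\<bar>sdiff ?u \<xi> \<eta>\<bar> / heis_norm \<eta> powr (heis_hdim TYPE('n) + 2 * s)) \<partial>lborel)
        \<le> ennreal (C * r powr (2 * s) * bracket (dil r \<xi>) powr - b)" by (simp only: b)
    show "\<bar>frac_sublaplacian c s ?u \<xi>\<bar> \<le> \<bar>c CARD('n) s\<bar> / 2 * C * r powr (2 * s) * bracket (dil r \<xi>) powr - b"
      using frac_sublaplacian_bound(1)[OF _ _ le, of c] C by (simp add: mult.assoc)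
  qed
qed

text \<open>The total mass of a bump, which is the constant in the lower bound below.\<close>

lemma nn_integral_profile_pos:
  assumes b: "heis_hdim TYPE('n::finite) < 4 * b" and k: "1 < k"
  obtains j where "0 < j" "(\<integral>\<^sup>+\<eta>. ennreal (profile b k (bracket \<eta>)) \<partial>(lborel :: 'n heis measure)) = ennreal j"
proof -
  have b0: "0 \<le> b" using b heis_hdim_ge_4[where 'n='n] by simp
  define J where "J = (\<integral>\<^sup>+\<eta>. ennreal (profile b k (bracket \<eta>)) \<partial>(lborel :: 'n heis measure))"
  have "J \<le> (\<integral>\<^sup>+\<eta>. ennreal (bracket \<eta> powr - b) \<partial>(lborel :: 'n heis measure))"
    unfolding J_def using k b0 by (intro nn_integral_mono ennreal_leI profile_bounds) auto
  then have fin: "J < \<infinity>" using nn_integral_bracket_powr[OF b] by (rule le_less_trans)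
  have "J \<noteq> 0"
  proof
    assume "J = 0"
    then have ae: "AE \<eta> in (lborel :: 'n heis measure). ennreal (profile b k (bracket \<eta>)) = 0"
      unfolding J_def by (subst (asm) nn_integral_0_iff_AE) auto
    have pos: "0 < profile b k (bracket \<eta>)" if "bracket \<eta> < k" for \<eta> :: "'n heis"
    proof -
      have "0 < 1 - bracket \<eta> / k" using that k by simp
      moreover have "0 < bracket \<eta> powr - b" using bracket_pos[of \<eta>] by (simp del: bracket_pos)
      ultimately show ?thesis by (simp add: profile_def zero_less_mult_iff)
    qed
    from ae have "AE \<eta> in (lborel :: 'n heis measure). \<not> bracket \<eta> < k"
    proof eventually_elim
      case (elim \<eta>)
      with pos[of \<eta>] show ?case by (auto simp: ennreal_eq_0_iff)
    qed
    then have "{\<eta> :: 'n heis. bracket \<eta> < k} \<in> null_sets lborel"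
      using AE_iff_null[of "lborel :: 'n heis measure" "\<lambda>\<eta>. \<not> bracket \<eta> < k"] by simp
    then have "negligible {\<eta> :: 'n heis. bracket \<eta> < k}"
      by (simp add: negligible_iff_null_sets null_sets_completionI)
    moreover have "open {\<eta> :: 'n heis. bracket \<eta> < k}"
      by (intro open_Collect_less continuous_bracket continuous_intros)
    moreover have "bracket (0 :: 'n heis) < k" using k by (simp add: bracket_def)
    ultimately show False using open_not_negligible by blast
  qed
  with fin have "0 < enn2real J" by (simp add: enn2real_positive_iff zero_less_iff_neq_zero)
  moreover have "J = ennreal (enn2real J)" using fin by (intro ennreal_enn2real[symmetric]) simp
  ultimately show thesis using that unfolding J_def by blast
qed

text \<open>Where the bump vanishes, its second difference is non-negative, so there is no cancellation in the integral. The
  integral is at least the mass of the bump times the smallest value of the kernel on those \<open>\<eta>\<close> that carry \<open>\<xi>\<close> into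
  the support, and these have gauge at most a multiple of that of \<open>\<xi>\<close>.\<close>

lemma frac_sublaplacian_profile_lower:
  fixes c :: "nat \<Rightarrow> real \<Rightarrow> real"
  assumes s: "0 < s" "s < 1" and b: "4 * b = heis_hdim TYPE('n::finite) + 2 * s"
    and c: "0 < c CARD('n) s" and k: "1 < k"
  obtains d where "0 < d" "\<And>\<xi> :: 'n heis. k \<le> bracket \<xi> \<Longrightarrow>
    d * bracket \<xi> powr - b \<le> \<bar>frac_sublaplacian c s (\<lambda>\<zeta>. profile b k (bracket \<zeta>)) \<xi>\<bar>"
proof -
  have b0: "0 \<le> b" and bQ: "heis_hdim TYPE('n) < 4 * b" "4 * b < heis_hdim TYPE('n) + 2"
    using s b heis_hdim_ge_4[where 'n='n] by auto
  let ?\<phi> = "\<lambda>\<zeta> :: 'n heis. profile b k (bracket \<zeta>)"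
  obtain C where C: "0 \<le> C" and C': "\<And>k (\<xi> :: 'n heis). 0 < k \<Longrightarrow>
    (\<integral>\<^sup>+\<eta>. ennreal (\<bar>sdiff (\<lambda>\<zeta>. profile b k (bracket \<zeta>)) \<xi> \<eta>\<bar> / heis_norm \<eta> powr (4 * b)) \<partial>lborel)
      \<le> ennreal (C * bracket \<xi> powr - b)"
    using nn_integral_sdiff_profile[where 'n='n, of b] bQ by auto
  obtain j where j: "0 < j" "(\<integral>\<^sup>+\<eta>. ennreal (?\<phi> \<eta>) \<partial>lborel) = ennreal j"
    using nn_integral_profile_pos[OF bQ(1) k] by blast
  have \<phi>0: "0 \<le> ?\<phi> \<zeta>" for \<zeta> using profile_bounds(1)[of k "bracket \<zeta>" b] k b0 by simp
  have \<phi>k: "?\<phi> \<zeta> = 0" if "k \<le> bracket \<zeta>" for \<zeta> using that k by (simp add: profile_def max_def field_simps)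
  define d where "d = c CARD('n) s / 2 * ((28 * k) powr - b * j)"
  show thesis
  proof (rule that[of d])
    show "0 < d" using c j k by (simp add: d_def)
    fix \<xi> :: "'n heis" assume \<xi>: "k \<le> bracket \<xi>"
    let ?g = "\<lambda>\<eta>. sdiff ?\<phi> \<xi> \<eta> / heis_norm \<eta> powr (heis_hdim TYPE('n) + 2 * s)"
    let ?m = "(28 * k) powr - b * bracket \<xi> powr - b"
    have sd: "sdiff ?\<phi> \<xi> \<eta> = ?\<phi> (\<xi> \<circ>\<^sub>H \<eta>) + ?\<phi> (\<xi> \<circ>\<^sub>H (- \<eta>))" for \<eta>
      using \<phi>k[OF \<xi>] by (simp add: sdiff_def)
    have i: "integrable lebesgue ?g"
      by (rule frac_sublaplacian_bound(2)[OF _ _ C'[of k \<xi>, unfolded b]]) (use C k in auto)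
    have pt: "?m * ?\<phi> (\<xi> \<circ>\<^sub>H \<eta>) \<le> ?g \<eta>" for \<eta>
    proof (cases "\<eta> = 0 \<or> k \<le> bracket (\<xi> \<circ>\<^sub>H \<eta>)")
      case True
      then have "?\<phi> (\<xi> \<circ>\<^sub>H \<eta>) = 0" using \<phi>k[OF \<xi>] \<phi>k[of "\<xi> \<circ>\<^sub>H \<eta>"] by auto
      moreover have "0 \<le> ?g \<eta>" unfolding sd by (intro divide_nonneg_nonneg add_nonneg_nonneg \<phi>0) auto
      ultimately show ?thesis by simp
    next
      case False
      have "bracket \<eta> \<le> 14 * (bracket \<xi> + bracket (\<xi> \<circ>\<^sub>H \<eta>))"
        using bracket_mult_le[of "- \<xi>" "\<xi> \<circ>\<^sub>H \<eta>"] by (simp add: heis_mult_minus_cancel)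
      also have "\<dots> \<le> 28 * bracket \<xi>" using False \<xi> by simp
      also have "\<dots> \<le> 28 * k * bracket \<xi>" using k by simp
      finally have "(28 * k * bracket \<xi>) powr - b \<le> bracket \<eta> powr - b" using b0 by (intro powr_mono2') auto
      also have "\<dots> \<le> heis_norm \<eta> powr - (4 * b)" using False by (intro bracket_powr_le_heis_norm b0) auto
      finally have "?m \<le> heis_norm \<eta> powr - (4 * b)" using k by (simp add: powr_mult)
      then have "?m * ?\<phi> (\<xi> \<circ>\<^sub>H \<eta>) \<le> heis_norm \<eta> powr - (4 * b) * (?\<phi> (\<xi> \<circ>\<^sub>H \<eta>) + ?\<phi> (\<xi> \<circ>\<^sub>H (- \<eta>)))"
        using \<phi>0 by (intro mult_mono) auto
      also have "\<dots> = ?g \<eta>" unfolding sd b powr_minus divide_inverse by (rule mult.commute)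
      finally show ?thesis .
    qed
    have g0: "0 \<le> ?g \<eta>" for \<eta> using order_trans[OF _ pt[of \<eta>]] \<phi>0 by (simp add: zero_le_mult_iff)
    have "ennreal (?m * j) = ennreal ?m * (\<integral>\<^sup>+\<eta>. ennreal (?\<phi> (\<xi> \<circ>\<^sub>H \<eta>)) \<partial>lborel)"
      using j by (subst nn_integral_heis_mult[of "\<lambda>\<eta>. ennreal (?\<phi> \<eta>)"]) (auto simp: ennreal_mult)
    also have "\<dots> = (\<integral>\<^sup>+\<eta>. ennreal ?m * ennreal (?\<phi> (\<xi> \<circ>\<^sub>H \<eta>)) \<partial>lborel)"
      by (rule nn_integral_cmult[symmetric]) measurable
    also have "\<dots> \<le> (\<integral>\<^sup>+\<eta>. ennreal (?g \<eta>) \<partial>lborel)"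
      using pt \<phi>0 by (intro nn_integral_mono) (simp add: ennreal_mult[symmetric] ennreal_leI)
    also have "\<dots> = ennreal (LINT \<eta>|lebesgue. ?g \<eta>)"
      using nn_integral_eq_integral[OF i] g0 by (simp add: nn_integral_completion)
    finally have "?m * j \<le> (LINT \<eta>|lebesgue. ?g \<eta>)"
      using g0 by (subst (asm) ennreal_le_iff) (auto intro!: integral_nonneg_AE)
    then have "c CARD('n) s / 2 * (?m * j) \<le> c CARD('n) s / 2 * (LINT \<eta>|lebesgue. ?g \<eta>)"
      using c by (intro mult_left_mono) auto
    also have "\<dots> \<le> \<bar>frac_sublaplacian c s ?\<phi> \<xi>\<bar>"
      by (simp add: frac_sublaplacian_def sdiff_def)
    finally show "d * bracket \<xi> powr - b \<le> \<bar>frac_sublaplacian c s ?\<phi> \<xi>\<bar>" by (simp add: d_def algebra_simps)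
  qed
qed


section \<open>Weak solutions tested against truncated weights\<close>

text \<open>Fubini for a product of a function of \<open>t\<close> and one of \<open>x\<close>. Complete Lebesgue measure on a product space is a proper
  extension of the product measure, so \<open>F\<close> is first replaced by a Borel function that equals it almost everywhere.\<close>

lemma lebesgue_product_integral:
  fixes h :: "'a::euclidean_space \<Rightarrow> real" and F :: "'b::euclidean_space \<Rightarrow> real"
  assumes h: "integrable lborel h" and F: "integrable lebesgue F"
  shows "integrable lebesgue (\<lambda>z. h (fst z) * F (snd z))"
    and "(LINT z|lebesgue. h (fst z) * F (snd z)) = (LINT t|lborel. h t) * (LINT x|lebesgue. F x)"
proof -
  obtain F' where F'[measurable]: "F' \<in> borel_measurable borel" and ae: "AE x in lborel. F x = F' x"
    using completion_ex_borel_measurable_real[OF borel_measurable_integrable[OF F]] by auto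
  have ae': "AE x in lebesgue. F x = F' x" using ae by (rule AE_completion)
  have "integrable lebesgue F'"
    using F by (rule integrable_cong_AE_imp) (use ae' in \<open>auto intro: measurable_completion\<close>)
  then have iF': "integrable lborel F'" by (simp add: integrable_completion)
  have eF': "(LINT x|lebesgue. F x) = (LINT x|lborel. F' x)"
  proof -
    have "(LINT x|lebesgue. F x) = (LINT x|lebesgue. F' x)"
      by (rule integral_cong_AE) (use F ae' in \<open>auto intro: measurable_completion\<close>)
    then show ?thesis by (simp add: integral_completion)
  qed
  have [measurable]: "h \<in> borel_measurable borel" using borel_measurable_integrable[OF h] by simp
  have i: "integrable (lborel \<Otimes>\<^sub>M lborel) (\<lambda>z. h (fst z) * F' (snd z))"
  proof (rule lborel_pair.Fubini_integrable)
    show "integrable lborel (\<lambda>x. LINT y|lborel. norm (h (fst (x, y)) * F' (snd (x, y))))"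
      using h by (simp add: abs_mult)
    show "AE x in lborel. integrable lborel (\<lambda>y. h (fst (x, y)) * F' (snd (x, y)))"
      using iF' by simp
  qed simp
  have e: "(LINT z|(lborel \<Otimes>\<^sub>M lborel). h (fst z) * F' (snd z)) = (LINT t|lborel. h t) * (LINT x|lborel. F' x)"
    by (subst lborel_pair.integral_fst'[symmetric, OF i]) simp
  obtain N where N: "{x. F x \<noteq> F' x} \<subseteq> N" "N \<in> null_sets lborel"
    using ae by (auto elim!: AE_E simp: null_sets_def)
  have "emeasure (lborel \<Otimes>\<^sub>M lborel) (UNIV \<times> N) = emeasure lborel (UNIV :: 'a set) * emeasure lborel N"
    using N by (subst lborel.emeasure_pair_measure_Times) auto
  then have "(UNIV :: 'a set) \<times> N \<in> null_sets (lborel \<Otimes>\<^sub>M lborel)"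
    using N by (auto simp: null_sets_def intro!: pair_measureI)
  then have "AE z in (lborel :: ('a \<times> 'b) measure). z \<notin> UNIV \<times> N"
    by (simp add: lborel_prod AE_not_in)
  then have "AE z in (lborel :: ('a \<times> 'b) measure). h (fst z) * F' (snd z) = h (fst z) * F (snd z)"
    by eventually_elim (use N in auto)
  then have ae2: "AE z in (lebesgue :: ('a \<times> 'b) measure). h (fst z) * F' (snd z) = h (fst z) * F (snd z)"
    by (rule AE_completion)
  have i2: "integrable lebesgue (\<lambda>z::'a \<times> 'b. h (fst z) * F' (snd z))"
    using i by (simp add: integrable_completion lborel_prod)
  have m2: "(\<lambda>z::'a \<times> 'b. h (fst z) * F (snd z)) \<in> borel_measurable lebesgue"
    by (rule borel_measurable_AE[OF borel_measurable_integrable[OF i2] ae2])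
  show "integrable lebesgue (\<lambda>z::'a \<times> 'b. h (fst z) * F (snd z))"
    by (rule integrable_cong_AE_imp[OF i2 m2]) (use ae2 in \<open>auto elim: eventually_mono\<close>)
  have "(LINT z|lebesgue. h (fst z) * F (snd z)) = (LINT z|(lebesgue :: ('a \<times> 'b) measure). h (fst z) * F' (snd z))"
    by (rule integral_cong_AE[OF m2 borel_measurable_integrable[OF i2]]) (use ae2 in \<open>auto elim: eventually_mono\<close>)
  also have "\<dots> = (LINT t|lborel. h t) * (LINT x|lborel. F' x)"
    using e borel_measurable_integrable[OF i] by (simp add: integral_completion lborel_prod)
  finally show "(LINT z|lebesgue. h (fst z) * F (snd z)) = (LINT t|lborel. h t) * (LINT x|lebesgue. F x)"
    by (simp add: eF')
qed

text \<open>Young's inequality adapted to the time cut-off: one of the two terms on the right dominates, depending on which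
  side of \<open>a\<^sup>p\<^sup>-\<^sup>1 z = \<epsilon>\<close> the number \<open>a\<close> lies. On the second side the power of \<open>z\<close> left over is
  \<open>n + 1 - 1/(p - 1)\<close>; the exponent of the cut-off is chosen so large that this is non-negative.\<close>

lemma absorb_into_power:
  fixes a \<epsilon> z p :: real
  assumes p: "1 < p" and a: "0 \<le> a" and e: "0 < \<epsilon>" and z: "0 \<le> z" "z \<le> 1"
    and m: "1 / (p - 1) \<le> real (Suc n)"
  shows "\<epsilon> * a * z ^ Suc n \<le> a powr p * z ^ Suc (Suc n) + \<epsilon> powr (p / (p - 1))"
proof (cases "a = 0 \<or> z = 0")
  case True then show ?thesis by auto
next
  case False
  with a z have pos: "0 < a" "0 < z" by auto
  show ?thesis
  proof (cases "\<epsilon> \<le> a powr (p - 1) * z")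
    case True
    have "\<epsilon> * a * z ^ Suc n = \<epsilon> * (a * z ^ Suc n)" by simp
    also have "\<dots> \<le> (a powr (p - 1) * z) * (a * z ^ Suc n)"
      using pos by (intro mult_right_mono True) auto
    also have "\<dots> = a powr p * z ^ Suc (Suc n)"
      using pos by (simp add: powr_diff)
    finally show ?thesis by (simp add: add_increasing2)
  next
    case False
    define r where "r = 1 / (p - 1)"
    have r: "0 < r" using p by (simp add: r_def)
    have "a = (a powr (p - 1)) powr r" using pos p by (simp add: powr_powr r_def)
    also have "\<dots> \<le> (\<epsilon> / z) powr r"
      using False pos r by (intro powr_mono2) (auto simp: field_simps)
    finally have a_le: "a \<le> \<epsilon> powr r * z powr - r" using pos e by (simp add: powr_divide powr_minus field_simps)
    have "\<epsilon> * a * z ^ Suc n \<le> \<epsilon> * (\<epsilon> powr r * z powr - r) * z ^ Suc n"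
      using pos e by (intro mult_right_mono mult_left_mono a_le) auto
    also have "\<dots> = \<epsilon> powr (1 + r) * z powr (real (Suc n) - r)"
      using pos e by (simp add: powr_add powr_diff powr_minus powr_realpow[symmetric] field_simps del: of_nat_Suc power_Suc)
    also have "\<dots> \<le> \<epsilon> powr (1 + r) * 1"
      using pos z m by (intro mult_left_mono powr_le1) (auto simp: r_def)
    also have "1 + r = p / (p - 1)" using p by (simp add: r_def field_simps)
    finally show ?thesis using pos by (simp add: add_increasing)
  qed
qed

text \<open>The time cut-off. It vanishes to order \<open>m\<close> at time \<open>T\<close>, so that its derivative is controlled by a slightly smaller
  power, as \<open>absorb_into_power\<close> requires.\<close>

definition tcut :: "nat \<Rightarrow> real \<Rightarrow> real \<Rightarrow> real" where
  "tcut m T t = max 0 (1 - t / T) ^ m"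

lemma tcut_nonneg [simp]: "0 \<le> tcut m T t"
  by (simp add: tcut_def)

lemma tcut_le_1: "0 < T \<Longrightarrow> 0 \<le> t \<Longrightarrow> tcut m T t \<le> 1"
  unfolding tcut_def by (intro power_le_one) auto

lemma tcut_eq_0: "0 < T \<Longrightarrow> T \<le> t \<Longrightarrow> 0 < m \<Longrightarrow> tcut m T t = 0"
  by (simp add: tcut_def field_simps max_def)

lemma continuous_tcut: "continuous_on UNIV (tcut m T)"
  unfolding tcut_def[abs_def] divide_inverse by (intro continuous_intros)

lemma borel_measurable_tcut [measurable]: "tcut m T \<in> borel_measurable borel"
  by (rule borel_measurable_continuous_onI[OF continuous_tcut])

lemma tcut_deriv:
  assumes "T \<noteq> 0"
  shows "(tcut (Suc (Suc n)) T has_field_derivative (- real (Suc (Suc n)) / T * tcut (Suc n) T t)) (at t)"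
proof -
  have "((\<lambda>t. 1 - t / T) has_field_derivative (- 1 / T)) (at t)"
    using assms by (auto intro!: derivative_eq_intros)
  from DERIV_chain2[OF pos_part_power_deriv[of n] this] show ?thesis
    unfolding tcut_def[abs_def] by (rule DERIV_cong) (simp add: algebra_simps add_divide_distrib diff_divide_distrib)
qed

lemma profile_eq_0: "0 < k \<Longrightarrow> k \<le> v \<Longrightarrow> profile b k v = 0"
  by (simp add: profile_def max_def field_simps)

lemma Cc2_profile:
  assumes "0 < k" "0 < r"
  shows "Cc2 (\<lambda>\<xi> :: 'n::finite heis. profile b k (bracket (dil r \<xi>)))"
proof (rule Cc2I)
  show "C2 (\<lambda>\<xi> :: 'n heis. profile b k (bracket (dil r \<xi>)))"
  proof (rule C2_compose[OF C2_bracket_dil, where S = "{0<..}" and g' = "profile' b k" and g'' = "profile'' b k"])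
    show "continuous_on {0<..} (profile'' b k)"
      unfolding profile''_def[abs_def] divide_inverse by (intro continuous_intros) auto
  qed (use assms in \<open>auto intro: profile_deriv\<close>)
  show "compact (dil (1 / r) ` {\<xi> :: 'n heis. bracket \<xi> \<le> k})"
    by (intro compact_continuous_image compact_bracket_sublevel continuous_on_subset[OF continuous_dil]) auto
  fix \<xi> :: "'n heis" assume "\<xi> \<notin> dil (1 / r) ` {\<xi>. bracket \<xi> \<le> k}"
  moreover have "\<xi> = dil (1 / r) (dil r \<xi>)" using assms by (simp add: dil_def power_divide)
  ultimately have "\<not> bracket (dil r \<xi>) \<le> k" by blast
  then show "profile b k (bracket (dil r \<xi>)) = 0" using assms by (intro profile_eq_0) auto
qed

lemma frac_sublaplacian_scale: "frac_sublaplacian c s (\<lambda>\<xi>. a * u \<xi>) \<xi> = a * frac_sublaplacian c s u \<xi>"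
proof -
  have *: "(a * u (\<xi> \<circ>\<^sub>H \<eta>) + a * u (\<xi> \<circ>\<^sub>H (- \<eta>)) - 2 * (a * u \<xi>)) / w
      = a * ((u (\<xi> \<circ>\<^sub>H \<eta>) + u (\<xi> \<circ>\<^sub>H (- \<eta>)) - 2 * u \<xi>) / w)" for \<eta> w
    by (simp add: algebra_simps add_divide_distrib diff_divide_distrib)
  show ?thesis by (simp only: frac_sublaplacian_def * integral_mult_right_zero) simp
qed

definition half_space :: "(real \<times> 'a) set" where
  "half_space = {0<..} \<times> UNIV"

text \<open>For a product of a time cut-off and a truncated weight, each of the two operators acts on one factor only.\<close>

lemma global_weak_solution_test:
  fixes u :: "real \<Rightarrow> 'n::finite heis \<Rightarrow> real" and T r k b :: real and n :: nat
  assumes sol: "global_weak_solution c s p u0 f u" and "0 < T" "0 < r" "0 < k" "0 \<le> b"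
  defines "g \<equiv> \<lambda>\<xi>. profile b k (bracket (dil r \<xi>))" and "m \<equiv> Suc (Suc n)"
  defines "A \<equiv> \<lambda>z. u (fst z) (snd z) * (- real m / T * tcut (Suc n) T (fst z) * g (snd z)
      - tcut m T (fst z) * frac_sublaplacian c s g (snd z))"
    and "B \<equiv> \<lambda>z. \<bar>u (fst z) (snd z)\<bar> powr p * (tcut m T (fst z) * g (snd z))"
    and "G \<equiv> \<lambda>z. f (snd z) * (tcut m T (fst z) * g (snd z))"
  shows "set_integrable lebesgue half_space A" "set_integrable lebesgue half_space B"
    "integrable lebesgue (\<lambda>\<xi>. u0 \<xi> * g \<xi>)" "set_integrable lebesgue half_space G"
    "- (LINT z:half_space|lebesgue. A z) = (LINT z:half_space|lebesgue. B z)
       + (LINT \<xi>|lebesgue. u0 \<xi> * g \<xi>) + (LINT z:half_space|lebesgue. G z)"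
proof -
  let ?\<phi> = "\<lambda>t \<xi>. tcut m T t * g \<xi>"
  have d: "(tcut m T has_field_derivative (- real m / T * tcut (Suc n) T t)) (at t)" for t
    unfolding m_def using assms by (intro tcut_deriv) auto
  have tf: "test_function \<infinity> ?\<phi>"
  proof (rule test_function_product[OF _ d, where T = T])
    show "Cc2 g" unfolding g_def using assms by (intro Cc2_profile)
    show "continuous_on UNIV (\<lambda>t. - real m / T * tcut (Suc n) T t)"
      by (intro continuous_intros continuous_tcut)
    show "tcut m T t = 0" if "T \<le> t" for t using that assms by (intro tcut_eq_0) (auto simp: m_def)
  qed
  have nn: "0 \<le> ?\<phi> t \<xi>" for t \<xi>
    unfolding g_def using assms by (intro mult_nonneg_nonneg profile_bounds) auto
  have D: "{t. 0 < t \<and> ereal t < \<infinity>} \<times> UNIV = half_space" by (auto simp: half_space_def)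
  have eA: "(\<lambda>(t, \<xi>). u t \<xi> * (deriv (\<lambda>r. ?\<phi> r \<xi>) t - frac_sublaplacian c s (?\<phi> t) \<xi>)) = A"
    using DERIV_imp_deriv[OF DERIV_cmult_right[OF d]]
    by (auto simp: A_def fun_eq_iff frac_sublaplacian_scale)
  have eB: "(\<lambda>(t, \<xi>). \<bar>u t \<xi>\<bar> powr p * ?\<phi> t \<xi>) = B" "(\<lambda>(t, \<xi>). f \<xi> * ?\<phi> t \<xi>) = G"
    by (auto simp: B_def G_def fun_eq_iff)
  have t0: "?\<phi> 0 \<xi> = g \<xi>" for \<xi> by (simp add: tcut_def)
  have "set_integrable lebesgue half_space A \<and> set_integrable lebesgue half_space B \<and>
    integrable lebesgue (\<lambda>\<xi>. u0 \<xi> * g \<xi>) \<and> set_integrable lebesgue half_space G \<and>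
    - (LINT z:half_space|lebesgue. A z) = (LINT z:half_space|lebesgue. B z)
       + (LINT \<xi>|lebesgue. u0 \<xi> * g \<xi>) + (LINT z:half_space|lebesgue. G z)"
    using sol tf nn unfolding global_weak_solution_def weak_solution_def Let_def
    by (auto dest!: spec[of _ ?\<phi>] simp only: D eA eB t0) 
  then show "set_integrable lebesgue half_space A" "set_integrable lebesgue half_space B"
    "integrable lebesgue (\<lambda>\<xi>. u0 \<xi> * g \<xi>)" "set_integrable lebesgue half_space G"
    "- (LINT z:half_space|lebesgue. A z) = (LINT z:half_space|lebesgue. B z)
       + (LINT \<xi>|lebesgue. u0 \<xi> * g \<xi>) + (LINT z:half_space|lebesgue. G z)"
    by blast+
qed

lemma global_weak_solution_measurable:
  fixes u :: "real \<Rightarrow> 'n::finite heis \<Rightarrow> real"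
  assumes sol: "global_weak_solution c s p u0 f u"
  shows "(\<lambda>z. indicator half_space z * u (fst z) (snd z)) \<in> borel_measurable lebesgue"
proof (rule borel_measurable_LIMSEQ_real)
  let ?S = "\<lambda>n. {1 / real (Suc n)..real (Suc n)} \<times> {\<xi> :: 'n heis. bracket \<xi> \<le> real (Suc n)}"
  have L: "Lp_loc_Lp_loc p \<infinity> u" using sol by (simp add: global_weak_solution_def weak_solution_def)
  show "(\<lambda>z. indicator (?S n) z * u (fst z) (snd z)) \<in> borel_measurable lebesgue" for n
  proof -
    have "{1 / real (Suc n)..real (Suc n)} \<subseteq> {t. 0 < t \<and> ereal t < \<infinity>}"
    proof
      fix t assume t: "t \<in> {1 / real (Suc n)..real (Suc n)}"
      have "0 < 1 / real (Suc n)" by simp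
      also have "\<dots> \<le> t" using t by simp
      finally show "t \<in> {t. 0 < t \<and> ereal t < \<infinity>}" by simp
    qed
    then have "set_borel_measurable lebesgue (?S n) (\<lambda>(t, \<xi>). u t \<xi>)"
      using L compact_bracket_sublevel unfolding Lp_loc_Lp_loc_def by blast
    then show ?thesis by (simp add: set_borel_measurable_def case_prod_unfold)
  qed
  fix z :: "real \<times> 'n heis"
  show "(\<lambda>n. indicator (?S n) z * u (fst z) (snd z)) \<longlonglongrightarrow> indicator half_space z * u (fst z) (snd z)"
  proof (cases "0 < fst z")
    case False
    then have "z \<notin> ?S n" for n
    proof -
      have "0 < 1 / real (Suc n)" by simp
      moreover have "1 / real (Suc n) \<le> fst z" if "z \<in> ?S n" using that by auto
      ultimately show ?thesis using False by linarith
    qed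
    then show ?thesis using False by (cases z) (simp add: half_space_def)
  next
    case True
    obtain N :: nat where N: "max (max (fst z) (1 / fst z)) (bracket (snd z)) \<le> real N" using real_arch_simple by blast
    have "z \<in> ?S n" if "N \<le> n" for n
    proof -
      have le: "real N \<le> real (Suc n)" using that by simp
      then have "1 / fst z \<le> real (Suc n)" using N by linarith
      then have "1 / real (Suc n) \<le> fst z" using True by (simp add: field_simps del: of_nat_Suc)
      then show ?thesis using le N by (cases z) (auto simp del: of_nat_Suc)
    qed
    moreover have "z \<in> half_space" using True by (cases z) (simp add: half_space_def)
    ultimately have "\<forall>\<^sub>F n in sequentially. indicator (?S n) z * u (fst z) (snd z) = indicator half_space z * u (fst z) (snd z)"
      unfolding eventually_sequentially by (intro exI[of _ N]) (simp add: indicator_def)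
    then show ?thesis by (rule tendsto_eventually)
  qed
qed

text \<open>The solution space only asks \<open>\<bar>u\<bar>\<^sup>p\<close> to be integrable on compact sets away from \<open>t = 0\<close>, but the
  weak formulation demands that its integrals exist. For a bump with support \<open>bracket \<le> 2\<close>, the term with the
  sub-Laplacian controls \<open>\<bar>u\<bar>\<close> times the weight outside the support, by the lower bound on that term. On
  the support, and down to \<open>t = 0\<close>, the integral of \<open>\<bar>u\<bar>\<^sup>p\<close> against a larger bump controls \<open>\<bar>u\<bar>\<close>.\<close>

lemma solution_weighted_integrable:
  fixes u :: "real \<Rightarrow> 'n::finite heis \<Rightarrow> real" and c :: "nat \<Rightarrow> real \<Rightarrow> real"
  assumes sol: "global_weak_solution c s p u0 f u"
    and s: "0 < s" "s < 1" and b: "4 * b = heis_hdim TYPE('n) + 2 * s"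
    and c: "0 < c CARD('n) s" and p: "1 < p" and T: "0 < T" and r: "0 < r" "r \<le> 1"
  shows "set_integrable lebesgue half_space
    (\<lambda>z. \<bar>u (fst z) (snd z)\<bar> * indicator {..<T} (fst z) * bracket (dil r (snd z)) powr - b)"
proof -
  have b0: "0 \<le> b" using s b heis_hdim_ge_4[where 'n='n] by auto
  define U where "U z = indicator half_space z * u (fst z) (snd z)" for z
  have [measurable]: "U \<in> borel_measurable lebesgue"
    unfolding U_def[abs_def] by (rule global_weak_solution_measurable[OF sol])
  \<comment> \<open>The larger bump \<open>h\<close> is bounded below on the support of \<open>g\<close>, and the time horizon is doubled to keep the
    time cut-off away from zero on \<open>(0, T)\<close>.\<close>
  define g where "g = (\<lambda>\<xi> :: 'n heis. profile b 2 (bracket \<xi>))"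
  define h where "h = (\<lambda>\<xi> :: 'n heis. profile b 4 (bracket \<xi>))"
  have dil1: "dil 1 \<xi> = \<xi>" for \<xi> :: "'n heis" by (simp add: dil_def)
  obtain d where d: "0 < d" "\<And>\<xi> :: 'n heis. 2 \<le> bracket \<xi> \<Longrightarrow>
    d * bracket \<xi> powr - b \<le> \<bar>frac_sublaplacian c s g \<xi>\<bar>"
    unfolding g_def using frac_sublaplacian_profile_lower[where c = c and k = 2, OF s b c] by auto
  define A where "A z = u (fst z) (snd z) * (- real (Suc (Suc 0)) / (2 * T) * tcut (Suc 0) (2 * T) (fst z) * g (snd z)
      - tcut (Suc (Suc 0)) (2 * T) (fst z) * frac_sublaplacian c s g (snd z))" for z
  define B where "B z = \<bar>u (fst z) (snd z)\<bar> powr p * (tcut (Suc (Suc 0)) (2 * T) (fst z) * h (snd z))" for z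
  have iA: "integrable lebesgue (\<lambda>z. indicator half_space z * A z)"
    using global_weak_solution_test(1)[OF sol, of "2 * T" 1 2 b 0] T b0
    unfolding A_def g_def set_integrable_def by (simp add: dil1)
  have iB: "integrable lebesgue (\<lambda>z. indicator half_space z * B z)"
    using global_weak_solution_test(2)[OF sol, of "2 * T" 1 4 b 0] T b0
    unfolding B_def h_def set_integrable_def by (simp add: dil1)
  define K where "K = {0<..<T} \<times> {\<xi> :: 'n heis. bracket \<xi> \<le> 2}"
  have iK: "integrable lebesgue (indicator K :: _ \<Rightarrow> real)"
  proof -
    have "bounded K" unfolding K_def by (intro bounded_Times bounded_bracket_sublevel) auto
    moreover have "K \<in> sets borel"
    proof -
      have "{\<xi> :: 'n heis. bracket \<xi> \<le> 2} \<in> sets borel" by measurable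
      then show ?thesis unfolding K_def by (intro borel_Times) auto
    qed
    ultimately have "integrable lborel (indicator K :: _ \<Rightarrow> real)"
      using emeasure_bounded_finite[of K] by (simp add: integrable_indicator_iff top.not_eq_extremum)
    then show ?thesis using \<open>K \<in> sets borel\<close> by (simp add: integrable_completion)
  qed
  \<comment> \<open>The minimum of \<open>h\<close> on \<open>bracket \<le> 2\<close>, where its cut-off is at least one half.\<close>
  define e where "e = 2 powr - b / 8"
  have e: "0 < e" by (simp add: e_def)
  have tc: "1 / 4 \<le> tcut (Suc (Suc 0)) (2 * T) t" if "0 < t" "t < T" for t
  proof -
    have "1 / 2 \<le> max 0 (1 - t / (2 * T))" using that T by (simp add: field_simps)
    from power_mono[OF this, of 2] show ?thesis by (simp add: tcut_def power2_eq_square)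
  qed
  have i: "integrable lebesgue (\<lambda>z. indicator half_space z * (\<bar>u (fst z) (snd z)\<bar> * indicator {..<T} (fst z) * bracket (snd z) powr - b))"
  proof (rule Bochner_Integration.integrable_bound)
    show "integrable lebesgue (\<lambda>z. \<bar>4 / d * (indicator half_space z * A z)\<bar> + 4 / e * (indicator half_space z * B z) + indicator K z)"
      using iA iB iK by (intro Bochner_Integration.integrable_add Bochner_Integration.integrable_diff integrable_mult_right integrable_abs)
    have "(\<lambda>z. indicator half_space z * (\<bar>u (fst z) (snd z)\<bar> * indicator {..<T} (fst z) * bracket (snd z) powr - b))
       = (\<lambda>z. \<bar>U z\<bar> * (indicator {..<T} (fst z) * bracket (snd z) powr - b))"
      by (auto simp: U_def fun_eq_iff abs_mult indicator_def)
    also have "\<dots> \<in> borel_measurable lebesgue"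
    proof -
      have "(\<lambda>z :: real \<times> 'n heis. indicator {..<T} (fst z) * bracket (snd z) powr - b :: real) \<in> borel_measurable borel"
        by (subst borel_prod[symmetric]) measurable
      then have "(\<lambda>z :: real \<times> 'n heis. indicator {..<T} (fst z) * bracket (snd z) powr - b :: real) \<in> borel_measurable lebesgue"
        by (intro measurable_completion) simp
      then show ?thesis by measurable
    qed
    finally show "(\<lambda>z. indicator half_space z * (\<bar>u (fst z) (snd z)\<bar> * indicator {..<T} (fst z) * bracket (snd z) powr - b)) \<in> borel_measurable lebesgue" .
    have "norm (indicator half_space z * (\<bar>u (fst z) (snd z)\<bar> * indicator {..<T} (fst z) * bracket (snd z) powr - b))
      \<le> \<bar>4 / d * (indicator half_space z * A z)\<bar> + 4 / e * (indicator half_space z * B z) + indicator K z" for z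
    proof (cases "0 < fst z \<and> fst z < T")
      case False
      then show ?thesis
        using d e by (cases z) (auto simp: half_space_def indicator_def B_def h_def intro!: add_nonneg_nonneg
            divide_nonneg_nonneg mult_nonneg_nonneg profile_bounds b0)
    next
      case True
      obtain t \<xi> where z: "z = (t, \<xi>)" by (cases z)
      have t: "0 < t" "t < T" using True z by auto
      have hs: "indicator half_space z = (1 :: real)" using t by (simp add: half_space_def z)
      have B0: "0 \<le> B z" unfolding B_def h_def
        by (intro mult_nonneg_nonneg profile_bounds b0) auto
      have "\<bar>u t \<xi>\<bar> * bracket \<xi> powr - b \<le> 4 / d * \<bar>A z\<bar> + 4 / e * B z + indicator K z"
      proof (cases "2 \<le> bracket \<xi>")
        case True
        have "g \<xi> = 0" unfolding g_def using True by (intro profile_eq_0) auto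
        then have "\<bar>A z\<bar> = \<bar>u t \<xi>\<bar> * tcut (Suc (Suc 0)) (2 * T) t * \<bar>frac_sublaplacian c s g \<xi>\<bar>"
          by (simp add: A_def z abs_mult)
        also have "\<dots> \<ge> \<bar>u t \<xi>\<bar> * (1 / 4) * (d * bracket \<xi> powr - b)"
          using d(1) by (intro mult_mono d(2)[OF True] tc[OF t] order_refl) auto
        finally have "\<bar>u t \<xi>\<bar> * bracket \<xi> powr - b \<le> 4 / d * \<bar>A z\<bar>" using d(1) by (simp add: field_simps)
        moreover have "0 \<le> 4 / e * B z" using e B0 by simp
        moreover have "0 \<le> (indicator K z :: real)" by simp
        ultimately show ?thesis by linarith
      next
        case False
        then have "z \<in> K" using t by (simp add: K_def z)
        have "e \<le> h \<xi>"
        proof -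
          have 1: "2 powr - b \<le> bracket \<xi> powr - b" using False b0 by (intro powr_mono2') auto
          have half: "1 / 2 \<le> max 0 (1 - bracket \<xi> / 4)" using False by linarith
          have 2: "(1/2) ^ 3 \<le> max 0 (1 - bracket \<xi> / 4) ^ 3" by (rule power_mono[OF half]) simp
          have "2 powr - b * (1/2) ^ 3 \<le> bracket \<xi> powr - b * max 0 (1 - bracket \<xi> / 4) ^ 3"
            by (rule mult_mono[OF 1 2]) auto
          then show ?thesis by (simp add: h_def profile_def e_def power3_eq_cube)
        qed
        then have "(1 / 4) * e \<le> tcut (Suc (Suc 0)) (2 * T) t * h \<xi>" using e by (intro mult_mono tc[OF t]) auto
        then have "\<bar>u t \<xi>\<bar> powr p * ((1 / 4) * e) \<le> B z"
          unfolding B_def z fst_conv snd_conv by (intro mult_left_mono) auto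
        then have 1: "\<bar>u t \<xi>\<bar> powr p \<le> 4 / e * B z" using e by (simp add: field_simps)
        have "\<bar>u t \<xi>\<bar> \<le> 1 + \<bar>u t \<xi>\<bar> powr p"
        proof (cases "\<bar>u t \<xi>\<bar> \<le> 1")
          case False
          then have "\<bar>u t \<xi>\<bar> powr 1 \<le> \<bar>u t \<xi>\<bar> powr p" using p by (intro powr_mono) auto
          then show ?thesis using False by simp
        qed (simp add: add_increasing2)
        moreover have "\<bar>u t \<xi>\<bar> * bracket \<xi> powr - b \<le> \<bar>u t \<xi>\<bar>"
        proof -
          have "bracket \<xi> powr - b \<le> 1 powr - b" using b0 by (intro powr_mono2') auto
          then show ?thesis by (simp add: mult_left_le)
        qed
        moreover have "0 \<le> 4 / d * \<bar>A z\<bar>" using d by simp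
        moreover have "(indicator K z :: real) = 1" using \<open>z \<in> K\<close> by simp
        ultimately show ?thesis using 1 by linarith
      qed
      then show ?thesis using t d unfolding hs by (simp add: z abs_mult)
    qed
    then show "AE z in lebesgue. norm (indicator half_space z * (\<bar>u (fst z) (snd z)\<bar> * indicator {..<T} (fst z) * bracket (snd z) powr - b))
      \<le> norm (\<bar>4 / d * (indicator half_space z * A z)\<bar> + 4 / e * (indicator half_space z * B z) + indicator K z)"
      by (intro AE_I2) (rule order_trans, assumption, simp)
  qed
  show ?thesis unfolding set_integrable_def real_scaleR_def
  proof (rule Bochner_Integration.integrable_bound[OF integrable_mult_right[OF i, of "(r ^ 4) powr - b"]])
    have "(\<lambda>z. indicator half_space z * (\<bar>u (fst z) (snd z)\<bar> * indicator {..<T} (fst z) * bracket (dil r (snd z)) powr - b))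
       = (\<lambda>z. \<bar>U z\<bar> * (indicator {..<T} (fst z) * bracket (dil r (snd z)) powr - b))"
      by (auto simp: U_def fun_eq_iff abs_mult indicator_def)
    also have "\<dots> \<in> borel_measurable lebesgue"
    proof -
      have "(\<lambda>z :: real \<times> 'n heis. indicator {..<T} (fst z) * bracket (dil r (snd z)) powr - b :: real) \<in> borel_measurable borel"
        by (subst borel_prod[symmetric]) measurable
      then have "(\<lambda>z :: real \<times> 'n heis. indicator {..<T} (fst z) * bracket (dil r (snd z)) powr - b :: real) \<in> borel_measurable lebesgue"
        by (intro measurable_completion) simp
      then show ?thesis by measurable
    qed
    finally show "(\<lambda>z. indicator half_space z * (\<bar>u (fst z) (snd z)\<bar> * indicator {..<T} (fst z) * bracket (dil r (snd z)) powr - b)) \<in> borel_measurable lebesgue" .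
    have le: "bracket (dil r \<xi>) powr - b \<le> (r ^ 4) powr - b * bracket \<xi> powr - b" for \<xi> :: "'n heis"
    proof -
      have "0 < r ^ 4 * bracket \<xi>" using r bracket_pos[of \<xi>] by (simp del: bracket_pos)
      then have "bracket (dil r \<xi>) powr - b \<le> (r ^ 4 * bracket \<xi>) powr - b"
        using b0 bracket_dil_ge[OF r, of \<xi>] by (intro powr_mono2') auto
      then show ?thesis using r by (simp add: powr_mult)
    qed
    have "norm (indicator half_space z * (\<bar>u (fst z) (snd z)\<bar> * indicator {..<T} (fst z) * bracket (dil r (snd z)) powr - b))
      \<le> norm ((r ^ 4) powr - b * (indicator half_space z * (\<bar>u (fst z) (snd z)\<bar> * indicator {..<T} (fst z) * bracket (snd z) powr - b)))" for z
      using mult_left_mono[OF le[of "snd z"], of "\<bar>u (fst z) (snd z)\<bar>"]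
      by (simp add: abs_mult indicator_def algebra_simps)
    then show "AE z in lebesgue. norm (indicator half_space z * (\<bar>u (fst z) (snd z)\<bar> * indicator {..<T} (fst z) * bracket (dil r (snd z)) powr - b))
      \<le> norm ((r ^ 4) powr - b * (indicator half_space z * (\<bar>u (fst z) (snd z)\<bar> * indicator {..<T} (fst z) * bracket (snd z) powr - b)))"
      by (intro AE_I2)
  qed
qed


section \<open>Letting the truncation and the scale go to infinity\<close>

lemma bracket_dil_powr_integrable:
  assumes b: "heis_hdim TYPE('n::finite) < 4 * b" and r: "0 < r"
  shows "integrable lebesgue (\<lambda>\<xi> :: 'n heis. bracket (dil r \<xi>) powr - b)"
    and "(LINT \<xi>|lebesgue. bracket (dil r (\<xi> :: 'n heis)) powr - b)
      = r powr - heis_hdim TYPE('n) * (LINT \<xi>|(lebesgue :: 'n heis measure). bracket \<xi> powr - b)"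
proof -
  define Q where "Q = heis_hdim TYPE('n)"
  define J where "J = (\<integral>\<^sup>+\<xi>. ennreal (bracket \<xi> powr - b) \<partial>(lborel :: 'n heis measure))"
  have J: "J < \<infinity>" unfolding J_def by (rule nn_integral_bracket_powr[OF b])
  have e: "(\<integral>\<^sup>+\<xi>. ennreal (bracket (dil r (\<xi> :: 'n heis)) powr - b) \<partial>lborel) = ennreal (r powr - Q) * J"
  proof -
    have "ennreal (r powr - Q) * J = ennreal (r powr - Q) * (ennreal (r powr Q) * (\<integral>\<^sup>+\<xi>. ennreal (bracket (dil r (\<xi> :: 'n heis)) powr - b) \<partial>lborel))"
      unfolding J_def Q_def using r by (subst nn_integral_dil) auto
    then show ?thesis using r by (simp add: mult.assoc[symmetric] ennreal_mult[symmetric] powr_add[symmetric])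
  qed
  have m: "(\<lambda>\<xi> :: 'n heis. bracket (dil r \<xi>) powr - b) \<in> borel_measurable lebesgue"
    "(\<lambda>\<xi> :: 'n heis. bracket \<xi> powr - b) \<in> borel_measurable lebesgue"
    by (rule measurable_completion; measurable)+
  have "(\<integral>\<^sup>+\<xi>. ennreal (norm (bracket (dil r (\<xi> :: 'n heis)) powr - b)) \<partial>lebesgue) < \<infinity>"
    using J by (simp add: nn_integral_completion e ennreal_mult_less_top)
  with m(1) show i: "integrable lebesgue (\<lambda>\<xi> :: 'n heis. bracket (dil r \<xi>) powr - b)" by (rule integrableI_bounded)
  have "(LINT \<xi>|lebesgue. bracket (dil r (\<xi> :: 'n heis)) powr - b) = enn2real (ennreal (r powr - Q) * J)"
    by (subst integral_eq_nn_integral[OF m(1)]) (simp_all add: nn_integral_completion e)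
  also have "\<dots> = r powr - Q * enn2real J" by (simp add: enn2real_mult)
  also have "enn2real J = (LINT \<xi>|(lebesgue :: 'n heis measure). bracket \<xi> powr - b)"
    by (subst integral_eq_nn_integral[OF m(2)]) (simp_all add: nn_integral_completion J_def)
  finally show "(LINT \<xi>|lebesgue. bracket (dil r (\<xi> :: 'n heis)) powr - b)
      = r powr - heis_hdim TYPE('n) * (LINT \<xi>|(lebesgue :: 'n heis measure). bracket \<xi> powr - b)"
    by (simp add: Q_def)
qed

lemma L_infty_mult_integrable:
  assumes f: "L_infty f" and g: "integrable lebesgue g"
  shows "integrable lebesgue (\<lambda>x. f x * g x)"
proof -
  obtain C where C: "AE x in lebesgue. \<bar>f x\<bar> \<le> C" and [measurable]: "f \<in> borel_measurable lebesgue"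
    using f by (auto simp: L_infty_def)
  note [measurable] = borel_measurable_integrable[OF g]
  show ?thesis
  proof (rule Bochner_Integration.integrable_bound)
    show "integrable lebesgue (\<lambda>x. \<bar>C\<bar> * \<bar>g x\<bar>)" using g by simp
    show "AE x in lebesgue. norm (f x * g x) \<le> norm (\<bar>C\<bar> * \<bar>g x\<bar>)"
      using C by eventually_elim (auto simp: abs_mult intro!: mult_right_mono)
  qed measurable
qed

text \<open>The linear term is bounded by \<open>\<epsilon> \<bar>u\<bar>\<close> times the full weight \<open>\<Phi>\<close>, but only \<open>\<bar>u\<bar>\<^sup>p\<close> times the truncated weight \<open>g\<close> is
  available to absorb it. The part belonging to \<open>g\<close> is absorbed pointwise; the part belonging to \<open>\<Phi> - g\<close> is kept on
  the right, where it will vanish in the limit. The choice \<open>T = r\<^sup>-\<^sup>2\<^sup>s\<close> balances the time derivative with the sub-Laplacian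
  at spatial scale \<open>1/r\<close>.\<close>

lemma tested_inequality:
  fixes u :: "real \<Rightarrow> 'n::finite heis \<Rightarrow> real" and c :: "nat \<Rightarrow> real \<Rightarrow> real" and n :: nat
  assumes sol: "global_weak_solution c s p u0 f u"
    and s: "0 < s" "s < 1" and b: "4 * b = heis_hdim TYPE('n) + 2 * s"
    and c: "0 < c CARD('n) s" and p: "1 < p" and n: "1 / (p - 1) \<le> real (Suc n)"
    and u0: "AE \<xi> in lebesgue. 0 \<le> u0 \<xi>" and f: "L_infty f"
    and C0: "0 \<le> C0" "\<And>k r (\<xi> :: 'n heis). \<lbrakk>0 < k; 0 < r\<rbrakk> \<Longrightarrow>
      \<bar>frac_sublaplacian c s (\<lambda>\<zeta>. profile b k (bracket (dil r \<zeta>))) \<xi>\<bar>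
        \<le> C0 * r powr (2 * s) * bracket (dil r \<xi>) powr - b"
    and r: "0 < r" "r \<le> 1" and k: "0 < k"
  defines "T \<equiv> r powr - (2 * s)" and "\<epsilon> \<equiv> (real (Suc (Suc n)) + C0) * r powr (2 * s)"
  shows "(LINT t|lborel. indicator {0<..} t * tcut (Suc (Suc n)) T t) * (LINT \<xi>|lebesgue. f \<xi> * profile b k (bracket (dil r \<xi>)))
    \<le> \<epsilon> * (LINT z|lebesgue. indicator half_space z * (\<bar>u (fst z) (snd z)\<bar> * tcut (Suc n) T (fst z)
          * (bracket (dil r (snd z)) powr - b - profile b k (bracket (dil r (snd z))))))
      + \<epsilon> powr (p / (p - 1)) * T * (LINT \<xi>|lebesgue. bracket (dil r (\<xi> :: 'n heis)) powr - b)"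
    and "integrable lebesgue (\<lambda>z. indicator half_space z * (\<bar>u (fst z) (snd z)\<bar> * tcut (Suc n) T (fst z)
          * (bracket (dil r (snd z)) powr - b - profile b k (bracket (dil r (snd z))))))"
proof -
  have b0: "0 \<le> b" and bQ: "heis_hdim TYPE('n) < 4 * b" using s b heis_hdim_ge_4[where 'n='n] by auto
  define m where "m = Suc (Suc n)"
  define q where "q = p / (p - 1)"
  define g where "g \<xi> = profile b k (bracket (dil r \<xi>))" for \<xi> :: "'n heis"
  define \<Phi> where "\<Phi> \<xi> = bracket (dil r \<xi>) powr - b" for \<xi> :: "'n heis"
  have T: "0 < T" using r by (simp add: T_def)
  have \<epsilon>: "0 < \<epsilon>" unfolding \<epsilon>_def using r C0 by (intro mult_pos_pos add_pos_nonneg) auto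
  have T1: "1 / T = r powr (2 * s)" by (simp add: T_def powr_minus divide_inverse)
  have g0: "0 \<le> g \<xi>" and g\<Phi>: "g \<xi> \<le> \<Phi> \<xi>" for \<xi>
    unfolding g_def \<Phi>_def using profile_bounds[of k "bracket (dil r \<xi>)" b] k b0 by auto
  have \<Phi>0: "0 \<le> \<Phi> \<xi>" for \<xi> by (simp add: \<Phi>_def)
  have [measurable]: "g \<in> borel_measurable borel" "\<Phi> \<in> borel_measurable borel"
    unfolding g_def[abs_def] \<Phi>_def[abs_def] by measurable
  define A where "A z = u (fst z) (snd z) * (- real m / T * tcut (Suc n) T (fst z) * g (snd z)
      - tcut m T (fst z) * frac_sublaplacian c s g (snd z))" for z
  define B where "B z = \<bar>u (fst z) (snd z)\<bar> powr p * (tcut m T (fst z) * g (snd z))" for z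
  define G where "G z = f (snd z) * (tcut m T (fst z) * g (snd z))" for z
  define H where "H z = indicator half_space z * (\<bar>u (fst z) (snd z)\<bar> * tcut (Suc n) T (fst z) * (\<Phi> (snd z) - g (snd z)))" for z
  define E where "E z = indicator {0<..<T} (fst z) * g (snd z)" for z
  note test = global_weak_solution_test(1,2,5)[where n = n, OF sol T r(1) k b0, folded g_def m_def]
  have iA: "integrable lebesgue (\<lambda>z. indicator half_space z * A z)"
    and iB: "integrable lebesgue (\<lambda>z. indicator half_space z * B z)"
    using test(1,2) unfolding A_def B_def set_integrable_def real_scaleR_def by simp_all
  have ident: "- (LINT z|lebesgue. indicator half_space z * A z) = (LINT z|lebesgue. indicator half_space z * B z)
       + (LINT \<xi>|lebesgue. u0 \<xi> * g \<xi>) + (LINT z|lebesgue. indicator half_space z * G z)"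
    using test(3) unfolding A_def B_def G_def set_lebesgue_integral_def real_scaleR_def by simp
  have i\<Phi>: "integrable lebesgue \<Phi>" unfolding \<Phi>_def[abs_def] by (rule bracket_dil_powr_integrable[OF bQ r(1)])
  have ig: "integrable lebesgue g"
    by (rule Bochner_Integration.integrable_bound[OF i\<Phi>])
      (use g0 g\<Phi> \<Phi>0 in \<open>auto intro!: measurable_completion AE_I2\<close>)
  have iH: "integrable lebesgue H"
  proof (rule Bochner_Integration.integrable_bound)
    show "integrable lebesgue (\<lambda>z. indicator half_space z * (\<bar>u (fst z) (snd z)\<bar> * indicator {..<T} (fst z) * \<Phi> (snd z)))"
      using solution_weighted_integrable[OF sol s b c p T r]
      unfolding set_integrable_def real_scaleR_def \<Phi>_def .
    note [measurable] = global_weak_solution_measurable[OF sol]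
    have "(\<lambda>z :: real \<times> 'n heis. tcut (Suc n) T (fst z) * (\<Phi> (snd z) - g (snd z))) \<in> borel_measurable borel"
      by (subst borel_prod[symmetric]) measurable
    then have [measurable]: "(\<lambda>z :: real \<times> 'n heis. tcut (Suc n) T (fst z) * (\<Phi> (snd z) - g (snd z))) \<in> borel_measurable lebesgue"
      by (intro measurable_completion) simp
    have "H = (\<lambda>z. \<bar>indicator half_space z * u (fst z) (snd z)\<bar> * (tcut (Suc n) T (fst z) * (\<Phi> (snd z) - g (snd z))))"
      by (auto simp: H_def fun_eq_iff abs_mult indicator_def)
    also have "\<dots> \<in> borel_measurable lebesgue" by measurable
    finally show "H \<in> borel_measurable lebesgue" .
    have "norm (H z) \<le> norm (indicator half_space z * (\<bar>u (fst z) (snd z)\<bar> * indicator {..<T} (fst z) * \<Phi> (snd z)))" for z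
    proof (cases "z \<in> half_space")
      case True
      then have t: "0 < fst z" by (auto simp: half_space_def)
      have "tcut (Suc n) T (fst z) \<le> indicator {..<T} (fst z)"
        using tcut_le_1[OF T, of "fst z" "Suc n"] tcut_eq_0[OF T, of "fst z" "Suc n"] t by (auto simp: indicator_def)
      then have "\<bar>u (fst z) (snd z)\<bar> * tcut (Suc n) T (fst z) * (\<Phi> (snd z) - g (snd z))
          \<le> \<bar>u (fst z) (snd z)\<bar> * indicator {..<T} (fst z) * \<Phi> (snd z)"
        using g0 g\<Phi> by (intro mult_mono) auto
      moreover have "0 \<le> \<bar>u (fst z) (snd z)\<bar> * tcut (Suc n) T (fst z) * (\<Phi> (snd z) - g (snd z))"
        using g\<Phi> by (intro mult_nonneg_nonneg) auto
      ultimately show ?thesis using True by (simp add: H_def)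
    qed (simp add: H_def)
    then show "AE z in lebesgue. norm (H z) \<le> norm (indicator half_space z * (\<bar>u (fst z) (snd z)\<bar> * indicator {..<T} (fst z) * \<Phi> (snd z)))"
      by (intro AE_I2)
  qed
  then show "integrable lebesgue (\<lambda>z. indicator half_space z * (\<bar>u (fst z) (snd z)\<bar> * tcut (Suc n) T (fst z)
          * (bracket (dil r (snd z)) powr - b - profile b k (bracket (dil r (snd z))))))"
    unfolding H_def[abs_def] \<Phi>_def g_def .
  have iT: "integrable lborel (indicator {0<..<T} :: real \<Rightarrow> real)" using T by (intro integrable_real_indicator) auto
  have E: "integrable lebesgue E" "(LINT z|lebesgue. E z) = T * (LINT \<xi>|lebesgue. g \<xi>)"
    using lebesgue_product_integral[OF iT ig] T unfolding E_def[abs_def] by simp_all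
  \<comment> \<open>The pointwise form of the inequality; the rest is integration.\<close>
  have pt: "- (indicator half_space z * A z) - indicator half_space z * B z \<le> \<epsilon> * H z + \<epsilon> powr q * E z" for z
  proof (cases "z \<in> half_space")
    case False
    then show ?thesis using g0 by (cases z) (simp add: H_def E_def half_space_def)
  next
    case True
    obtain t \<xi> where z: "z = (t, \<xi>)" by (cases z)
    have t: "0 < t" using True by (simp add: half_space_def z)
    define y where "y = max 0 (1 - t / T)"
    have y: "0 \<le> y" "y \<le> 1" "tcut (Suc n) T t = y ^ Suc n" "tcut m T t = y ^ Suc (Suc n)"
      using t T by (auto simp: y_def tcut_def m_def)
    define a where "a = \<bar>u t \<xi>\<bar>"
    have a: "0 \<le> a" by (simp add: a_def)
    have ym: "y ^ Suc (Suc n) \<le> y ^ Suc n" using y by (intro power_decreasing) auto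
    have L: "\<bar>frac_sublaplacian c s g \<xi>\<bar> \<le> C0 * r powr (2 * s) * \<Phi> \<xi>"
      unfolding g_def[abs_def] \<Phi>_def by (rule C0(2)[OF k r(1)])
    have "- A z \<le> \<bar>A z\<bar>" by simp
    also have "\<bar>A z\<bar> = a * \<bar>- real m / T * y ^ Suc n * g \<xi> - y ^ Suc (Suc n) * frac_sublaplacian c s g \<xi>\<bar>"
      by (simp only: A_def z fst_conv snd_conv y abs_mult a_def)
    also have "\<dots> \<le> a * (real m * r powr (2 * s) * y ^ Suc n * \<Phi> \<xi> + y ^ Suc n * (C0 * r powr (2 * s) * \<Phi> \<xi>))"
    proof (intro mult_left_mono a order_trans[OF abs_triangle_ineq4] add_mono)
      have "\<bar>- real m / T * y ^ Suc n * g \<xi>\<bar> = real m * (1 / T) * y ^ Suc n * g \<xi>"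
        using T y(1) g0[of \<xi>] by (simp add: abs_mult)
      also have "\<dots> \<le> real m * r powr (2 * s) * y ^ Suc n * \<Phi> \<xi>"
        unfolding T1 using y(1) g0 g\<Phi> by (intro mult_left_mono) auto
      finally show "\<bar>- real m / T * y ^ Suc n * g \<xi>\<bar> \<le> real m * r powr (2 * s) * y ^ Suc n * \<Phi> \<xi>" .
      have "\<bar>y ^ Suc (Suc n) * frac_sublaplacian c s g \<xi>\<bar> = y ^ Suc (Suc n) * \<bar>frac_sublaplacian c s g \<xi>\<bar>"
        using y(1) by (simp add: abs_mult)
      also have "\<dots> \<le> y ^ Suc n * (C0 * r powr (2 * s) * \<Phi> \<xi>)"
        using y(1) by (intro mult_mono ym L) auto
      finally show "\<bar>y ^ Suc (Suc n) * frac_sublaplacian c s g \<xi>\<bar> \<le> y ^ Suc n * (C0 * r powr (2 * s) * \<Phi> \<xi>)" .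
    qed
    also have "\<dots> = \<epsilon> * a * y ^ Suc n * \<Phi> \<xi>"
      by (simp add: \<epsilon>_def m_def algebra_simps)
    finally have A: "- A z \<le> \<epsilon> * a * y ^ Suc n * \<Phi> \<xi>" .
    have "\<epsilon> * a * y ^ Suc n * g \<xi> \<le> B z + \<epsilon> powr q * E z"
    proof (cases "t < T")
      case True
      have "\<epsilon> * a * y ^ Suc n \<le> a powr p * y ^ Suc (Suc n) + \<epsilon> powr q"
        unfolding q_def by (rule absorb_into_power[OF p a \<epsilon> y(1,2) n])
      from mult_right_mono[OF this g0[of \<xi>]] show ?thesis
        using True t by (simp add: B_def E_def z y(4) a_def algebra_simps)
    next
      case False
      then have "y = 0" using T by (simp add: y_def field_simps max_def)
      then show ?thesis using g0[of \<xi>] by (simp add: B_def E_def z y(4))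
    qed
    moreover have "\<epsilon> * H z = \<epsilon> * a * y ^ Suc n * \<Phi> \<xi> - \<epsilon> * a * y ^ Suc n * g \<xi>"
      using True by (simp add: H_def z y(3) a_def algebra_simps)
    ultimately show ?thesis using A True by simp
  qed
  have "(LINT z|lebesgue. - (indicator half_space z * A z) - indicator half_space z * B z)
      \<le> (LINT z|lebesgue. \<epsilon> * H z + \<epsilon> powr q * E z)"
    using iA iB iH E(1) pt by (intro integral_mono) auto
  also have "\<dots> = \<epsilon> * (LINT z|lebesgue. H z) + \<epsilon> powr q * T * (LINT \<xi>|lebesgue. g \<xi>)"
    using iH E by simp
  also have "(LINT \<xi>|lebesgue. g \<xi>) \<le> (LINT \<xi>|lebesgue. \<Phi> \<xi>)"
    by (intro integral_mono ig i\<Phi> g\<Phi>)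
  finally have le: "(LINT z|lebesgue. - (indicator half_space z * A z) - indicator half_space z * B z)
      \<le> \<epsilon> * (LINT z|lebesgue. H z) + \<epsilon> powr q * T * (LINT \<xi>|lebesgue. \<Phi> \<xi>)"
    using T by (simp add: mult_left_mono)
  have "(LINT z|lebesgue. - (indicator half_space z * A z) - indicator half_space z * B z)
     = - (LINT z|lebesgue. indicator half_space z * A z) - (LINT z|lebesgue. indicator half_space z * B z)"
    using iA iB by simp
  also have "\<dots> = (LINT \<xi>|lebesgue. u0 \<xi> * g \<xi>) + (LINT z|lebesgue. indicator half_space z * G z)"
    using ident by simp
  finally have "(LINT \<xi>|lebesgue. u0 \<xi> * g \<xi>) + (LINT z|lebesgue. indicator half_space z * G z)
     \<le> \<epsilon> * (LINT z|lebesgue. H z) + \<epsilon> powr q * T * (LINT \<xi>|lebesgue. \<Phi> \<xi>)" using le by simp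
  moreover have "0 \<le> (LINT \<xi>|lebesgue. u0 \<xi> * g \<xi>)"
    by (rule integral_nonneg_AE) (use u0 g0 in \<open>auto elim: eventually_mono\<close>)
  moreover have "(LINT z|lebesgue. indicator half_space z * G z)
     = (LINT t|lborel. indicator {0<..} t * tcut m T t) * (LINT \<xi>|lebesgue. f \<xi> * g \<xi>)"
  proof -
    have it: "integrable lborel (\<lambda>t. indicator {0<..} t * tcut m T t)"
    proof (rule Bochner_Integration.integrable_bound[OF iT])
      show "AE t in lborel. norm (indicator {0<..} t * tcut m T t) \<le> norm (indicator {0<..<T} t :: real)"
        using tcut_le_1[OF T] tcut_eq_0[OF T] by (intro AE_I2) (auto simp: indicator_def m_def)
    qed measurable
    have "(\<lambda>z. indicator half_space z * G z) = (\<lambda>z. (indicator {0<..} (fst z) * tcut m T (fst z)) * (f (snd z) * g (snd z)))"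
      by (auto simp: fun_eq_iff G_def half_space_def indicator_def)
    then show ?thesis using lebesgue_product_integral(2)[OF it L_infty_mult_integrable[OF f ig]] by simp
  qed
  ultimately show "(LINT t|lborel. indicator {0<..} t * tcut (Suc (Suc n)) T t) * (LINT \<xi>|lebesgue. f \<xi> * profile b k (bracket (dil r \<xi>)))
    \<le> \<epsilon> * (LINT z|lebesgue. indicator half_space z * (\<bar>u (fst z) (snd z)\<bar> * tcut (Suc n) T (fst z)
          * (bracket (dil r (snd z)) powr - b - profile b k (bracket (dil r (snd z))))))
      + \<epsilon> powr (p / (p - 1)) * T * (LINT \<xi>|lebesgue. bracket (dil r (\<xi> :: 'n heis)) powr - b)"
    unfolding H_def[abs_def] g_def \<Phi>_def m_def q_def by simp
qed

lemma profile_tendsto: "(\<lambda>j. profile b (real (Suc j)) v) \<longlonglongrightarrow> v powr - b"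
proof -
  have "(\<lambda>j. v / real (Suc j)) \<longlonglongrightarrow> 0" by (rule lim_const_over_n[THEN LIMSEQ_Suc])
  then have "(\<lambda>j. v powr - b * max 0 (1 - v / real (Suc j)) ^ 3) \<longlonglongrightarrow> v powr - b * max 0 (1 - 0) ^ 3"
    by (intro tendsto_intros)
  then show ?thesis by (simp add: profile_def)
qed

text \<open>Dominated convergence as the truncation is removed; the majorant for the remainder is the one of
  \<open>solution_weighted_integrable\<close>.\<close>

lemma tested_inequality_limit:
  fixes u :: "real \<Rightarrow> 'n::finite heis \<Rightarrow> real" and c :: "nat \<Rightarrow> real \<Rightarrow> real" and n :: nat
  assumes sol: "global_weak_solution c s p u0 f u"
    and s: "0 < s" "s < 1" and b: "4 * b = heis_hdim TYPE('n) + 2 * s"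
    and c: "0 < c CARD('n) s" and p: "1 < p" and n: "1 / (p - 1) \<le> real (Suc n)"
    and u0: "AE \<xi> in lebesgue. 0 \<le> u0 \<xi>" and f: "L_infty f"
    and C0: "0 \<le> C0" "\<And>k r (\<xi> :: 'n heis). \<lbrakk>0 < k; 0 < r\<rbrakk> \<Longrightarrow>
      \<bar>frac_sublaplacian c s (\<lambda>\<zeta>. profile b k (bracket (dil r \<zeta>))) \<xi>\<bar>
        \<le> C0 * r powr (2 * s) * bracket (dil r \<xi>) powr - b"
    and r: "0 < r" "r \<le> 1"
  defines "T \<equiv> r powr - (2 * s)" and "\<epsilon> \<equiv> (real (Suc (Suc n)) + C0) * r powr (2 * s)"
  shows "(LINT t|lborel. indicator {0<..} t * tcut (Suc (Suc n)) T t) * (LINT \<xi>|lebesgue. f \<xi> * bracket (dil r \<xi>) powr - b)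
    \<le> \<epsilon> powr (p / (p - 1)) * T * (LINT \<xi>|lebesgue. bracket (dil r (\<xi> :: 'n heis)) powr - b)"
proof -
  have b0: "0 \<le> b" and bQ: "heis_hdim TYPE('n) < 4 * b" using s b heis_hdim_ge_4[where 'n='n] by auto
  have T: "0 < T" using r by (simp add: T_def)
  define H where "H j z = indicator half_space z * (\<bar>u (fst z) (snd z)\<bar> * tcut (Suc n) T (fst z)
          * (bracket (dil r (snd z)) powr - b - profile b (real (Suc j)) (bracket (dil r (snd z)))))" for j z
  let ?g = "\<lambda>j \<xi> :: 'n heis. profile b (real (Suc j)) (bracket (dil r \<xi>))"
  let ?\<Phi> = "\<lambda>\<xi> :: 'n heis. bracket (dil r \<xi>) powr - b"
  have g: "0 \<le> ?g j \<xi>" "?g j \<xi> \<le> ?\<Phi> \<xi>" for j \<xi>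
    using profile_bounds(1,2)[of "real (Suc j)" "bracket (dil r \<xi>)" b] b0 by auto
  have iH: "integrable lebesgue (H j)" for j
    unfolding H_def[abs_def] T_def
    by (rule tested_inequality(2)[OF sol s b c p n u0 f C0 r]) auto
  have le: "(LINT t|lborel. indicator {0<..} t * tcut (Suc (Suc n)) T t) * (LINT \<xi>|lebesgue. f \<xi> * ?g j \<xi>)
    \<le> \<epsilon> * (LINT z|lebesgue. H j z) + \<epsilon> powr (p / (p - 1)) * T * (LINT \<xi>|lebesgue. ?\<Phi> \<xi>)" for j
    unfolding H_def T_def \<epsilon>_def
    by (rule tested_inequality(1)[OF sol s b c p n u0 f C0 r]) auto
  have i\<Phi>: "integrable lebesgue ?\<Phi>" by (rule bracket_dil_powr_integrable[OF bQ r(1)])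
  have if\<Phi>: "integrable lebesgue (\<lambda>\<xi>. f \<xi> * ?\<Phi> \<xi>)" by (rule L_infty_mult_integrable[OF f i\<Phi>])
  have [measurable]: "f \<in> borel_measurable lebesgue" using f by (simp add: L_infty_def)
  have 1: "(\<lambda>j. LINT \<xi>|lebesgue. f \<xi> * ?g j \<xi>) \<longlonglongrightarrow> (LINT \<xi>|lebesgue. f \<xi> * ?\<Phi> \<xi>)"
  proof (rule integral_dominated_convergence[where w = "\<lambda>\<xi>. norm (f \<xi> * ?\<Phi> \<xi>)"])
    show "(\<lambda>\<xi>. f \<xi> * ?g j \<xi>) \<in> borel_measurable lebesgue" for j
    proof -
      have "?g j \<in> borel_measurable lebesgue" by (rule measurable_completion) measurable
      then show ?thesis by measurable
    qed
    show "AE \<xi> in lebesgue. (\<lambda>j. f \<xi> * ?g j \<xi>) \<longlonglongrightarrow> f \<xi> * ?\<Phi> \<xi>"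
      by (intro AE_I2 tendsto_mult tendsto_const profile_tendsto)
    show "AE \<xi> in lebesgue. norm (f \<xi> * ?g j \<xi>) \<le> norm (f \<xi> * ?\<Phi> \<xi>)" for j
      using g by (intro AE_I2) (auto simp: abs_mult intro!: mult_left_mono)
  qed (use if\<Phi> in auto)
  have 2: "(\<lambda>j. LINT z|lebesgue. H j z) \<longlonglongrightarrow> (LINT z|(lebesgue :: (real \<times> 'n heis) measure). 0)"
  proof (rule integral_dominated_convergence)
    show "integrable lebesgue (\<lambda>z. indicator half_space z * (\<bar>u (fst z) (snd z)\<bar> * indicator {..<T} (fst z) * ?\<Phi> (snd z)))"
      using solution_weighted_integrable[OF sol s b c p T r]
      unfolding set_integrable_def real_scaleR_def .
    show "H j \<in> borel_measurable lebesgue" for j by (rule borel_measurable_integrable[OF iH])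
    have "(\<lambda>j. H j z) \<longlonglongrightarrow> indicator half_space z * (\<bar>u (fst z) (snd z)\<bar> * tcut (Suc n) T (fst z)
          * (?\<Phi> (snd z) - ?\<Phi> (snd z)))" for z
      unfolding H_def by (intro tendsto_mult tendsto_const tendsto_diff profile_tendsto)
    then show "AE z in lebesgue. (\<lambda>j. H j z) \<longlonglongrightarrow> 0" by simp
    have "norm (H j z) \<le> indicator half_space z * (\<bar>u (fst z) (snd z)\<bar> * indicator {..<T} (fst z) * ?\<Phi> (snd z))" for j z
    proof (cases "z \<in> half_space")
      case True
      then have t: "0 < fst z" by (auto simp: half_space_def)
      have "tcut (Suc n) T (fst z) \<le> indicator {..<T} (fst z)"
        using tcut_le_1[OF T, of "fst z" "Suc n"] tcut_eq_0[OF T, of "fst z" "Suc n"] t by (auto simp: indicator_def)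
      then have "\<bar>u (fst z) (snd z)\<bar> * tcut (Suc n) T (fst z) * (?\<Phi> (snd z) - ?g j (snd z))
          \<le> \<bar>u (fst z) (snd z)\<bar> * indicator {..<T} (fst z) * ?\<Phi> (snd z)"
        using g by (intro mult_mono) auto
      moreover have "0 \<le> \<bar>u (fst z) (snd z)\<bar> * tcut (Suc n) T (fst z) * (?\<Phi> (snd z) - ?g j (snd z))"
        using g by (intro mult_nonneg_nonneg) auto
      ultimately show ?thesis using True by (simp add: H_def)
    qed (simp add: H_def)
    then show "AE z in lebesgue. norm (H j z) \<le> indicator half_space z * (\<bar>u (fst z) (snd z)\<bar> * indicator {..<T} (fst z) * ?\<Phi> (snd z))" for j
      by (intro AE_I2)
  qed simp
  show ?thesis
  proof (rule LIMSEQ_le)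
    show "(\<lambda>j. (LINT t|lborel. indicator {0<..} t * tcut (Suc (Suc n)) T t) * (LINT \<xi>|lebesgue. f \<xi> * ?g j \<xi>))
      \<longlonglongrightarrow> (LINT t|lborel. indicator {0<..} t * tcut (Suc (Suc n)) T t) * (LINT \<xi>|lebesgue. f \<xi> * ?\<Phi> \<xi>)"
      by (intro tendsto_mult tendsto_const 1)
    have "(\<lambda>j. \<epsilon> * (LINT z|lebesgue. H j z) + \<epsilon> powr (p / (p - 1)) * T * (LINT \<xi>|lebesgue. ?\<Phi> \<xi>))
      \<longlonglongrightarrow> \<epsilon> * (LINT z|(lebesgue :: (real \<times> 'n heis) measure). 0) + \<epsilon> powr (p / (p - 1)) * T * (LINT \<xi>|lebesgue. ?\<Phi> \<xi>)"
      by (intro tendsto_mult tendsto_add tendsto_const 2)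
    then show "(\<lambda>j. \<epsilon> * (LINT z|lebesgue. H j z) + \<epsilon> powr (p / (p - 1)) * T * (LINT \<xi>|lebesgue. ?\<Phi> \<xi>))
      \<longlonglongrightarrow> \<epsilon> powr (p / (p - 1)) * T * (LINT \<xi>|lebesgue. ?\<Phi> \<xi>)" by simp
  qed (use le in auto)
qed

text \<open>The cut-off is at least \<open>2\<^sup>-\<^sup>m\<close> on the first half of the interval.\<close>

lemma tcut_integral_ge:
  assumes T: "0 < T" and m: "0 < m"
  shows "T / 2 ^ Suc m \<le> (LINT t|lborel. indicator {0<..} t * tcut m T t)"
proof -
  have "(LINT t|lborel. (1/2 :: real) ^ m * indicator {0<..<T / 2} t) \<le> (LINT t|lborel. indicator {0<..} t * tcut m T t)"
  proof (rule integral_mono)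
    show "integrable lborel (\<lambda>t. indicator {0<..} t * tcut m T t)"
    proof (rule Bochner_Integration.integrable_bound)
      show "integrable lborel (indicator {0<..<T} :: real \<Rightarrow> real)" using T by (intro integrable_real_indicator) auto
      show "AE t in lborel. norm (indicator {0<..} t * tcut m T t) \<le> norm (indicator {0<..<T} t :: real)"
        using tcut_le_1[OF T] tcut_eq_0[OF T] m by (intro AE_I2) (auto simp: indicator_def)
    qed measurable
    show "integrable lborel (\<lambda>t. (1/2 :: real) ^ m * indicator {0<..<T / 2} t)" using T by simp
    fix t :: real
    show "(1/2 :: real) ^ m * indicator {0<..<T / 2} t \<le> indicator {0<..} t * tcut m T t"
    proof (cases "0 < t \<and> t < T / 2")
      case True
      then have "1 / 2 \<le> max 0 (1 - t / T)" using T by (simp add: field_simps)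
      then have "(1/2) ^ m \<le> max 0 (1 - t / T) ^ m" by (rule power_mono) simp
      then show ?thesis using True by (simp add: tcut_def)
    qed (simp add: indicator_def)
  qed
  then show ?thesis using T by (simp add: field_simps power_one_over)
qed

text \<open>At spatial scale tending to infinity the weights increase to 1, so the positive and negative parts converge
  monotonically. Treating them separately covers the case where the integral of \<open>f\<close> is infinite: only the negative part must be
  finite.\<close>

lemma weighted_integral_eventually_ge:
  fixes f :: "'n::finite heis \<Rightarrow> real"
  assumes b: "heis_hdim TYPE('n) < 4 * b"
    and f: "L_infty f" "quasi_integrable f" "0 < ext_integral f"
  obtains \<delta> where "0 < \<delta>"
    "\<forall>\<^sub>F i in sequentially. \<delta> \<le> (LINT \<xi>|lebesgue. f \<xi> * bracket (dil (1 / real (Suc i)) \<xi>) powr - b)"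
proof -
  have b0: "0 \<le> b" using b heis_hdim_ge_4[where 'n='n] by simp
  define \<Phi> where "\<Phi> i \<xi> = bracket (dil (1 / real (Suc i)) \<xi>) powr - b" for i and \<xi> :: "'n heis"
  have \<Phi>: "0 \<le> \<Phi> i \<xi>" "\<Phi> i \<xi> \<le> 1" for i \<xi>
  proof -
    show "0 \<le> \<Phi> i \<xi>" by (simp add: \<Phi>_def)
    have "\<Phi> i \<xi> \<le> 1 powr - b" unfolding \<Phi>_def using b0 by (intro powr_mono2') auto
    then show "\<Phi> i \<xi> \<le> 1" by simp
  qed
  have \<Phi>_mono: "\<Phi> i \<xi> \<le> \<Phi> j \<xi>" if "i \<le> j" for i j \<xi>
  proof -
    have "1 / real (Suc j) \<le> 1 / real (Suc i)" using that by (simp add: field_simps)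
    then have "(1 / real (Suc j)) ^ 4 \<le> (1 / real (Suc i)) ^ 4" by (intro power_mono) auto
    then have "bracket (dil (1 / real (Suc j)) \<xi>) \<le> bracket (dil (1 / real (Suc i)) \<xi>)"
      unfolding bracket_dil by (intro add_left_mono mult_right_mono) auto
    then show ?thesis unfolding \<Phi>_def using b0 by (intro powr_mono2') auto
  qed
  have \<Phi>_lim: "(\<lambda>i. \<Phi> i \<xi>) \<longlonglongrightarrow> 1" for \<xi>
  proof -
    have "(\<lambda>i. 1 / real (Suc i)) \<longlonglongrightarrow> 0" by (rule lim_const_over_n[THEN LIMSEQ_Suc])
    then have "(\<lambda>i. (1 + (1 / real (Suc i)) ^ 4 * (bracket \<xi> - 1)) powr - b) \<longlonglongrightarrow> (1 + 0 ^ 4 * (bracket \<xi> - 1)) powr - b"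
      by (intro tendsto_intros) auto
    then show ?thesis by (simp add: \<Phi>_def bracket_dil)
  qed
  have [measurable]: "f \<in> borel_measurable lebesgue" using f by (simp add: L_infty_def)
  have [measurable]: "\<Phi> i \<in> borel_measurable lebesgue" for i
    unfolding \<Phi>_def[abs_def] by (rule measurable_completion) measurable
  have int: "integrable lebesgue (\<lambda>\<xi>. f \<xi> * \<Phi> i \<xi>)" for i
    unfolding \<Phi>_def by (intro L_infty_mult_integrable f bracket_dil_powr_integrable b) simp
  define P where "P = (\<integral>\<^sup>+ x. ennreal (f x) \<partial>lebesgue)"
  define M where "M = (\<integral>\<^sup>+ x. ennreal (- f x) \<partial>lebesgue)"
  define Pi where "Pi i = (\<integral>\<^sup>+ x. ennreal (f x * \<Phi> i x) \<partial>lebesgue)" for i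
  define Mi where "Mi i = (\<integral>\<^sup>+ x. ennreal (- (f x * \<Phi> i x)) \<partial>lebesgue)" for i
  have PM: "0 < enn2ereal P - enn2ereal M" "P < \<infinity> \<or> M < \<infinity>"
    using f(2,3) by (simp_all add: ext_integral_def quasi_integrable_def P_def M_def)
  have "M \<noteq> \<infinity>"
  proof
    assume "M = \<infinity>"
    with PM(2) have "P < \<infinity>" by simp
    then obtain \<rho> where "P = ennreal \<rho>" "0 \<le> \<rho>" by (cases P) auto
    with \<open>M = \<infinity>\<close> PM(1) show False by (simp add: enn2ereal_top)
  qed
  then obtain \<mu> where \<mu>: "M = ennreal \<mu>" "0 \<le> \<mu>" by (cases M) auto
  have "M < P"
  proof (cases P)
    case (real \<rho>)
    with PM(1) \<mu> have "\<mu> < \<rho>" by simp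
    then show ?thesis using real \<mu> by (simp add: ennreal_less_iff)
  qed (use \<mu> in simp)
  then obtain y where y: "M < y" "y < P" using dense by blast
  then obtain \<nu> where \<nu>: "y = ennreal \<nu>" "0 \<le> \<nu>" by (cases y) auto
  have "\<mu> < \<nu>" using y(1) \<mu> \<nu> by (simp add: ennreal_less_iff)
  have "Pi \<longlonglongrightarrow> P"
    unfolding Pi_def[abs_def] P_def
  proof (rule nn_integral_LIMSEQ)
    show "incseq (\<lambda>i x. ennreal (f x * \<Phi> i x))"
      unfolding incseq_def le_fun_def using \<Phi> \<Phi>_mono
      by (auto simp: ennreal_mult'' intro!: mult_left_mono ennreal_leI)
    show "(\<lambda>x. ennreal (f x * \<Phi> i x)) \<in> borel_measurable lebesgue" for i by measurable
    have "(\<lambda>i. ennreal (f x * \<Phi> i x)) \<longlonglongrightarrow> ennreal (f x * 1)" for x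
      by (intro tendsto_ennrealI tendsto_mult tendsto_const \<Phi>_lim)
    then show "(\<lambda>i. ennreal (f x * \<Phi> i x)) \<longlonglongrightarrow> ennreal (f x)" for x by simp
  qed
  then have "\<forall>\<^sub>F i in sequentially. ennreal \<nu> < Pi i" using y(2) \<nu> by (intro order_tendstoD) auto
  then have "\<forall>\<^sub>F i in sequentially. \<nu> - \<mu> \<le> (LINT \<xi>|lebesgue. f \<xi> * \<Phi> i \<xi>)"
  proof eventually_elim
    case (elim i)
    have "Mi i \<le> M"
      unfolding Mi_def M_def
    proof (rule nn_integral_mono)
      fix x
      have "ennreal (- f x * \<Phi> i x) \<le> ennreal (- f x) * 1"
        using \<Phi>[of i x] mult_left_mono[of "ennreal (\<Phi> i x)" 1 "ennreal (- f x)"]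
        by (subst ennreal_mult'') (auto simp: ennreal_le_1)
      then show "ennreal (- (f x * \<Phi> i x)) \<le> ennreal (- f x)" by simp
    qed
    then have 1: "enn2real (Mi i) \<le> \<mu>" using \<mu> by (metis enn2real_leI)
    have "Pi i < \<infinity>"
      using int[of i] by (simp add: Pi_def real_integrable_def less_top)
    then have 2: "\<nu> \<le> enn2real (Pi i)" using elim \<nu>(2)
      by (metis enn2real_ennreal enn2real_mono less_imp_le infinity_ennreal_def)
    have "(LINT \<xi>|lebesgue. f \<xi> * \<Phi> i \<xi>) = enn2real (Pi i) - enn2real (Mi i)"
      unfolding Pi_def Mi_def by (rule real_lebesgue_integral_def[OF int])
    then show ?case using 1 2 by simp
  qed
  with \<open>\<mu> < \<nu>\<close> show thesis by (intro that[of "\<nu> - \<mu>"]) (auto simp: \<Phi>_def)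
qed

theorem theorem1p3:
  fixes c :: "nat \<Rightarrow> real \<Rightarrow> real"
    and s p :: real
    and u0 f :: "'n::finite heis \<Rightarrow> real"
  assumes "\<And>N r. 1 \<le> N \<Longrightarrow> 0 < r \<Longrightarrow> r < 1 \<Longrightarrow> 0 < c N r"
    and "0 < s" and "s < 1"
    and "1 < p" and "p < heis_hdim TYPE('n) / (heis_hdim TYPE('n) - 2 * s)"
    and "L_infty u0" and "L1_loc u0"
    and "L_infty f" and "L1_loc f"
    and "AE \<xi> in lebesgue. 0 \<le> u0 \<xi>"
    and "quasi_integrable f" and "0 < ext_integral f"
  shows "\<nexists>u. global_weak_solution c s p u0 f u"
proof
  assume "\<exists>u. global_weak_solution c s p u0 f u"
  then obtain u where sol: "global_weak_solution c s p u0 f u" by blast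
  note s = assms(2,3) and p = assms(4)
  define Q where "Q = heis_hdim TYPE('n)"
  \<comment> \<open>The weight decays exactly as fast as the kernel: slower decay would lose the integrability of the solution
    against it, faster decay the bound on its sub-Laplacian.\<close>
  define b where "b = (Q + 2 * s) / 4"
  define q where "q = p / (p - 1)"
  have b: "4 * b = heis_hdim TYPE('n) + 2 * s" by (simp add: b_def Q_def)
  have bQ: "heis_hdim TYPE('n) < 4 * b" using b s by simp
  have c: "0 < c CARD('n) s" using assms(1)[of "CARD('n)" s] s by (simp add: Suc_leI)
  have Q4: "4 \<le> Q" unfolding Q_def by (rule heis_hdim_ge_4)
  have expo: "Q < 2 * s * q"
  proof -
    have "p * (Q - 2 * s) < Q" using assms(5) Q4 s by (simp add: Q_def field_simps)
    then have "Q * (p - 1) < 2 * s * p" by (simp add: algebra_simps)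
    then show ?thesis using p by (simp add: q_def field_simps)
  qed
  obtain n :: nat where "1 / (p - 1) \<le> real n" using real_arch_simple by blast
  then have n: "1 / (p - 1) \<le> real (Suc n)" by simp
  obtain C0 where C0: "0 \<le> C0" "\<And>k r (\<xi> :: 'n heis). \<lbrakk>0 < k; 0 < r\<rbrakk> \<Longrightarrow>
      \<bar>frac_sublaplacian c s (\<lambda>\<zeta>. profile b k (bracket (dil r \<zeta>))) \<xi>\<bar>
        \<le> C0 * r powr (2 * s) * bracket (dil r \<xi>) powr - b"
    using frac_sublaplacian_profile_upper[where c = c, OF s b] by blast
  obtain \<delta> where \<delta>: "0 < \<delta>"
    "\<forall>\<^sub>F i in sequentially. \<delta> \<le> (LINT \<xi>|lebesgue. f \<xi> * bracket (dil (1 / real (Suc i)) \<xi>) powr - b)"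
    using weighted_integral_eventually_ge[OF bQ assms(8,11,12)] by blast
  define I where "I = (LINT \<xi>|(lebesgue :: 'n heis measure). bracket \<xi> powr - b)"
  define K where "K = 2 ^ Suc (Suc (Suc n)) * (real (Suc (Suc n)) + C0) powr q * I"
  have bound: "\<delta> \<le> K * r powr (2 * s * q - Q)"
    if r: "0 < r" "r \<le> 1" and le: "\<delta> \<le> (LINT \<xi>|lebesgue. f \<xi> * bracket (dil r \<xi>) powr - b)" for r
  proof -
    define T where "T = r powr - (2 * s)"
    define \<kappa> where "\<kappa> = (LINT t|lborel. indicator {0<..} t * tcut (Suc (Suc n)) T t)"
    have T: "0 < T" using r by (simp add: T_def)
    have \<kappa>: "T / 2 ^ Suc (Suc (Suc n)) \<le> \<kappa>" unfolding \<kappa>_def by (rule tcut_integral_ge[OF T]) simp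
    have "T / 2 ^ Suc (Suc (Suc n)) * \<delta> \<le> \<kappa> * (LINT \<xi>|lebesgue. f \<xi> * bracket (dil r \<xi>) powr - b)"
    proof (rule mult_mono[OF \<kappa> le])
      show "0 \<le> \<kappa>" by (rule order_trans[OF _ \<kappa>]) (use T in simp)
    qed (use \<delta> in simp)
    also have "\<dots> \<le> ((real (Suc (Suc n)) + C0) * r powr (2 * s)) powr q * T * (LINT \<xi>|lebesgue. bracket (dil r (\<xi> :: 'n heis)) powr - b)"
      unfolding \<kappa>_def T_def q_def
      by (rule tested_inequality_limit[OF sol s b c p n assms(10,8) C0 r])
    also have "\<dots> = ((real (Suc (Suc n)) + C0) * r powr (2 * s)) powr q * T * (r powr - Q * I)"
      unfolding I_def Q_def by (simp only: bracket_dil_powr_integrable(2)[OF bQ r(1)])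
    also have "\<dots> = T / 2 ^ Suc (Suc (Suc n)) * (K * r powr (2 * s * q - Q))"
    proof -
      have "((real (Suc (Suc n)) + C0) * r powr (2 * s)) powr q = (real (Suc (Suc n)) + C0) powr q * r powr (2 * s * q)"
        using r C0(1) by (subst powr_mult) (auto simp: powr_powr)
      then show ?thesis using r by (simp add: K_def powr_diff powr_minus field_simps)
    qed
    finally show ?thesis
    proof (rule mult_left_le_imp_le)
      show "0 < T / 2 ^ Suc (Suc (Suc n))" using T by simp
    qed
  qed
  have ev: "\<forall>\<^sub>F i in sequentially. \<delta> \<le> K * (1 / real (Suc i)) powr (2 * s * q - Q)"
    using \<delta>(2) by eventually_elim (rule bound, auto)
  have "(\<lambda>i. K * (1 / real (Suc i)) powr (2 * s * q - Q)) \<longlonglongrightarrow> K * 0"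
  proof (intro tendsto_mult tendsto_const)
    have "(\<lambda>i. 1 / real (Suc i)) \<longlonglongrightarrow> 0" by (rule lim_const_over_n[THEN LIMSEQ_Suc])
    then show "(\<lambda>i. (1 / real (Suc i)) powr (2 * s * q - Q)) \<longlonglongrightarrow> 0"
      using expo by (intro tendsto_zero_powrI[where b = "2 * s * q - Q"] tendsto_const) auto
  qed
  from tendsto_lowerbound[OF this ev] have "\<delta> \<le> 0" by simp
  with \<delta>(1) show False by simp
qed

end
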